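(* To every semidensity ${\bf s}$ in an odd symplectic superspace $E^{n.n}$ there corresponds a semidensity $\mathcal{A}({\bf s})$ defined on non-degenerated $(1.1)$-codimensional surfaces embedded in this superspace. The value $\mathcal{A}(M,{\bf s})$ of this semidensity on a $(1.1)$-codimensional non-degenerated surface $M$, in Darboux coordinates $(x^\mu,\theta_\nu)$ adjusted to $M$, is given by $$\mathcal{A}(M,{\bf s})=\frac{\partial s(x^\mu,\theta_\nu)}{\partial\theta_0}\Big\vert_{x^0=\theta_0=0}\,|\widetilde{dx\,d\theta}|^{1/2},\qquad {\bf s}=s(x^\mu,\theta_\nu)\,|dx\,d\theta|^{1/2}.$$ That is, the right-hand side is a well-defined semidensity on $M$, independent of the choice of Darboux coordinates adjusted to $M$.
   Context: $E^{n.n}$ is a superspace with $n$ even and $n$ odd coordinates (points are $\Lambda$-points, $\Lambda$ an arbitrary Grassmann algebra). It is an odd symplectic superspace if it is endowed with an odd closed non-degenerate two-form $\Omega$; $\{\cdot,\cdot\}$ is the corresponding odd Poisson (Buttin) bracket. Darboux coordinates, here numbered $(x^\mu,\theta_\mu)$ with $\mu=0,1,\dots,n-1$, $x^\mu$ even and $\theta_\mu$ odd, are coordinates with $\{x^\mu,x^\nu\}=0$, $\{\theta_\mu,\theta_\nu\}=0$, $\{x^\mu,\theta_\nu\}=\delta^\mu_\nu$. A semidensity is an object given in coordinates by ${\bf s}=s(z)|dz|^{1/2}$, where $s$ is multiplied by the square root of the Berezinian of the coordinate transformation under a change of coordinates; it may take even or odd values. A surface $M$ embedded in $E^{n.n}$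 is non-degenerated if the pull-back of $\Omega$ to $M$ is non-degenerate; this pull-back is the induced symplectic structure on $M$. A surface of codimension $(1.1)$ has dimension $(n-1.n-1)$. For a non-degenerated surface $M$ of codimension $(1.1)$, Darboux coordinates $(x^0,x^i,\theta_0,\theta_j)$ ($i,j=1,\dots,n-1$) of $E^{n.n}$ (in a vicinity of an arbitrary point of $M$) are called adjusted to $M$ if $M$ is given in them by the equations $x^0=\theta_0=0$; such coordinates exist, and $(x^i,\theta_j)$ are then Darboux coordinates on $M$ for the induced symplectic structure. Notation: $|\widetilde{dx\,d\theta}|=|dx^1\cdots dx^{n-1}d\theta_1\cdots d\theta_{n-1}|$. *)

theory Defs
  imports
    "HOL-Analysis.Derivative"
    "HOL-Analysis.Function_Topology"
    "HOL-Library.Infinite_Typeclass"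
    "Jordan_Normal_Form.Determinant"
begin

section \<open>Grassmann algebras\<close>

text \<open>
  The Grassmann algebra on the generators \<open>'l\<close>: an element is given by its coefficients at
  the monomials, a monomial being the finite set of the generators occurring in it (multiplied
  in increasing order).
\<close>

typedef 'l grassmann =
  "{f :: 'l set \<Rightarrow> real. finite {S. f S \<noteq> 0} \<and> (\<forall>S. f S \<noteq> 0 \<longrightarrow> finite S)}"
  morphisms gcoeff Abs_grassmann
  by (rule exI[of _ "\<lambda>_. 0"]) simp

setup_lifting type_definition_grassmann

definition gsign :: "'l::linorder set \<Rightarrow> 'l set \<Rightarrow> real" where
  "gsign A B = (-1) ^ card {(a, b). a \<in> A \<and> b \<in> B \<and> b < a}"

definition gmul :: "('l::linorder set \<Rightarrow> real) \<Rightarrow> ('l set \<Rightarrow> real) \<Rightarrow> 'l set \<Rightarrow> real" where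
  "gmul f g S = (\<Sum>A\<in>Pow S. gsign A (S - A) * f A * g (S - A))"

lemma finite_inv: "finite A \<Longrightarrow> finite B \<Longrightarrow> finite {(a, b). a \<in> A \<and> b \<in> B \<and> b < a}"
  by (rule finite_subset[of _ "A \<times> B"]) auto

lemma gsign_Un_right:
  assumes "finite A" "finite B" "finite C" "B \<inter> C = {}"
  shows "gsign A (B \<union> C) = gsign A B * gsign A C"
proof -
  have "{(a, b). a \<in> A \<and> b \<in> B \<union> C \<and> b < a} =
        {(a, b). a \<in> A \<and> b \<in> B \<and> b < a} \<union> {(a, b). a \<in> A \<and> b \<in> C \<and> b < a}" by auto
  moreover have "{(a, b). a \<in> A \<and> b \<in> B \<and> b < a} \<inter> {(a, b). a \<in> A \<and> b \<in> C \<and> b < a} = {}"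
    using assms(4) by auto
  ultimately show ?thesis unfolding gsign_def
    by (simp add: card_Un_disjoint finite_inv assms power_add)
qed

lemma gsign_Un_left:
  assumes "finite A" "finite B" "finite C" "A \<inter> B = {}"
  shows "gsign (A \<union> B) C = gsign A C * gsign B C"
proof -
  have "{(a, b). a \<in> A \<union> B \<and> b \<in> C \<and> b < a} =
        {(a, b). a \<in> A \<and> b \<in> C \<and> b < a} \<union> {(a, b). a \<in> B \<and> b \<in> C \<and> b < a}" by auto
  moreover have "{(a, b). a \<in> A \<and> b \<in> C \<and> b < a} \<inter> {(a, b). a \<in> B \<and> b \<in> C \<and> b < a} = {}"
    using assms(4) by auto
  ultimately show ?thesis unfolding gsign_def
    by (simp add: card_Un_disjoint finite_inv assms power_add)
qed

lemma gsign_swap: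
  fixes A B :: "'l::linorder set"
  assumes "finite A" "finite B" "A \<inter> B = {}"
  shows "gsign B A = (-1) ^ (card A * card B) * gsign A B"
proof -
  define P where "P = {(a, b). a \<in> A \<and> b \<in> B \<and> b < a}"
  define Q where "Q = {(a, b). a \<in> A \<and> b \<in> B \<and> a < b}"
  have "A \<times> B = P \<union> Q"
  proof (rule Set.set_eqI)
    fix p :: "'l \<times> 'l"
    obtain a b where p: "p = (a, b)" by (cases p)
    show "p \<in> A \<times> B \<longleftrightarrow> p \<in> P \<union> Q"
      using assms(3) linorder_less_linear[of a b] unfolding p P_def Q_def by blast
  qed
  moreover have "P \<inter> Q = {}" unfolding P_def Q_def by auto
  moreover have "finite P" unfolding P_def by (rule finite_inv) (fact assms)+
  moreover have "finite Q"
    by (rule finite_subset[of _ "A \<times> B"]) (auto simp: Q_def assms)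
  ultimately have sum: "card A * card B = card P + card Q"
    using card_Un_disjoint[of P Q] card_cartesian_product[of A B] by simp
  have "{(b, a). b \<in> B \<and> a \<in> A \<and> a < b} = Q\<inverse>" unfolding Q_def by blast
  then have swap: "card {(b, a). b \<in> B \<and> a \<in> A \<and> a < b} = card Q"
    by (simp only: card_inverse)
  have "(-1::real) ^ (card A * card B) * (-1) ^ card P
      = (-1) ^ card Q * ((-1) ^ card P * (-1) ^ card P)"
    unfolding sum power_add by (simp only: mult_ac)
  also have "\<dots> = (-1) ^ card Q" by simp
  finally show ?thesis unfolding gsign_def swap P_def[symmetric] by simp
qed

lemma gsign_empty [simp]: "gsign {} B = 1" "gsign A {} = 1"
  by (simp_all add: gsign_def)

lemma gmul_infinite: "infinite S \<Longrightarrow> gmul f g S = 0"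
  unfolding gmul_def by (simp add: finite_Pow_iff)

lemma gmul_assoc: "gmul (gmul f g) h S = gmul f (gmul g h) S"
proof (cases "finite S")
  case True
  have fin: "A \<subseteq> S \<Longrightarrow> finite A" for A using True finite_subset by blast
  have "gmul (gmul f g) h S =
      (\<Sum>T\<in>Pow S. \<Sum>A\<in>Pow T. gsign T (S - T) * gsign A (T - A) * f A * g (T - A) * h (S - T))"
    unfolding gmul_def by (simp add: sum_distrib_left sum_distrib_right mult_ac)
  also have "\<dots> = (\<Sum>(T, A)\<in>(SIGMA T:Pow S. Pow T).
      gsign T (S - T) * gsign A (T - A) * f A * g (T - A) * h (S - T))"
    using fin by (subst sum.Sigma) (auto simp: True)
  also have "\<dots> = (\<Sum>(A, B)\<in>(SIGMA A:Pow S. Pow (S - A)).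
      gsign A (S - A) * gsign B (S - A - B) * f A * g B * h (S - A - B))"
  proof (rule sum.reindex_bij_witness[of _ "\<lambda>(A, B). (A \<union> B, A)" "\<lambda>(T, A). (A, T - A)"],
         goal_cases)
    case (5 p)
    then obtain T A where p: "p = (T, A)" and TA: "T \<subseteq> S" "A \<subseteq> T" by auto
    have f: "finite A" "finite (T - A)" "finite (S - T)" using TA fin by auto
    have e: "S - A - (T - A) = S - T" "S - A = (T - A) \<union> (S - T)" using TA by auto
    have "gsign T (S - T) = gsign A (S - T) * gsign (T - A) (S - T)"
      using gsign_Un_left[of A "T - A" "S - T"] f TA by (simp add: Un_absorb1)
    moreover have "gsign A (S - A) = gsign A (T - A) * gsign A (S - T)"
      unfolding e(2) using gsign_Un_right[of A "T - A" "S - T"] f by auto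
    ultimately show ?case by (simp add: p e(1))
  qed auto
  also have "\<dots> = (\<Sum>A\<in>Pow S. \<Sum>B\<in>Pow (S - A).
      gsign A (S - A) * gsign B (S - A - B) * f A * g B * h (S - A - B))"
    using fin by (subst sum.Sigma) (auto simp: True)
  also have "\<dots> = gmul f (gmul g h) S"
    unfolding gmul_def by (simp add: sum_distrib_left mult_ac)
  finally show ?thesis .
qed (simp add: gmul_infinite)

lemma gmul_supp: "gmul f g S \<noteq> 0 \<Longrightarrow> \<exists>A B. f A \<noteq> 0 \<and> g B \<noteq> 0 \<and> S = A \<union> B \<and> A \<inter> B = {}"
proof -
  assume "gmul f g S \<noteq> 0"
  then obtain A where "A \<in> Pow S" "gsign A (S - A) * f A * g (S - A) \<noteq> 0"
    unfolding gmul_def by (rule sum.not_neutral_contains_not_neutral)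
  then show ?thesis by (intro exI[of _ A] exI[of _ "S - A"]) auto
qed

instantiation grassmann :: (linorder) real_algebra_1
begin

lift_definition zero_grassmann :: "'a grassmann" is "\<lambda>_. 0" by simp

lift_definition one_grassmann :: "'a grassmann" is "\<lambda>S. if S = {} then 1 else 0" by simp

lift_definition uminus_grassmann :: "'a grassmann \<Rightarrow> 'a grassmann" is "\<lambda>f S. - f S" by simp

lift_definition plus_grassmann :: "'a grassmann \<Rightarrow> 'a grassmann \<Rightarrow> 'a grassmann"
  is "\<lambda>f g S. f S + g S"
proof -
  fix f g :: "'a set \<Rightarrow> real"
  assume f: "finite {S. f S \<noteq> 0} \<and> (\<forall>S. f S \<noteq> 0 \<longrightarrow> finite S)"
    and g: "finite {S. g S \<noteq> 0} \<and> (\<forall>S. g S \<noteq> 0 \<longrightarrow> finite S)"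
  have "{S. f S + g S \<noteq> 0} \<subseteq> {S. f S \<noteq> 0} \<union> {S. g S \<noteq> 0}" by auto
  then have "finite {S. f S + g S \<noteq> 0}" using f g finite_subset by blast
  moreover have "f S + g S \<noteq> 0 \<Longrightarrow> finite S" for S using f g by (cases "f S = 0") auto
  ultimately show "finite {S. f S + g S \<noteq> 0} \<and> (\<forall>S. f S + g S \<noteq> 0 \<longrightarrow> finite S)" by blast
qed

definition minus_grassmann :: "'a grassmann \<Rightarrow> 'a grassmann \<Rightarrow> 'a grassmann" where
  "minus_grassmann a b = a + - b"

lift_definition scaleR_grassmann :: "real \<Rightarrow> 'a grassmann \<Rightarrow> 'a grassmann" is "\<lambda>r f S. r * f S"
  by (auto elim: rev_finite_subset)

lift_definition times_grassmann :: "'a grassmann \<Rightarrow> 'a grassmann \<Rightarrow> 'a grassmann" is gmul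
proof -
  fix f g :: "'a set \<Rightarrow> real"
  assume f: "finite {S. f S \<noteq> 0} \<and> (\<forall>S. f S \<noteq> 0 \<longrightarrow> finite S)"
    and g: "finite {S. g S \<noteq> 0} \<and> (\<forall>S. g S \<noteq> 0 \<longrightarrow> finite S)"
  have "{S. gmul f g S \<noteq> 0} \<subseteq> (\<lambda>(A, B). A \<union> B) ` ({S. f S \<noteq> 0} \<times> {S. g S \<noteq> 0})"
    using gmul_supp by fastforce
  then have "finite {S. gmul f g S \<noteq> 0}" using f g by (meson finite_SigmaI finite_imageI finite_subset)
  moreover have "gmul f g S \<noteq> 0 \<Longrightarrow> finite S" for S using gmul_infinite by blast
  ultimately show "finite {S. gmul f g S \<noteq> 0} \<and> (\<forall>S. gmul f g S \<noteq> 0 \<longrightarrow> finite S)" by blast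
qed

instance
proof
  fix a b c :: "'a grassmann" and r s :: real
  show "a + b + c = a + (b + c)" by transfer (simp add: fun_eq_iff)
  show "a + b = b + a" by transfer (simp add: fun_eq_iff)
  show "0 + a = a" by transfer simp
  show "- a + a = 0" by transfer simp
  show "a - b = a + - b" by (fact minus_grassmann_def)
  show "a * b * c = a * (b * c)" by transfer (simp add: fun_eq_iff gmul_assoc)
  show "(a + b) * c = a * c + b * c"
    by transfer (simp add: fun_eq_iff gmul_def algebra_simps sum.distrib)
  show "a * (b + c) = a * b + a * c"
    by transfer (simp add: fun_eq_iff gmul_def algebra_simps sum.distrib)
  show "(0::'a grassmann) \<noteq> 1" by transfer (auto simp: fun_eq_iff)
  show "r *\<^sub>R (a + b) = r *\<^sub>R a + r *\<^sub>R b" by transfer (simp add: fun_eq_iff algebra_simps)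
  show "(r + s) *\<^sub>R a = r *\<^sub>R a + s *\<^sub>R a" by transfer (simp add: fun_eq_iff algebra_simps)
  show "r *\<^sub>R s *\<^sub>R a = (r * s) *\<^sub>R a" by transfer (simp add: fun_eq_iff)
  show "1 *\<^sub>R a = a" by transfer simp
  show "r *\<^sub>R a * b = r *\<^sub>R (a * b)"
    by transfer (simp add: fun_eq_iff gmul_def sum_distrib_left mult_ac)
  show "a * r *\<^sub>R b = r *\<^sub>R (a * b)"
    by transfer (simp add: fun_eq_iff gmul_def sum_distrib_left mult_ac)
  show "1 * a = a"
  proof (transfer, rule ext)
    fix f :: "'a set \<Rightarrow> real" and S
    assume f: "finite {S. f S \<noteq> 0} \<and> (\<forall>S. f S \<noteq> 0 \<longrightarrow> finite S)"
    show "gmul (\<lambda>S. if S = {} then 1 else 0) f S = f S"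
    proof (cases "finite S")
      case True
      then have "gmul (\<lambda>S. if S = {} then 1 else 0) f S = (\<Sum>A\<in>{{}}. f (S - A))"
        unfolding gmul_def by (intro sum.mono_neutral_cong_right) auto
      then show ?thesis by simp
    qed (use f gmul_infinite in fastforce)
  qed
  show "a * 1 = a"
  proof (transfer, rule ext)
    fix f :: "'a set \<Rightarrow> real" and S
    assume f: "finite {S. f S \<noteq> 0} \<and> (\<forall>S. f S \<noteq> 0 \<longrightarrow> finite S)"
    show "gmul f (\<lambda>S. if S = {} then 1 else 0) S = f S"
    proof (cases "finite S")
      case True
      then have "gmul f (\<lambda>S. if S = {} then 1 else 0) S = (\<Sum>A\<in>{S}. f A)"
        unfolding gmul_def by (intro sum.mono_neutral_cong_right) auto
      then show ?thesis by simp
    qed (use f gmul_infinite in fastforce)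
  qed
qed

end

definition gbody :: "'l grassmann \<Rightarrow> real" where
  "gbody a = gcoeff a {}"

definition gsoul :: "'l::linorder grassmann \<Rightarrow> 'l grassmann" where
  "gsoul a = a - of_real (gbody a)"

definition geven :: "'l grassmann \<Rightarrow> bool" where
  "geven a \<longleftrightarrow> (\<forall>S. gcoeff a S \<noteq> 0 \<longrightarrow> even (card S))"

definition godd :: "'l grassmann \<Rightarrow> bool" where
  "godd a \<longleftrightarrow> (\<forall>S. gcoeff a S \<noteq> 0 \<longrightarrow> odd (card S))"

lemma geven_zero: "geven 0" and geven_one: "geven 1"
  by (simp_all add: geven_def zero_grassmann.rep_eq one_grassmann.rep_eq)

lemma geven_add: "geven a \<Longrightarrow> geven b \<Longrightarrow> geven (a + b)"
  unfolding geven_def plus_grassmann.rep_eq by (metis add.right_neutral)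

lemma geven_uminus: "geven a \<Longrightarrow> geven (- a)"
  by (simp add: geven_def uminus_grassmann.rep_eq)

lemma geven_minus: "geven a \<Longrightarrow> geven b \<Longrightarrow> geven (a - b)"
  unfolding minus_grassmann_def by (intro geven_add geven_uminus)

lemma finite_gcoeff: "gcoeff a S \<noteq> 0 \<Longrightarrow> finite S"
  using gcoeff[of a] by auto

lemma geven_mult: "geven a \<Longrightarrow> geven b \<Longrightarrow> geven (a * b)"
  unfolding geven_def times_grassmann.rep_eq
  by (metis card_Un_disjoint even_add finite_gcoeff gmul_supp)

lemma geven_commute:
  assumes "geven a"
  shows "a * b = b * a"
proof -
  have "gmul (gcoeff a) (gcoeff b) S = gmul (gcoeff b) (gcoeff a) S" for S
  proof (cases "finite S")
    case True
    have "gmul (gcoeff b) (gcoeff a) S =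
        (\<Sum>A\<in>Pow S. gsign (S - A) A * gcoeff b (S - A) * gcoeff a A)"
      unfolding gmul_def
      by (rule sum.reindex_bij_witness[of _ "\<lambda>A. S - A" "\<lambda>A. S - A"]) (auto simp: double_diff)
    also have "\<dots> = gmul (gcoeff a) (gcoeff b) S"
      unfolding gmul_def
    proof (rule sum.cong[OF refl])
      fix A assume A: "A \<in> Pow S"
      have "gcoeff a A \<noteq> 0 \<Longrightarrow> gsign (S - A) A = gsign A (S - A)"
        using gsign_swap[of A "S - A"] A True finite_subset[of A S] assms
        by (auto simp: geven_def)
      then show "gsign (S - A) A * gcoeff b (S - A) * gcoeff a A
          = gsign A (S - A) * gcoeff a A * gcoeff b (S - A)"
        by (cases "gcoeff a A = 0") auto
    qed
    finally show ?thesis by simp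
  qed (simp add: gmul_infinite)
  then show ?thesis
    by (simp add: gcoeff_inject[symmetric] times_grassmann.rep_eq fun_eq_iff)
qed

text \<open>The commutative ring of the even elements; determinants live here.\<close>

typedef (overloaded) 'l geven_ring = "{a :: 'l::linorder grassmann. geven a}"
  morphisms of_geven to_geven
  using geven_zero by blast

setup_lifting type_definition_geven_ring

instantiation geven_ring :: (linorder) comm_ring_1
begin
lift_definition zero_geven_ring :: "'a geven_ring" is 0 by (rule geven_zero)
lift_definition one_geven_ring :: "'a geven_ring" is 1 by (rule geven_one)
lift_definition uminus_geven_ring :: "'a geven_ring \<Rightarrow> 'a geven_ring" is uminus
  by (rule geven_uminus)
lift_definition plus_geven_ring :: "'a geven_ring \<Rightarrow> 'a geven_ring \<Rightarrow> 'a geven_ring" is "(+)"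
  by (rule geven_add)
lift_definition minus_geven_ring :: "'a geven_ring \<Rightarrow> 'a geven_ring \<Rightarrow> 'a geven_ring" is "(-)"
  by (rule geven_minus)
lift_definition times_geven_ring :: "'a geven_ring \<Rightarrow> 'a geven_ring \<Rightarrow> 'a geven_ring" is "(*)"
  by (rule geven_mult)
instance
  by standard (transfer; simp add: algebra_simps geven_commute)+
end


section \<open>Superdomains and superfunctions\<close>

text \<open>
  Everything takes place in dimension \<open>(n.n)\<close>. \<open>Inl \<mu>\<close> is the index of the even coordinate
  \<open>x\<^sup>\<mu>\<close> and \<open>Inr \<mu>\<close> that of the odd coordinate \<open>\<theta>\<^sub>\<mu>\<close>, for \<open>\<mu> < n\<close>; components with other
  indices are zero. Tuples of this kind serve as \<open>\<Lambda>\<close>-points and as even tangent vectors.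
\<close>

type_synonym sindex = "nat + nat"
type_synonym 'l spoint = "sindex \<Rightarrow> 'l grassmann"

definition sidx :: "nat \<Rightarrow> sindex set" where
  "sidx n = {..<n} <+> {..<n}"

fun has_parity :: "sindex \<Rightarrow> 'l grassmann \<Rightarrow> bool" where
  "has_parity (Inl i) a \<longleftrightarrow> geven a"
| "has_parity (Inr j) a \<longleftrightarrow> godd a"

definition svec :: "nat \<Rightarrow> 'l::linorder spoint set" where
  "svec n = {u. (\<forall>A. has_parity A (u A)) \<and> (\<forall>A. A \<notin> sidx n \<longrightarrow> u A = 0)}"

definition rspace :: "nat \<Rightarrow> (nat \<Rightarrow> real) set" where
  "rspace n = {x. \<forall>i. n \<le> i \<longrightarrow> x i = 0}"

definition pbody :: "'l spoint \<Rightarrow> nat \<Rightarrow> real" where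
  "pbody z = (\<lambda>i. gbody (z (Inl i)))"

definition open_dom :: "nat \<Rightarrow> (nat \<Rightarrow> real) set \<Rightarrow> bool" where
  "open_dom n U \<longleftrightarrow> openin (top_of_set (rspace n)) U"

definition superdomain :: "nat \<Rightarrow> (nat \<Rightarrow> real) set \<Rightarrow> 'l::linorder spoint set" where
  "superdomain n U = {z \<in> svec n. pbody z \<in> U}"

definition rpartial :: "nat \<Rightarrow> ((nat \<Rightarrow> real) \<Rightarrow> real) \<Rightarrow> (nat \<Rightarrow> real) \<Rightarrow> real" where
  "rpartial i g x = deriv (\<lambda>t. g (x(i := t))) (x i)"

definition smooth :: "nat \<Rightarrow> (nat \<Rightarrow> real) set \<Rightarrow> ((nat \<Rightarrow> real) \<Rightarrow> real) \<Rightarrow> bool" where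
  "smooth n U g \<longleftrightarrow> (\<forall>is. set is \<subseteq> {..<n} \<longrightarrow>
     continuous_on U (foldr rpartial is g) \<and>
     (\<forall>i<n. \<forall>x\<in>U. (\<lambda>t. foldr rpartial is g (x(i := t))) differentiable (at (x i))))"

text \<open>\<open>\<Lambda>\<close>-valued smooth functions involve, locally, only finitely many generators of \<open>\<Lambda>\<close>.\<close>

definition gsmooth :: "nat \<Rightarrow> (nat \<Rightarrow> real) set \<Rightarrow> ((nat \<Rightarrow> real) \<Rightarrow> 'l grassmann) \<Rightarrow> bool" where
  "gsmooth n U c \<longleftrightarrow>
     (\<forall>S. smooth n U (\<lambda>x. gcoeff (c x) S)) \<and>
     (\<forall>x\<in>U. \<exists>V N. open_dom n V \<and> x \<in> V \<and> finite N \<and>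
        (\<forall>y\<in>V \<inter> U. \<forall>S. gcoeff (c y) S \<noteq> 0 \<longrightarrow> S \<subseteq> N))"

definition gpartials :: "nat list \<Rightarrow> ((nat \<Rightarrow> real) \<Rightarrow> 'l grassmann) \<Rightarrow> (nat \<Rightarrow> real) \<Rightarrow> 'l grassmann"
  where "gpartials is c x = Abs_grassmann (\<lambda>S. foldr rpartial is (\<lambda>y. gcoeff (c y) S) x)"

definition soul_monomial :: "'l::linorder spoint \<Rightarrow> nat list \<Rightarrow> 'l grassmann" where
  "soul_monomial z is = prod_list (map (\<lambda>i. gsoul (z (Inl i))) is)"

text \<open>
  The value at the even elements \<open>x\<^sup>i = body + soul\<close> of \<open>\<Lambda>\<close> of a smooth function of real
  variables is defined by the Taylor series in the souls. It is written here as a sum over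
  sequences of indices rather than multi-indices, and is finite since souls are nilpotent.
\<close>

definition taylor :: "nat \<Rightarrow> ((nat \<Rightarrow> real) \<Rightarrow> 'l::linorder grassmann) \<Rightarrow> 'l spoint \<Rightarrow> 'l grassmann" where
  "taylor n c z =
     (\<Sum>is | set is \<subseteq> {..<n} \<and> soul_monomial z is \<noteq> 0.
        (1 / fact (length is)) *\<^sub>R (soul_monomial z is * gpartials is c (pbody z)))"

definition odd_monomial :: "'l::linorder spoint \<Rightarrow> nat set \<Rightarrow> 'l grassmann" where
  "odd_monomial z I = prod_list (map (\<lambda>j. z (Inr j)) (sorted_list_of_set I))"

text \<open>
  Superfunctions \<open>f(x,\<theta>) = \<Sum>\<^sub>I \<theta>\<^sup>I c\<^sub>I(x)\<close>. The coefficients may be \<open>\<Lambda>\<close>-valued, that is, may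
  depend on odd parameters.
\<close>

definition superfunction :: "nat \<Rightarrow> (nat \<Rightarrow> real) set \<Rightarrow> ('l::linorder spoint \<Rightarrow> 'l grassmann) \<Rightarrow> bool" where
  "superfunction n U f \<longleftrightarrow>
     (\<exists>c. (\<forall>I\<in>Pow {..<n}. gsmooth n U (c I)) \<and>
          (\<forall>z\<in>superdomain n U. f z = (\<Sum>I\<in>Pow {..<n}. odd_monomial z I * taylor n (c I) z)))"

text \<open>
  Partial derivatives: \<open>f(z + h e\<^sub>A) = f(z) + h \<partial>\<^sub>Af(z)\<close> for all increments \<open>h\<close> of the parity of
  \<open>z\<^sup>A\<close> with \<open>h\<^sup>2 = 0\<close> (automatic for odd \<open>h\<close>). On superfunctions this is the derivative of the
  coefficients \<open>c\<^sub>I\<close> for even, and the left derivative for odd \<open>z\<^sup>A\<close>; it is unique as \<open>\<Lambda>\<close>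
  has infinitely many generators. The right derivative has \<open>h\<close> on the other side.
\<close>

definition pd :: "sindex \<Rightarrow> ('l::linorder spoint \<Rightarrow> 'l grassmann) \<Rightarrow> 'l spoint \<Rightarrow> 'l grassmann" where
  "pd A f z = (THE g. \<forall>h. has_parity A h \<and> h * h = 0 \<longrightarrow> f (z(A := z A + h)) = f z + h * g)"

definition pd_right :: "sindex \<Rightarrow> ('l::linorder spoint \<Rightarrow> 'l grassmann) \<Rightarrow> 'l spoint \<Rightarrow> 'l grassmann" where
  "pd_right A f z = (THE g. \<forall>h. has_parity A h \<and> h * h = 0 \<longrightarrow> f (z(A := z A + h)) = f z + g * h)"

definition ddir :: "nat \<Rightarrow> 'l::linorder spoint \<Rightarrow> ('l spoint \<Rightarrow> 'l grassmann) \<Rightarrow> 'l spoint \<Rightarrow> 'l grassmann" where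
  "ddir n u f z = (\<Sum>A\<in>sidx n. u A * pd A f z)"


section \<open>The Berezinian and its square root\<close>

text \<open>
  The blocks of \<open>(\<partial>\<^sub>A F\<^sup>B)\<close>, the row \<open>A\<close> being the variable of differentiation; \<open>p\<close> and \<open>q\<close> are
  \<open>Inl\<close> or \<open>Inr\<close>.
\<close>

definition jac :: "nat \<Rightarrow> (nat \<Rightarrow> sindex) \<Rightarrow> (nat \<Rightarrow> sindex) \<Rightarrow> ('l::linorder spoint \<Rightarrow> 'l spoint)
    \<Rightarrow> 'l spoint \<Rightarrow> 'l grassmann mat" where
  "jac n p q F z = mat n n (\<lambda>(i, j). pd (p i) (\<lambda>y. F y (q j)) z)"

definition mat_inv :: "nat \<Rightarrow> 'a::ring_1 mat \<Rightarrow> 'a mat" where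
  "mat_inv n A = (THE B. B \<in> carrier_mat n n \<and> A * B = 1\<^sub>m n \<and> B * A = 1\<^sub>m n)"

definition ring_inv :: "'a::ring_1 \<Rightarrow> 'a" where
  "ring_inv a = (THE b. a * b = 1 \<and> b * a = 1)"

definition even_det :: "'l::linorder grassmann mat \<Rightarrow> 'l geven_ring" where
  "even_det A = det (map_mat to_geven A)"

definition Ber :: "nat \<Rightarrow> ('l::linorder spoint \<Rightarrow> 'l spoint) \<Rightarrow> 'l spoint \<Rightarrow> 'l geven_ring" where
  "Ber n F z =
     (let A = jac n Inl Inl F z; B = jac n Inl Inr F z; C = jac n Inr Inl F z; D = jac n Inr Inr F z
      in even_det (A - B * mat_inv n D * C) * ring_inv (even_det D))"

text \<open>
  The factor \<open>|Ber F|\<^bsup>1/2\<^esup>\<close> of semidensities. Its branch is the one whose body has the sign of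
  the determinant of the body of \<open>\<partial>x'/\<partial>x\<close>. Between Darboux coordinates the body of the
  Berezinian is \<open>(det \<partial>x'/\<partial>x)\<^sup>2\<close>, so that no absolute value is needed and the body of its square
  root is \<open>det \<partial>x'/\<partial>x\<close>; for \<open>det \<partial>x'/\<partial>x > 0\<close> this is the positive root. Taking the positive
  root regardless of orientation is not possible: under \<open>x\<^sup>0, \<theta>\<^sub>0 \<mapsto> -x\<^sup>0, -\<theta>\<^sub>0\<close>
  (Berezinian \<open>1\<close>) the derivative \<open>\<partial>s/\<partial>\<theta>\<^sub>0\<close> would change sign.
\<close>

definition sqrt_Ber :: "nat \<Rightarrow> ('l::linorder spoint \<Rightarrow> 'l spoint) \<Rightarrow> 'l spoint \<Rightarrow> 'l grassmann" where
  "sqrt_Ber n F z = of_geven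
     (THE r. of_geven (r * r) = sgn (gbody (of_geven (Ber n F z))) *\<^sub>R of_geven (Ber n F z) \<and>
             sgn (gbody (of_geven r)) = sgn (gbody (of_geven (even_det (jac n Inl Inl F z)))))"


section \<open>Coordinate systems and semidensities\<close>

text \<open>
  A chart \<open>(D, w)\<close> consists of a set \<open>D\<close> of points and the coordinates \<open>w\<close>, an injective map
  of \<open>D\<close> onto a superdomain.
\<close>

type_synonym 'l chart = "'l spoint set \<times> ('l spoint \<Rightarrow> 'l spoint)"

text \<open>The coordinate systems on the open parts of the superspace over \<open>U\<close>.\<close>

definition coord_systems :: "nat \<Rightarrow> (nat \<Rightarrow> real) set \<Rightarrow> 'l::linorder chart set" where
  "coord_systems n U = {(D, w). \<exists>V V'. open_dom n V \<and> V \<subseteq> U \<and> open_dom n V' \<and>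
     D = superdomain n V \<and> bij_betw w D (superdomain n V') \<and>
     (\<forall>A\<in>sidx n. superfunction n V (\<lambda>z. w z A)) \<and>
     (\<forall>A\<in>sidx n. superfunction n V' (\<lambda>y. inv_into D w y A))}"

definition transition :: "'l chart \<Rightarrow> 'l chart \<Rightarrow> 'l spoint \<Rightarrow> 'l spoint" where
  "transition c c' = snd c' \<circ> inv_into (fst c) (snd c)"

text \<open>
  A semidensity on an \<open>(n.n)\<close>-dimensional superspace with atlas \<open>\<A>\<close> is given by its
  coefficient \<open>s c\<close> in each coordinate system \<open>c\<close> of \<open>\<A>\<close>, a function of the coordinates.
\<close>

definition semidensity :: "nat \<Rightarrow> 'l::linorder chart set \<Rightarrow> ('l chart \<Rightarrow> 'l spoint \<Rightarrow> 'l grassmann) \<Rightarrow> bool" where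
  "semidensity n \<A> s \<longleftrightarrow>
     (\<forall>(D, w)\<in>\<A>. superfunction n (pbody ` w ` D) (s (D, w))) \<and>
     (\<forall>(D, w)\<in>\<A>. \<forall>(D', w')\<in>\<A>. \<forall>z\<in>D \<inter> D'.
        s (D, w) (w z) = s (D', w') (w' z) * sqrt_Ber n (transition (D, w) (D', w')) (w z))"


section \<open>Odd symplectic superspaces\<close>

type_synonym 'l two_form = "sindex \<Rightarrow> sindex \<Rightarrow> 'l spoint \<Rightarrow> 'l grassmann"

text \<open>The value of the form with components \<open>\<Omega>\<^sub>A\<^sub>B\<close> on even tangent vectors.\<close>

definition form_at :: "nat \<Rightarrow> 'l::linorder two_form \<Rightarrow> 'l spoint \<Rightarrow> 'l spoint \<Rightarrow> 'l spoint \<Rightarrow> 'l grassmann" where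
  "form_at n \<Omega> z u v = (\<Sum>A\<in>sidx n. \<Sum>B\<in>sidx n. u A * \<Omega> A B z * v B)"

definition odd_two_form :: "nat \<Rightarrow> (nat \<Rightarrow> real) set \<Rightarrow> 'l::linorder two_form \<Rightarrow> bool" where
  "odd_two_form n U \<Omega> \<longleftrightarrow>
     (\<forall>A\<in>sidx n. \<forall>B\<in>sidx n. superfunction n U (\<Omega> A B)) \<and>
     (\<forall>z\<in>superdomain n U. \<forall>u\<in>svec n. \<forall>v\<in>svec n.
        godd (form_at n \<Omega> z u v) \<and> form_at n \<Omega> z v u = - form_at n \<Omega> z u v)"

text \<open>
  \<open>d\<Omega>(u, v, t)\<close> for even vectors \<open>u, v, t\<close>, considered as constant vector fields in the given
  coordinates.
\<close>

definition closed_form :: "nat \<Rightarrow> (nat \<Rightarrow> real) set \<Rightarrow> 'l::linorder two_form \<Rightarrow> bool" where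
  "closed_form n U \<Omega> \<longleftrightarrow>
     (\<forall>z\<in>superdomain n U. \<forall>u\<in>svec n. \<forall>v\<in>svec n. \<forall>t\<in>svec n.
        form_at n (\<lambda>A B. ddir n u (\<Omega> A B)) z v t +
        form_at n (\<lambda>A B. ddir n v (\<Omega> A B)) z t u +
        form_at n (\<lambda>A B. ddir n t (\<Omega> A B)) z u v = 0)"

definition nondegenerate_at :: "nat \<Rightarrow> ('l::linorder spoint \<Rightarrow> 'l spoint \<Rightarrow> 'l grassmann) \<Rightarrow> bool" where
  "nondegenerate_at n \<beta> \<longleftrightarrow> (\<forall>u\<in>svec n. (\<forall>v\<in>svec n. \<beta> u v = 0) \<longrightarrow> u = (\<lambda>_. 0))"

definition odd_symplectic :: "nat \<Rightarrow> (nat \<Rightarrow> real) set \<Rightarrow> 'l::linorder two_form \<Rightarrow> bool" where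
  "odd_symplectic n U \<Omega> \<longleftrightarrow> odd_two_form n U \<Omega> \<and> closed_form n U \<Omega> \<and>
     (\<forall>z\<in>superdomain n U. nondegenerate_at n (form_at n \<Omega> z))"

text \<open>The matrix inverse to \<open>(\<Omega>\<^sub>A\<^sub>B)\<close>.\<close>

definition poisson_bivector :: "nat \<Rightarrow> 'l::linorder two_form \<Rightarrow> 'l spoint \<Rightarrow> sindex \<Rightarrow> sindex \<Rightarrow> 'l grassmann" where
  "poisson_bivector n \<Omega> z = (THE P.
     (\<forall>A B. A \<notin> sidx n \<or> B \<notin> sidx n \<longrightarrow> P A B = 0) \<and>
     (\<forall>A\<in>sidx n. \<forall>C\<in>sidx n.
        (\<Sum>B\<in>sidx n. \<Omega> A B z * P B C) = (if A = C then 1 else 0) \<and>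
        (\<Sum>B\<in>sidx n. P A B * \<Omega> B C z) = (if A = C then 1 else 0)))"

text \<open>
  The bracket \<open>{f,g} = X\<^sub>g f\<close>, where \<open>\<Omega>(u, X\<^sub>g) = u g\<close>. In Darboux coordinates it is
  \<open>\<partial>f/\<partial>x\<^sup>\<mu> \<partial>g/\<partial>\<theta>\<^sub>\<mu> + (-1)\<^bsup>p(f)\<^esup> \<partial>f/\<partial>\<theta>\<^sub>\<mu> \<partial>g/\<partial>x\<^sup>\<mu>\<close>.
\<close>

definition odd_bracket :: "nat \<Rightarrow> 'l::linorder two_form \<Rightarrow> ('l spoint \<Rightarrow> 'l grassmann)
    \<Rightarrow> ('l spoint \<Rightarrow> 'l grassmann) \<Rightarrow> 'l spoint \<Rightarrow> 'l grassmann" where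
  "odd_bracket n \<Omega> f g z =
     (\<Sum>A\<in>sidx n. \<Sum>B\<in>sidx n. pd_right A f z * poisson_bivector n \<Omega> z A B * pd B g z)"

definition darboux_systems :: "nat \<Rightarrow> (nat \<Rightarrow> real) set \<Rightarrow> 'l::linorder two_form \<Rightarrow> 'l chart set" where
  "darboux_systems n U \<Omega> = {(D, w) \<in> coord_systems n U.
     \<forall>z\<in>D. \<forall>\<mu><n. \<forall>\<nu><n.
       odd_bracket n \<Omega> (\<lambda>y. w y (Inl \<mu>)) (\<lambda>y. w y (Inl \<nu>)) z = 0 \<and>
       odd_bracket n \<Omega> (\<lambda>y. w y (Inr \<mu>)) (\<lambda>y. w y (Inr \<nu>)) z = 0 \<and>
       odd_bracket n \<Omega> (\<lambda>y. w y (Inl \<mu>)) (\<lambda>y. w y (Inr \<nu>)) z = (if \<mu> = \<nu> then 1 else 0)}"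


section \<open>Surfaces of codimension (1.1)\<close>

text \<open>The coordinate systems in which \<open>M\<close> is given by \<open>x\<^sup>0 = \<theta>\<^sub>0 = 0\<close>.\<close>

definition slice_systems :: "nat \<Rightarrow> (nat \<Rightarrow> real) set \<Rightarrow> 'l::linorder spoint set \<Rightarrow> 'l chart set" where
  "slice_systems n U M = {(D, w) \<in> coord_systems n U.
     M \<inter> D = {z \<in> D. w z (Inl 0) = 0 \<and> w z (Inr 0) = 0}}"

definition surface :: "nat \<Rightarrow> (nat \<Rightarrow> real) set \<Rightarrow> 'l::linorder spoint set \<Rightarrow> bool" where
  "surface n U M \<longleftrightarrow> M \<subseteq> superdomain n U \<and> (\<forall>z\<in>M. \<exists>(D, w)\<in>slice_systems n U M. z \<in> D)"

text \<open>
  \<open>drop0\<close> forgets \<open>x\<^sup>0\<close> and \<open>\<theta>\<^sub>0\<close>; the coordinates \<open>(x\<^sup>i, \<theta>\<^sub>i)\<close>, \<open>i = 1, \<dots>, n - 1\<close>, become the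
  coordinates number \<open>i - 1\<close> of a superspace of dimension \<open>(n - 1.n - 1)\<close>. \<open>insert0\<close> puts
  \<open>x\<^sup>0 = \<theta>\<^sub>0 = 0\<close> back.
\<close>

definition drop0 :: "'l spoint \<Rightarrow> 'l spoint" where
  "drop0 z = (\<lambda>A. case A of Inl i \<Rightarrow> z (Inl (Suc i)) | Inr i \<Rightarrow> z (Inr (Suc i)))"

definition insert0 :: "'l::linorder spoint \<Rightarrow> 'l spoint" where
  "insert0 y = (\<lambda>A. case A of
      Inl i \<Rightarrow> (case i of 0 \<Rightarrow> 0 | Suc k \<Rightarrow> y (Inl k))
    | Inr i \<Rightarrow> (case i of 0 \<Rightarrow> 0 | Suc k \<Rightarrow> y (Inr k)))"

text \<open>The coordinates on \<open>M\<close> induced by coordinates of the ambient superspace.\<close>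

definition induced_chart :: "'l spoint set \<Rightarrow> 'l chart \<Rightarrow> 'l chart" where
  "induced_chart M c = (M \<inter> fst c, drop0 \<circ> snd c)"

text \<open>
  The pull-back of \<open>\<Omega>\<close> to \<open>M\<close>, evaluated at the point of \<open>M\<close> with induced coordinates \<open>y\<close>;
  \<open>\<phi>\<close> is the embedding of \<open>M\<close> in these coordinates.
\<close>

definition pullback_at :: "nat \<Rightarrow> 'l::linorder two_form \<Rightarrow> 'l chart \<Rightarrow> 'l spoint \<Rightarrow> 'l spoint \<Rightarrow> 'l spoint \<Rightarrow> 'l grassmann" where
  "pullback_at n \<Omega> c y u v =
     (let \<phi> = inv_into (fst c) (snd c) \<circ> insert0;
          d\<phi> = (\<lambda>t B. ddir (n - 1) t (\<lambda>y'. \<phi> y' B) y)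
      in form_at n \<Omega> (\<phi> y) (d\<phi> u) (d\<phi> v))"

definition nondegenerate_surface :: "nat \<Rightarrow> (nat \<Rightarrow> real) set \<Rightarrow> 'l::linorder two_form \<Rightarrow> 'l spoint set \<Rightarrow> bool" where
  "nondegenerate_surface n U \<Omega> M \<longleftrightarrow> surface n U M \<and>
     (\<forall>c\<in>slice_systems n U M. \<forall>z\<in>M \<inter> fst c.
        nondegenerate_at (n - 1) (pullback_at n \<Omega> c (drop0 (snd c z))))"

text \<open>
  The Darboux coordinates adjusted to \<open>M\<close>. Such coordinates exist around every point of a
  non-degenerated \<open>M\<close>, so the induced charts form an atlas of \<open>M\<close>, and a semidensity on \<open>M\<close> can
  be specified by its coefficients in this atlas.
\<close>

definition adjusted_systems :: "nat \<Rightarrow> (nat \<Rightarrow> real) set \<Rightarrow> 'l::linorder two_form \<Rightarrow> 'l spoint set \<Rightarrow> 'l chart set" where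
  "adjusted_systems n U \<Omega> M = darboux_systems n U \<Omega> \<inter> slice_systems n U M"

end

theory Submission
  imports Defs
begin

text \<open>
  The points of a superdomain with a given body form an affine space over the souls, on which
  superfunctions are power series and all calculus is algebra with increments \<open>h\<close>, \<open>h\<^sup>2 = 0\<close>.

  Let \<open>F\<close> be the transition between two adjusted Darboux systems and \<open>G\<close> its inverse. Because
  \<open>\<partial>/\<partial>\<theta>\<^sub>0\<close> is the Hamiltonian vector field of \<open>x\<^sup>0\<close>, the derivatives \<open>\<partial>F/\<partial>\<theta>\<^sub>0\<close> are, up to
  the exchange of \<open>x'\<^sup>\<mu>\<close> and \<open>\<theta>'\<^sub>\<mu>\<close>, the derivatives of \<open>x\<^sup>0\<close> as a function of the new coordinates.
  As \<open>x\<^sup>0\<close> and \<open>\<theta>\<^sub>0\<close> vanish on \<open>M\<close>, the Jacobian matrix on \<open>M\<close> splits into a tangential and a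
  normal part, \<open>\<partial>/\<partial>\<theta>\<^sub>0 = (1/a) \<partial>/\<partial>\<theta>'\<^sub>0\<close> with \<open>a = \<partial>x'\<^sup>0/\<partial>x\<^sup>0\<close>, and the Berezinian is \<open>a\<^sup>2\<close>
  times that of the induced transition. Moreover \<open>\<partial> log Ber F/\<partial>\<theta>\<^sub>0 = 2 \<Sum>\<^sub>\<mu> \<partial>\<^sup>2x\<^sup>0/\<partial>x'\<^sup>\<mu>\<partial>\<theta>'\<^sub>\<mu>\<close>
  vanishes on \<open>M\<close>: the terms with \<open>\<mu> > 0\<close> are tangential derivatives, and the remaining one
  vanishes by \<open>{x\<^sup>0, x\<^sup>0} = 0\<close>. Hence differentiating \<open>s = s' \<cdot> Ber\<^bsup>1/2\<^esup>\<close> along \<open>\<theta>\<^sub>0\<close> only hits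
  \<open>s'\<close>, and the factors \<open>(1/a)\<close> and \<open>a\<close> cancel.
\<close>

section \<open>Parity, body and nilpotency in a Grassmann algebra\<close>

text \<open>Restricting to one body costs nothing: an increment with \<open>h * h = 0\<close> has
  body zero, so \<open>pd\<close> never leaves a \<open>fiber\<close>, and first-order expansions
  are exact there. The price is that a derivative is known only through its products with such
  \<open>h\<close>. As there are infinitely many generators, some \<open>h\<close> is disjoint from
  any given element, and this is what makes cancelling \<open>h\<close> legitimate.

  The Berezinian is never differentiated, since it contains inverses and its root is given by a
  description operator. Its values at a point and at the point moved by an odd \<epsilon> in
  \<theta>_0 are compared instead, which is algebra of matrices whose entries are multiples of
  \<epsilon>.

  The branch of the root enters through the sign of the normal factor \<open>a\<close>: the root of
  \<open>a * a * q\<close> with the prescribed sign is \<open>a\<close> times the root of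
  \<open>q\<close>, not its absolute value times it. Otherwise \<open>1/a\<close> and
  \<open>a\<close> would cancel only up to sign.

  An induced chart does not determine the ambient chart it comes from. The coefficient on M is
  therefore defined by a choice, whose irrelevance is the transformation law for two ambient charts
  with equal induced charts.\<close>

lemma grassmann_eqI: "(\<And>S. gcoeff a S = gcoeff b S) \<Longrightarrow> a = b"
  by (simp add: gcoeff_inject[symmetric] fun_eq_iff)

lemma gcoeff_simps [simp]:
  "gcoeff 0 S = 0" "gcoeff (- a) S = - gcoeff a S"
  "gcoeff (a + b) S = gcoeff a S + gcoeff b S" "gcoeff (a - b) S = gcoeff a S - gcoeff b S"
  "gcoeff (r *\<^sub>R a) S = r * gcoeff a S"
  by (simp_all add: zero_grassmann.rep_eq uminus_grassmann.rep_eq plus_grassmann.rep_eq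
      scaleR_grassmann.rep_eq)
    (simp only: minus_grassmann_def plus_grassmann.rep_eq uminus_grassmann.rep_eq
        diff_conv_add_uminus)

lemma gcoeff_one: "gcoeff 1 S = (if S = {} then 1 else 0)"
  by (simp add: one_grassmann.rep_eq)

lemma gbody_simps [simp]:
  "gbody 0 = 0" "gbody 1 = 1" "gbody (- a) = - gbody a" "gbody (a + b) = gbody a + gbody b"
  "gbody (a - b) = gbody a - gbody b" "gbody (r *\<^sub>R a) = r * gbody a"
  by (simp_all add: gbody_def gcoeff_one)

lemma gbody_mult [simp]: "gbody (a * b) = gbody a * gbody b"
  by (simp add: gbody_def times_grassmann.rep_eq gmul_def)

lemma gbody_of_real [simp]: "gbody (of_real r) = r"
  by (simp add: of_real_def)

lemma gbody_sum: "gbody (sum f I) = (\<Sum>i\<in>I. gbody (f i))"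
  by (induction I rule: infinite_finite_induct) auto

lemma gbody_gsoul [simp]: "gbody (gsoul a) = 0"
  by (simp add: gsoul_def)

lemma gbody_square_zero: "h * h = 0 \<Longrightarrow> gbody h = 0"
  using gbody_mult[of h h] by simp

text \<open>The parity automorphism. Being even or odd becomes a linear equation,
  \<open>ginvol a = a\<close> or \<open>ginvol a = - a\<close>, which passes through sums, products,
  inverses and cancellation.\<close>

lift_definition ginvol :: "'l::linorder grassmann \<Rightarrow> 'l grassmann"
  is "\<lambda>f S. (-1) ^ card S * f S"
  by (auto elim: rev_finite_subset)

lemma gcoeff_ginvol: "gcoeff (ginvol a) S = (-1) ^ card S * gcoeff a S"
  by (simp add: ginvol.rep_eq)

lemma ginvol_simps [simp]:
  "ginvol 0 = 0" "ginvol 1 = 1" "ginvol (- a) = - ginvol a" "ginvol (a + b) = ginvol a + ginvol b"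
  "ginvol (a - b) = ginvol a - ginvol b" "ginvol (r *\<^sub>R a) = r *\<^sub>R ginvol a"
  "ginvol (ginvol a) = a" "gbody (ginvol a) = gbody a"
  by (rule grassmann_eqI, simp add: gcoeff_ginvol gcoeff_one algebra_simps
      | simp add: gbody_def gcoeff_ginvol)+

lemma ginvol_mult [simp]: "ginvol (a * b) = ginvol a * ginvol b"
proof (rule grassmann_eqI)
  fix S
  show "gcoeff (ginvol (a * b)) S = gcoeff (ginvol a * ginvol b) S"
  proof (cases "finite S")
    case True
    have "card S = card A + card (S - A)" if "A \<subseteq> S" for A
      using that True by (metis card_Diff_subset card_mono finite_subset le_add_diff_inverse)
    then show ?thesis
      by (auto simp: gcoeff_ginvol times_grassmann.rep_eq gmul_def sum_distrib_left power_add
          intro!: sum.cong)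
  qed (simp add: gcoeff_ginvol times_grassmann.rep_eq gmul_infinite)
qed

lemma ginvol_sum [simp]: "ginvol (sum f I) = (\<Sum>i\<in>I. ginvol (f i))"
  by (induction I rule: infinite_finite_induct) auto

lemma ginvol_eq_0_iff [simp]: "ginvol a = 0 \<longleftrightarrow> a = 0"
  by (metis ginvol_simps(1,7))

lemma geven_iff: "geven a \<longleftrightarrow> ginvol a = a"
proof
  show "geven a \<Longrightarrow> ginvol a = a"
    by (rule grassmann_eqI) (auto simp: geven_def gcoeff_ginvol)
  assume "ginvol a = a"
  then have eq: "(-1) ^ card S * gcoeff a S = gcoeff a S" for S
    by (metis gcoeff_ginvol)
  have "gcoeff a S \<noteq> 0 \<Longrightarrow> even (card S)" for S
    using eq[of S] by (cases "even (card S)") auto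
  then show "geven a" by (simp add: geven_def)
qed

lemma godd_iff: "godd a \<longleftrightarrow> ginvol a = - a"
proof
  show "godd a \<Longrightarrow> ginvol a = - a"
    by (rule grassmann_eqI) (metis gcoeff_ginvol gcoeff_simps(2) godd_def mult_minus1 mult_zero_right
        neg_one_odd_power neg_0_equal_iff_equal)
  assume "ginvol a = - a"
  then have eq: "(-1) ^ card S * gcoeff a S = - gcoeff a S" for S
    by (metis gcoeff_ginvol gcoeff_simps(2))
  have "gcoeff a S \<noteq> 0 \<Longrightarrow> odd (card S)" for S
    using eq[of S] by (cases "even (card S)") auto
  then show "godd a" by (simp add: godd_def)
qed

text \<open>By \<open>gsign_swap\<close>, exchanging the monomials A and S - A costs the sign with
  exponent \<open>card A * card (S - A)\<close>. For odd \<open>card A\<close> this is the sign that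
  \<open>ginvol\<close> attaches to S - A.\<close>

lemma godd_commute:
  assumes "godd h"
  shows "h * a = ginvol a * h"
proof -
  have "gmul (gcoeff h) (gcoeff a) S = gmul (gcoeff (ginvol a)) (gcoeff h) S" for S
  proof (cases "finite S")
    case True
    have "gmul (gcoeff (ginvol a)) (gcoeff h) S =
        (\<Sum>A\<in>Pow S. gsign (S - A) A * gcoeff (ginvol a) (S - A) * gcoeff h A)"
      unfolding gmul_def
      by (rule sum.reindex_bij_witness[of _ "\<lambda>A. S - A" "\<lambda>A. S - A"]) (auto simp: double_diff)
    also have "\<dots> = gmul (gcoeff h) (gcoeff a) S"
      unfolding gmul_def
    proof (rule sum.cong[OF refl])
      fix A assume A: "A \<in> Pow S"
      have "gcoeff h A \<noteq> 0 \<Longrightarrow> gsign (S - A) A = (-1) ^ card (S - A) * gsign A (S - A)"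
        using gsign_swap[of A "S - A"] A True finite_subset[of A S] assms
        by (auto simp: godd_def power_mult)
      then show "gsign (S - A) A * gcoeff (ginvol a) (S - A) * gcoeff h A
          = gsign A (S - A) * gcoeff h A * gcoeff a (S - A)"
        by (cases "gcoeff h A = 0") (auto simp: gcoeff_ginvol)
    qed
    finally show ?thesis by simp
  qed (simp add: gmul_infinite)
  then show ?thesis
    by (intro grassmann_eqI) (simp add: times_grassmann.rep_eq)
qed

lemma godd_square:
  assumes "godd h" shows "h * h = 0"
proof -
  have "h * h = - (h * h)" using godd_commute[OF assms, of h] assms by (simp add: godd_iff)
  then have "2 *\<^sub>R (h * h) = 0" by (simp add: scaleR_2 eq_neg_iff_add_eq_0)
  then show ?thesis by simp
qed

lemma gbody_godd: "godd h \<Longrightarrow> gbody h = 0"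
  by (auto simp: gbody_def godd_def)

section \<open>Sign rules shared by even and odd coordinate indices\<close>

definition psign :: "sindex \<Rightarrow> real" where
  "psign A = (case A of Inl _ \<Rightarrow> 1 | Inr _ \<Rightarrow> -1)"

text \<open>What happens to a factor when an increment of the coordinate \<open>A\<close> is moved
  past it. It lets one argument serve both parities.\<close>

definition pinvol :: "sindex \<Rightarrow> 'l::linorder grassmann \<Rightarrow> 'l grassmann" where
  "pinvol A a = (case A of Inl _ \<Rightarrow> a | Inr _ \<Rightarrow> ginvol a)"

lemma psign_simps [simp]: "psign (Inl i) = 1" "psign (Inr i) = -1" "psign A * psign A = 1"
  "psign A * (psign A * r) = r"
  by (simp_all add: psign_def split: sum.split)

lemma pinvol_simps [simp]:
  "pinvol (Inl i) a = a" "pinvol (Inr i) a = ginvol a"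
  "pinvol A 0 = 0" "pinvol A 1 = 1" "pinvol A (- a) = - pinvol A a"
  "pinvol A (a + b) = pinvol A a + pinvol A b" "pinvol A (a - b) = pinvol A a - pinvol A b"
  "pinvol A (a * b) = pinvol A a * pinvol A b" "pinvol A (r *\<^sub>R a) = r *\<^sub>R pinvol A a"
  "pinvol A (pinvol A a) = a" "pinvol A (sum f I) = (\<Sum>i\<in>I. pinvol A (f i))"
  "pinvol A a = 0 \<longleftrightarrow> a = 0"
  by (simp_all add: pinvol_def split: sum.split)

lemma has_parity_iff: "has_parity A h \<longleftrightarrow> ginvol h = psign A *\<^sub>R h"
  by (cases A) (simp_all add: geven_iff godd_iff)

lemma has_parity_zero [simp]: "has_parity A 0"
  by (simp add: has_parity_iff)

lemma has_parity_add: "has_parity A a \<Longrightarrow> has_parity A b \<Longrightarrow> has_parity A (a + b)"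
  by (simp add: has_parity_iff algebra_simps)

lemma has_parity_diff: "has_parity A a \<Longrightarrow> has_parity A b \<Longrightarrow> has_parity A (a - b)"
  by (simp add: has_parity_iff algebra_simps)

lemma has_parity_left: "has_parity A h \<Longrightarrow> h * a = pinvol A a * h"
  by (cases A) (simp_all add: geven_commute godd_commute)

lemma has_parity_right: "has_parity A h \<Longrightarrow> a * h = h * pinvol A a"
  using has_parity_left[of A h "pinvol A a"] by simp

text \<open>Two terms that each carry \<open>h\<close> multiply to zero whatever stands between
  them; this removes all second-order terms.\<close>

lemma has_parity_sandwich: "has_parity A h \<Longrightarrow> h * h = 0 \<Longrightarrow> h * a * h = 0"
  by (metis has_parity_right mult.assoc mult_zero_left)

subsection \<open>Monomials\<close>

lift_definition gmono :: "'l set \<Rightarrow> 'l::linorder grassmann"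
  is "\<lambda>T S. if S = T \<and> finite T then 1 else 0"
  by (auto elim: rev_finite_subset[of "{_}"])

lemma gcoeff_gmono: "gcoeff (gmono T) S = (if S = T \<and> finite T then 1 else 0)"
  by (simp add: gmono.rep_eq)

lemma gmono_parity: "even (card T) \<Longrightarrow> geven (gmono T)" "odd (card T) \<Longrightarrow> godd (gmono T)"
  by (auto simp: geven_def godd_def gcoeff_gmono)

lemma gcoeff_gmono_mult:
  assumes "finite T" "finite S" "T \<inter> S = {}"
  shows "gcoeff (gmono T * a) (T \<union> S) = gsign T S * gcoeff a S"
proof -
  have "gmul (gcoeff (gmono T)) (gcoeff a) (T \<union> S)
      = (\<Sum>A\<in>{T}. gsign A (T \<union> S - A) * gcoeff (gmono T) A * gcoeff a (T \<union> S - A))"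
    unfolding gmul_def using assms by (intro sum.mono_neutral_right) (auto simp: gcoeff_gmono)
  moreover have "T \<union> S - T = S" using assms by auto
  ultimately show ?thesis by (simp add: times_grassmann.rep_eq gcoeff_gmono assms)
qed

text \<open>Every nonconstant monomial of \<open>a\<close> shares a generator with \<open>T\<close>,
  so its product with \<open>gmono T\<close> vanishes and only the body survives.\<close>

lemma gmono_mult_absorb:
  assumes "\<And>S. gcoeff a S \<noteq> 0 \<Longrightarrow> S \<subseteq> T" "finite T"
  shows "gmono T * a = gbody a *\<^sub>R gmono T"
proof (rule grassmann_eqI)
  fix R
  show "gcoeff (gmono T * a) R = gcoeff (gbody a *\<^sub>R gmono T) R"
  proof (cases "R = T")
    case True
    then show ?thesis using gcoeff_gmono_mult[of T "{}" a] assms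
      by (simp add: gcoeff_gmono gbody_def)
  next
    case False
    have "gmul (gcoeff (gmono T)) (gcoeff a) R = 0"
    proof (rule ccontr)
      assume "\<not> ?thesis"
      then obtain A B where "gcoeff (gmono T) A \<noteq> 0" "gcoeff a B \<noteq> 0" "R = A \<union> B" "A \<inter> B = {}"
        using gmul_supp by blast
      then have "A = T" "B \<subseteq> T" "R = T" using assms by (auto simp: gcoeff_gmono split: if_splits)
      then show False using False by simp
    qed
    then show ?thesis using False by (simp add: times_grassmann.rep_eq gcoeff_gmono)
  qed
qed

lemma gmono_square:
  assumes "T \<noteq> {}" "finite T"
  shows "gmono T * gmono T = 0"
  using gmono_mult_absorb[of "gmono T" T] assms
  by (auto simp: gcoeff_gmono gbody_def split: if_splits)

lemma gmono_nonzero: "finite T \<Longrightarrow> gmono T \<noteq> 0"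
  by (metis gcoeff_gmono gcoeff_simps(1) zero_neq_one)

lemma fresh_gmono:
  fixes S :: "'l::{linorder, infinite} set"
  assumes "finite S"
  obtains T where "finite T" "T \<inter> S = {}" "has_parity A (gmono T)" "gmono T * gmono T = 0" "T \<noteq> {}"
proof -
  \<comment> \<open>Two fresh generators form an even monomial and one forms an odd monomial; both
    square to zero.\<close>
  define m where "m = (case A of Inl _ \<Rightarrow> 2::nat | Inr _ \<Rightarrow> 1)"
  have "infinite (- S)" using assms by (simp add: Compl_eq_Diff_UNIV infinite_UNIV
      Diff_infinite_finite)
  then obtain T where T: "finite T" "card T = m" "T \<subseteq> - S"
    by (meson infinite_arbitrarily_large)
  have "has_parity A (gmono T)"
    using T gmono_parity[of T] by (cases A) (auto simp: m_def)
  moreover have "T \<noteq> {}" using T by (auto simp: m_def split: sum.splits)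
  ultimately show thesis using that[of T] T gmono_square[of T] by auto
qed

text \<open>For a monomial \<open>h\<close> on fresh generators \<open>T\<close>, the coefficient of
  \<open>h * g\<close> at \<open>T \<union> S\<close> is, up to sign, the coefficient of
  \<open>g\<close> at \<open>S\<close>.\<close>

lemma parity_cancel_zero:
  fixes g :: "'l::{linorder, infinite} grassmann"
  assumes "\<And>h. has_parity A h \<Longrightarrow> h * h = 0 \<Longrightarrow> h * g = 0"
  shows "g = 0"
proof (rule grassmann_eqI)
  fix S
  show "gcoeff g S = gcoeff 0 S"
  proof (cases "finite S")
    case True
    then obtain T where T: "finite T" "T \<inter> S = {}" "has_parity A (gmono T)" "gmono T * gmono T = 0"
      using fresh_gmono by metis
    then have "gsign T S * gcoeff g S = 0"
      using gcoeff_gmono_mult[of T S g] True assms[of "gmono T"] by simp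
    then show ?thesis by (simp add: gsign_def)
  qed (use finite_gcoeff in fastforce)
qed

lemma parity_cancel:
  fixes g g' :: "'l::{linorder, infinite} grassmann"
  assumes "\<And>h. has_parity A h \<Longrightarrow> h * h = 0 \<Longrightarrow> h * g = h * g'"
  shows "g = g'"
  using parity_cancel_zero[of A "g - g'"] assms by (simp add: algebra_simps)

text \<open>The increment \<open>h * g\<close> of a function inherits the parity of the function.
  Cancelling \<open>h\<close> leaves the parity of the derivative, shifted by that of the
  coordinate.\<close>

lemma parity_cancel_invol:
  fixes g :: "'l::{linorder, infinite} grassmann"
  assumes "\<And>h. has_parity A h \<Longrightarrow> h * h = 0 \<Longrightarrow> ginvol (h * g) = r *\<^sub>R (h * g)"
  shows "ginvol g = (psign A * r) *\<^sub>R g"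
proof (rule parity_cancel)
  fix h :: "'l grassmann"
  assume h: "has_parity A h" "h * h = 0"
  have "psign A *\<^sub>R (h * ginvol g) = r *\<^sub>R (h * g)"
    using assms[OF h] h by (simp add: has_parity_iff)
  then have "psign A *\<^sub>R psign A *\<^sub>R (h * ginvol g) = psign A *\<^sub>R r *\<^sub>R (h * g)" by simp
  then show "h * ginvol g = h * (psign A * r) *\<^sub>R g" by simp
qed

subsection \<open>The filtration by degree\<close>

text \<open>Membership in the \<open>k\<close>-th power of the augmentation ideal of the algebra
  generated by \<open>N\<close>. Recording a finite \<open>N\<close> bounds the order of nilpotency
  by \<open>card N\<close>; the whole algebra has no uniform bound.\<close>

definition gdeg :: "'l set \<Rightarrow> nat \<Rightarrow> 'l::linorder grassmann \<Rightarrow> bool" where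
  "gdeg N k a \<longleftrightarrow> (\<forall>S. gcoeff a S \<noteq> 0 \<longrightarrow> S \<subseteq> N \<and> k \<le> card S)"

lemma gdeg_mult: "gdeg N k a \<Longrightarrow> gdeg N l b \<Longrightarrow> gdeg N (k + l) (a * b)"
  unfolding gdeg_def times_grassmann.rep_eq
  by (metis Un_least add_mono card_Un_disjoint finite_gcoeff gmul_supp)

lemma gdeg_zero [simp]: "gdeg N k 0"
  by (simp add: gdeg_def)

lemma gdeg_add: "gdeg N k a \<Longrightarrow> gdeg N k b \<Longrightarrow> gdeg N k (a + b)"
  unfolding gdeg_def by (metis add.right_neutral gcoeff_simps(3))

lemma gdeg_uminus: "gdeg N k a \<Longrightarrow> gdeg N k (- a)"
  by (simp add: gdeg_def)

lemma gdeg_scaleR: "gdeg N k a \<Longrightarrow> gdeg N k (r *\<^sub>R a)"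
  by (simp add: gdeg_def)

lemma gdeg_sum: "(\<And>i. i \<in> I \<Longrightarrow> gdeg N k (f i)) \<Longrightarrow> gdeg N k (sum f I)"
  by (induction I rule: infinite_finite_induct) (auto intro: gdeg_add)

lemma gdeg_one: "gdeg N 0 1"
  by (simp add: gdeg_def gcoeff_one)

lemma gdeg_mono: "gdeg N k a \<Longrightarrow> l \<le> k \<Longrightarrow> gdeg N l a"
  unfolding gdeg_def by auto

lemma gdeg_eq_zero:
  assumes "gdeg N k a" "finite N" "card N < k"
  shows "a = 0"
proof (rule grassmann_eqI)
  show "gcoeff a S = gcoeff 0 S" for S
    using assms card_mono[of N S] unfolding gdeg_def by fastforce
qed

lemma gdeg_body_zero:
  assumes "gdeg N 0 a" "gbody a = 0"
  shows "gdeg N 1 a"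
  unfolding gdeg_def
proof (intro allI impI)
  fix S assume S: "gcoeff a S \<noteq> 0"
  then have "S \<noteq> {}" "finite S" using assms(2) finite_gcoeff by (auto simp: gbody_def)
  then show "S \<subseteq> N \<and> 1 \<le> card S" using S assms(1) by (auto simp: gdeg_def Suc_le_eq card_gt_0_iff)
qed

lemma finite_generators:
  assumes "finite X"
  obtains N where "finite N" "\<And>a. a \<in> X \<Longrightarrow> gdeg N 0 a"
proof -
  define N where "N = \<Union> (\<Union>a\<in>X. {S. gcoeff a S \<noteq> 0})"
  have "finite {S. gcoeff a S \<noteq> 0}" for a :: "'a grassmann" using gcoeff[of a] by auto
  then have "finite N" unfolding N_def using assms finite_gcoeff by (intro finite_Union) auto
  moreover have "a \<in> X \<Longrightarrow> gdeg N 0 a" for a unfolding gdeg_def N_def by auto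
  ultimately show thesis by (rule that)
qed

section \<open>Calculus on the points with a given body\<close>

definition fiber :: "nat \<Rightarrow> (nat \<Rightarrow> real) \<Rightarrow> 'l::linorder spoint set" where
  "fiber n x = {z \<in> svec n. pbody z = x}"

lemma finite_sidx [simp]: "finite (sidx n)"
  by (simp add: sidx_def)

lemma sidx_simps [simp]: "Inl i \<in> sidx n \<longleftrightarrow> i < n" "Inr i \<in> sidx n \<longleftrightarrow> i < n"
  by (auto simp: sidx_def)

lemma sum_sidx: "sum f (sidx n) = (\<Sum>i<n. f (Inl i)) + (\<Sum>i<n. f (Inr i))"
  unfolding sidx_def by (subst sum.Plus) auto

lemma svec_parity: "z \<in> svec n \<Longrightarrow> has_parity A (z A)"
  by (simp add: svec_def)

lemma svec_zero: "z \<in> svec n \<Longrightarrow> A \<notin> sidx n \<Longrightarrow> z A = 0"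
  by (simp add: svec_def)

lemma superdomain_fiber: "z \<in> superdomain n U \<Longrightarrow> z \<in> fiber n (pbody z)"
  by (simp add: superdomain_def fiber_def)

lemma fiber_superdomain: "z \<in> fiber n x \<Longrightarrow> x \<in> U \<Longrightarrow> z \<in> superdomain n U"
  by (simp add: superdomain_def fiber_def)

lemma fiber_svec: "z \<in> fiber n x \<Longrightarrow> z \<in> svec n"
  by (simp add: fiber_def)

lemma fiber_parity: "z \<in> fiber n x \<Longrightarrow> has_parity A (z A)"
  by (simp add: fiber_def svec_def)

lemma fiber_update:
  assumes "z \<in> fiber n x" "A \<in> sidx n" "has_parity A h" "h * h = 0"
  shows "z(A := z A + h) \<in> fiber n x"
proof -
  have "gbody h = 0" using assms(4) by (rule gbody_square_zero)
  then have "pbody (z(A := z A + h)) = pbody z" by (auto simp: pbody_def fun_eq_iff)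
  then show ?thesis
    using assms by (auto simp: fiber_def svec_def intro: has_parity_add)
qed

text \<open>The relation behind the description operator in \<open>pd\<close>. All calculus rules
  are proved for it, and \<open>pd\<close> is evaluated afterwards by uniqueness.\<close>

definition has_pd :: "('l::linorder spoint \<Rightarrow> 'l grassmann) \<Rightarrow> 'l spoint \<Rightarrow> sindex \<Rightarrow> 'l grassmann \<Rightarrow> bool"
  where "has_pd f z A g \<longleftrightarrow>
    (\<forall>h. has_parity A h \<and> h * h = 0 \<longrightarrow> f (z(A := z A + h)) = f z + h * g)"

lemma has_pd_unique:
  fixes g :: "'l::{linorder, infinite} grassmann"
  assumes "has_pd f z A g" "has_pd f z A g'"
  shows "g = g'"
proof (rule parity_cancel[of A])
  fix h :: "'l grassmann"
  assume "has_parity A h" "h * h = 0"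
  then have "f z + h * g = f z + h * g'" using assms unfolding has_pd_def by metis
  then show "h * g = h * g'" by simp
qed

lemma pd_eqI:
  fixes g :: "'l::{linorder, infinite} grassmann"
  assumes "has_pd f z A g"
  shows "pd A f z = g"
  using assms has_pd_unique[of f z A] unfolding pd_def has_pd_def by (intro the_equality) blast+

lemma has_pdD: "has_pd f z A g \<Longrightarrow> has_parity A h \<Longrightarrow> h * h = 0 \<Longrightarrow> f (z(A := z A + h)) = f z + h * g"
  by (simp add: has_pd_def)

lemma pd_right_eq:
  fixes g :: "'l::{linorder, infinite} grassmann"
  assumes "has_pd f z A g"
  shows "pd_right A f z = pinvol A g"
  unfolding pd_right_def
proof (rule the_equality)
  show "\<forall>h. has_parity A h \<and> h * h = 0 \<longrightarrow> f (z(A := z A + h)) = f z + pinvol A g * h"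
    using assms by (auto simp: has_pd_def has_parity_left)
next
  fix k
  assume *: "\<forall>h. has_parity A h \<and> h * h = 0 \<longrightarrow> f (z(A := z A + h)) = f z + k * h"
  have "has_pd f z A (pinvol A k)"
    unfolding has_pd_def using * by (metis has_parity_right)
  then have "pinvol A k = g" using assms has_pd_unique by blast
  then show "k = pinvol A g" by auto
qed

lemma has_pd_cong:
  assumes "has_pd f z A g" "z \<in> fiber n x" "A \<in> sidx n" "\<And>y. y \<in> fiber n x \<Longrightarrow> f y = f' y"
  shows "has_pd f' z A g"
  using assms fiber_update[of z n x A] unfolding has_pd_def by metis

lemma has_pd_const: "has_pd (\<lambda>_. c) z A 0"
  by (simp add: has_pd_def)

lemma has_pd_coord: "has_pd (\<lambda>z. z B) z A (if A = B then 1 else 0)"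
  by (simp add: has_pd_def)

lemma has_pd_add: "has_pd f z A f' \<Longrightarrow> has_pd g z A g' \<Longrightarrow> has_pd (\<lambda>z. f z + g z) z A (f' + g')"
  by (simp add: has_pd_def algebra_simps)

lemma has_pd_sum:
  "(\<And>i. i \<in> I \<Longrightarrow> has_pd (f i) z A (f' i)) \<Longrightarrow> has_pd (\<lambda>z. \<Sum>i\<in>I. f i z) z A (\<Sum>i\<in>I. f' i)"
  by (induction I rule: infinite_finite_induct) (auto intro: has_pd_const has_pd_add)

text \<open>Leibniz rule: \<open>h\<close> is moved to the front past \<open>f z\<close>, which
  produces \<open>pinvol A (f z)\<close>, and the product of the two increments is a sandwich, hence
  zero.\<close>

lemma has_pd_mult:
  fixes f g :: "'l::linorder spoint \<Rightarrow> 'l grassmann"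
  assumes "has_pd f z A f'" "has_pd g z A g'"
  shows "has_pd (\<lambda>z. f z * g z) z A (f' * g z + pinvol A (f z) * g')"
  unfolding has_pd_def
proof (intro allI impI)
  fix h :: "'l grassmann"
  assume h: "has_parity A h \<and> h * h = 0"
  have "f (z(A := z A + h)) * g (z(A := z A + h)) = (f z + h * f') * (g z + h * g')"
    using assms h by (simp add: has_pd_def)
  also have "\<dots> = f z * g z + h * f' * g z + (f z * h) * g' + (h * f' * h) * g'"
    by (simp add: algebra_simps)
  also have "\<dots> = f z * g z + h * (f' * g z + pinvol A (f z) * g')"
    using h has_parity_sandwich[of A h f'] has_parity_right[of A h "f z"]
    by (simp add: algebra_simps)
  finally show "f (z(A := z A + h)) * g (z(A := z A + h))
      = f z * g z + h * (f' * g z + pinvol A (f z) * g')" .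
qed

lemma has_pd_ginvol: "has_pd f z A f' \<Longrightarrow> has_pd (\<lambda>z. ginvol (f z)) z A (psign A *\<^sub>R ginvol f')"
  by (auto simp: has_pd_def has_parity_iff)

lemma has_pd_invol:
  fixes g :: "'l::{linorder, infinite} grassmann"
  assumes "has_pd f z A g" "z \<in> fiber n x" "A \<in> sidx n"
    and "\<And>y. y \<in> fiber n x \<Longrightarrow> ginvol (f y) = r *\<^sub>R f y"
  shows "ginvol g = (psign A * r) *\<^sub>R g"
proof (rule parity_cancel_invol)
  fix h :: "'l grassmann" assume h: "has_parity A h" "h * h = 0"
  have e: "h * g = f (z(A := z A + h)) - f z" using has_pdD[OF assms(1) h] by simp
  show "ginvol (h * g) = r *\<^sub>R (h * g)"
    unfolding e using assms(4)[OF fiber_update[OF assms(2,3) h]] assms(4)[OF assms(2)]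
    by (simp add: algebra_simps)
qed

subsection \<open>Functions differentiable \<open>k\<close> times\<close>

text \<open>The order is counted because the chain rule consumes two derivatives of the outer
  function, so that inductions must keep track of how many are left.\<close>

primrec sdiff :: "nat \<Rightarrow> (nat \<Rightarrow> real) \<Rightarrow> nat \<Rightarrow> ('l::linorder spoint \<Rightarrow> 'l grassmann) \<Rightarrow> bool" where
  "sdiff n x 0 f = True"
| "sdiff n x (Suc k) f \<longleftrightarrow> (\<forall>A\<in>sidx n. (\<forall>z\<in>fiber n x. has_pd f z A (pd A f z)) \<and> sdiff n x k (pd A f))"

lemma sdiff_has_pd:
  "sdiff n x k f \<Longrightarrow> 0 < k \<Longrightarrow> z \<in> fiber n x \<Longrightarrow> A \<in> sidx n \<Longrightarrow> has_pd f z A (pd A f z)"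
  by (cases k) auto

lemma sdiff_pd: "sdiff n x (Suc k) f \<Longrightarrow> A \<in> sidx n \<Longrightarrow> sdiff n x k (pd A f)"
  by simp

lemma pd_cong:
  fixes f f' :: "'l::linorder spoint \<Rightarrow> 'l grassmann"
  assumes "z \<in> fiber n x" "A \<in> sidx n" "\<And>y. y \<in> fiber n x \<Longrightarrow> f y = f' y"
  shows "pd A f z = pd A f' z"
proof -
  have "f (z(A := z A + h)) = f' (z(A := z A + h))" if "has_parity A h \<and> h * h = 0"
      for h :: "'l grassmann"
    using assms that fiber_update by blast
  then show ?thesis unfolding pd_def using assms(1,3) by (metis (mono_tags, lifting))
qed

lemma sdiff_cong:
  fixes f f' :: "'l::linorder spoint \<Rightarrow> 'l grassmann"
  assumes "sdiff n x k f" "\<And>y. y \<in> fiber n x \<Longrightarrow> f y = f' y"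
  shows "sdiff n x k f'"
  using assms
proof (induction k arbitrary: f f')
  case (Suc k)
  have "pd A f z = pd A f' z" if "z \<in> fiber n x" "A \<in> sidx n" for A z
    using that Suc.prems(2) by (rule pd_cong)
  then show ?case
    using Suc.prems Suc.IH[of "pd A f" "pd A f'" for A] has_pd_cong[of f _ _ _ n x f'] by auto
qed simp

lemma sdiff_SucI:
  fixes f :: "'l::{linorder, infinite} spoint \<Rightarrow> 'l grassmann"
  assumes "\<And>z A. z \<in> fiber n x \<Longrightarrow> A \<in> sidx n \<Longrightarrow> has_pd f z A (g A z)"
    and "\<And>A. A \<in> sidx n \<Longrightarrow> sdiff n x k (g A)"
  shows "sdiff n x (Suc k) f"
proof -
  have eq: "pd A f z = g A z" if "z \<in> fiber n x" "A \<in> sidx n" for z A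
    using assms(1)[OF that] by (rule pd_eqI)
  then have "sdiff n x k (pd A f)" if "A \<in> sidx n" for A
    using sdiff_cong[OF assms(2)[OF that], of "pd A f"] that by simp
  then show ?thesis using assms(1) eq by simp
qed

lemma sdiff_mono: "sdiff n x k f \<Longrightarrow> l \<le> k \<Longrightarrow> sdiff n x l f"
proof (induction k arbitrary: l f)
  case (Suc k)
  then show ?case by (cases l) auto
qed simp

lemma sdiff_sum:
  fixes f :: "'i \<Rightarrow> 'l::{linorder, infinite} spoint \<Rightarrow> 'l grassmann"
  assumes "\<And>i. i \<in> I \<Longrightarrow> sdiff n x k (f i)"
  shows "sdiff n x k (\<lambda>z. \<Sum>i\<in>I. f i z)"
  using assms
proof (induction k arbitrary: f)
  case (Suc k)
  show ?case
    by (rule sdiff_SucI[where g = "\<lambda>A z. \<Sum>i\<in>I. pd A (f i) z"])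
      (use Suc in \<open>auto intro!: has_pd_sum\<close>)
qed simp

lemma sdiff_add:
  fixes f g :: "'l::{linorder, infinite} spoint \<Rightarrow> 'l grassmann"
  assumes "sdiff n x k f" "sdiff n x k g"
  shows "sdiff n x k (\<lambda>z. f z + g z)"
  using sdiff_sum[of "{True, False}" n x k "\<lambda>b. if b then f else g"] assms by simp

lemma sdiff_scaleR:
  fixes f :: "'l::{linorder, infinite} spoint \<Rightarrow> 'l grassmann"
  assumes "sdiff n x k f"
  shows "sdiff n x k (\<lambda>z. r *\<^sub>R f z)"
  using assms
proof (induction k arbitrary: f)
  case (Suc k)
  have "has_pd (\<lambda>z. r *\<^sub>R f z) z A (r *\<^sub>R pd A f z)" if "z \<in> fiber n x" "A \<in> sidx n" for z A
    using Suc.prems that by (simp add: has_pd_def algebra_simps)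
  then show ?case
    by (rule sdiff_SucI[where g = "\<lambda>A z. r *\<^sub>R pd A f z"]) (use Suc in auto)
qed simp

lemma sdiff_ginvol:
  fixes f :: "'l::{linorder, infinite} spoint \<Rightarrow> 'l grassmann"
  assumes "sdiff n x k f"
  shows "sdiff n x k (\<lambda>z. ginvol (f z))"
  using assms
proof (induction k arbitrary: f)
  case (Suc k)
  show ?case
    by (rule sdiff_SucI[where g = "\<lambda>A z. psign A *\<^sub>R ginvol (pd A f z)"])
      (use Suc in \<open>auto intro!: has_pd_ginvol sdiff_scaleR\<close>)
qed simp

lemma sdiff_pinvol:
  fixes f :: "'l::{linorder, infinite} spoint \<Rightarrow> 'l grassmann"
  assumes "sdiff n x k f"
  shows "sdiff n x k (\<lambda>z. pinvol A (f z))"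
  using assms sdiff_ginvol by (cases A) auto

lemma sdiff_mult:
  fixes f g :: "'l::{linorder, infinite} spoint \<Rightarrow> 'l grassmann"
  assumes "sdiff n x k f" "sdiff n x k g"
  shows "sdiff n x k (\<lambda>z. f z * g z)"
  using assms
proof (induction k arbitrary: f g)
  case (Suc k)
  have *: "sdiff n x k f" "sdiff n x k g"
    using Suc.prems by (auto intro: sdiff_mono[of n x "Suc k"] simp del: sdiff.simps)
  have "sdiff n x k (\<lambda>z. pd A f z * g z + pinvol A (f z) * pd A g z)" if "A \<in> sidx n" for A
    using Suc.prems that * by (intro sdiff_add Suc.IH sdiff_pinvol sdiff_pd[of n x k])
  moreover have "has_pd (\<lambda>z. f z * g z) z A (pd A f z * g z + pinvol A (f z) * pd A g z)"
    if "z \<in> fiber n x" "A \<in> sidx n" for z A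
    using Suc.prems that by (intro has_pd_mult) auto
  ultimately show ?case
    by (intro sdiff_SucI[where g = "\<lambda>A z. pd A f z * g z + pinvol A (f z) * pd A g z"])
qed simp

subsection \<open>The chain rule\<close>

definition shift :: "'l::linorder spoint \<Rightarrow> 'l grassmann \<Rightarrow> (sindex \<Rightarrow> 'l grassmann) \<Rightarrow> sindex set \<Rightarrow>
    'l spoint"
  where "shift p h v S = (\<lambda>B. if B \<in> S then p B + h * v B else p B)"

lemma shift_insert: "B \<notin> S \<Longrightarrow> shift p h v (insert B S)
    = (shift p h v S)(B := shift p h v S B + h * v B)"
  by (auto simp: shift_def fun_eq_iff)

text \<open>The coordinates are moved one at a time by \<open>h * v B\<close>, each an admissible
  increment. A step uses the derivative at the point already moved; this differs from the derivative
  at \<open>p\<close> by a multiple of \<open>h\<close>, which the factor \<open>h * v B\<close>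
  kills.\<close>

lemma shift_increment:
  fixes f :: "'l::{linorder, infinite} spoint \<Rightarrow> 'l grassmann"
  assumes p: "p \<in> fiber n x" and h: "has_parity A h" "h * h = 0"
    and v: "\<And>B. B \<in> sidx n \<Longrightarrow> has_parity B (h * v B)" and S: "S \<subseteq> sidx n"
    and f: "sdiff n x 2 f"
  shows "f (shift p h v S) = f p + h * (\<Sum>B\<in>S. v B * pd B f p)"
proof -
  have sq: "h * v B * (h * v B) = 0" for B
    using has_parity_sandwich[OF h, of "v B"] by (simp add: mult.assoc[symmetric])
  have "finite S" using S by (rule finite_subset) simp
  \<comment> \<open>The middle claim, with an unspecified remainder \<open>r\<close>, is the one
    applied to the partial derivatives of \<open>f\<close>, for which only one further derivative is
    at hand.\<close>
  then have "S \<subseteq> sidx n \<longrightarrow> shift p h v S \<in> fiber n x \<and>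
     (\<forall>f. sdiff n x (Suc 0) f \<longrightarrow> (\<exists>r. f (shift p h v S) = f p + h * r)) \<and>
     (\<forall>f. sdiff n x 2 f \<longrightarrow> f (shift p h v S) = f p + h * (\<Sum>B\<in>S. v B * pd B f p))"
  proof (induction S rule: finite_induct)
    case empty
    have "shift p h v {} = p" by (simp add: shift_def)
    then show ?case using p by (auto intro: exI[of _ 0])
  next
    case (insert B S)
    show ?case
    proof (intro impI)
      assume BS: "insert B S \<subseteq> sidx n"
      then have B: "B \<in> sidx n" and IH: "shift p h v S \<in> fiber n x"
        "\<And>f. sdiff n x (Suc 0) f \<Longrightarrow> \<exists>r. f (shift p h v S) = f p + h * r"
        "\<And>f. sdiff n x 2 f \<Longrightarrow> f (shift p h v S) = f p + h * (\<Sum>B\<in>S. v B * pd B f p)"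
        using insert.IH by auto
      note e = shift_insert[OF insert.hyps(2), of p h v]
      have step: "f (shift p h v (insert B S)) = f (shift p h v S) + h * v B * pd B f (shift p h v S)"
        if "sdiff n x (Suc 0) f" for f
        unfolding e using sdiff_has_pd[OF that _ IH(1) B] v[OF B] sq by (simp add: has_pd_def)
      have 1: "shift p h v (insert B S) \<in> fiber n x"
        unfolding e using fiber_update[OF IH(1) B v[OF B] sq] .
      have 2: "\<exists>r. f (shift p h v (insert B S)) = f p + h * r" if f1: "sdiff n x (Suc 0) f" for f
      proof -
        obtain r where "f (shift p h v S) = f p + h * r" using IH(2)[OF f1] by blast
        then have "f (shift p h v (insert B S)) = f p + h * (r + v B * pd B f (shift p h v S))"
          using step[OF f1] by (simp add: algebra_simps)
        then show ?thesis by blast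
      qed
      have 3: "f (shift p h v (insert B S)) = f p + h * (\<Sum>B\<in>insert B S. v B * pd B f p)"
        if f: "sdiff n x 2 f" for f
      proof -
        have f1: "sdiff n x (Suc 0) f" by (rule sdiff_mono[OF f]) simp
        have "sdiff n x (Suc 0) (pd B f)" using f B by (simp add: numeral_2_eq_2)
        from IH(2)[OF this] obtain r where r: "pd B f (shift p h v S) = pd B f p + h * r" by blast
        have "h * v B * (h * r) = 0"
          using has_parity_sandwich[OF h, of "v B"] by (simp add: mult.assoc[symmetric])
        then show ?thesis
          using step[OF f1] IH(3)[OF f] insert.hyps r by (simp add: algebra_simps)
      qed
      show "shift p h v (insert B S) \<in> fiber n x \<and>
        (\<forall>f. sdiff n x (Suc 0) f \<longrightarrow> (\<exists>r. f (shift p h v (insert B S)) = f p + h * r)) \<and>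
        (\<forall>f. sdiff n x 2 f \<longrightarrow> f (shift p h v (insert B S))
            = f p + h * (\<Sum>B\<in>insert B S. v B * pd B f p))"
        using 1 2 3 by blast
    qed
  qed
  then show ?thesis using S f by blast
qed

definition fiber_map :: "nat \<Rightarrow> (nat \<Rightarrow> real) \<Rightarrow> (nat \<Rightarrow> real) \<Rightarrow> ('l::linorder spoint \<Rightarrow> 'l spoint) \<Rightarrow> bool"
  where "fiber_map n x x' G \<longleftrightarrow> (\<forall>z\<in>fiber n x. G z \<in> fiber n x') \<and>
    (\<forall>B\<in>sidx n. \<forall>k. sdiff n x k (\<lambda>z. G z B))"

lemma fiber_mapD:
  assumes "fiber_map n x x' G"
  shows "z \<in> fiber n x \<Longrightarrow> G z \<in> fiber n x'"
    and "B \<in> sidx n \<Longrightarrow> sdiff n x k (\<lambda>z. G z B)"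
    and "z \<in> fiber n x \<Longrightarrow> A \<in> sidx n \<Longrightarrow> B \<in> sidx n \<Longrightarrow>
      has_pd (\<lambda>z. G z B) z A (pd A (\<lambda>z. G z B) z)"
  using assms sdiff_has_pd[of n x "Suc 0" "\<lambda>z. G z B"] unfolding fiber_map_def by blast+

lemma fiber_map_update:
  fixes G :: "'l::{linorder, infinite} spoint \<Rightarrow> 'l spoint"
  assumes G: "fiber_map n x x' G" and z: "z \<in> fiber n x" and A: "A \<in> sidx n"
    and h: "has_parity A h" "h * h = 0"
  shows "G (z(A := z A + h)) = shift (G z) h (\<lambda>B. pd A (\<lambda>z. G z B) z) (sidx n)"
    and "B \<in> sidx n \<Longrightarrow> has_parity B (h * pd A (\<lambda>z. G z B) z)"
proof -
  let ?z = "z(A := z A + h)"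
  have z': "?z \<in> fiber n x" using z A h by (rule fiber_update)
  have eq: "G ?z B = G z B + h * pd A (\<lambda>z. G z B) z" if "B \<in> sidx n" for B
    using has_pdD[OF fiber_mapD(3)[OF G z A that] h] .
  have out: "G ?z B = 0" "G z B = 0" if "B \<notin> sidx n" for B
    using that fiber_mapD(1)[OF G] z z' by (simp_all add: fiber_def svec_def)
  show "G ?z = shift (G z) h (\<lambda>B. pd A (\<lambda>z. G z B) z) (sidx n)"
    using eq out by (auto simp: shift_def fun_eq_iff)
  show "has_parity B (h * pd A (\<lambda>z. G z B) z)" if "B \<in> sidx n"
  proof -
    \<comment> \<open>The increment of a coordinate is the difference of the coordinates of two
      points, and therefore has their parity.\<close>
    have "h * pd A (\<lambda>z. G z B) z = G ?z B - G z B" using eq[OF that] by simp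
    also have "has_parity B \<dots>"
      by (intro has_parity_diff fiber_parity[OF fiber_mapD(1)[OF G]] z z')
    finally show ?thesis .
  qed
qed

lemma has_pd_compose:
  fixes G :: "'l::{linorder, infinite} spoint \<Rightarrow> 'l spoint"
  assumes G: "fiber_map n x x' G" and f: "sdiff n x' 2 f"
    and z: "z \<in> fiber n x" and A: "A \<in> sidx n"
  shows "has_pd (\<lambda>z. f (G z)) z A (\<Sum>B\<in>sidx n. pd A (\<lambda>z. G z B) z * pd B f (G z))"
  unfolding has_pd_def
proof (intro allI impI)
  fix h :: "'l grassmann" assume h: "has_parity A h \<and> h * h = 0"
  show "f (G (z(A := z A + h))) = f (G z) + h * (\<Sum>B\<in>sidx n. pd A (\<lambda>z. G z B) z * pd B f (G z))"
    using fiber_map_update[OF G z A] h f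
      shift_increment[OF fiber_mapD(1)[OF G z], of A h "\<lambda>B. pd A (\<lambda>z. G z B) z" "sidx n" f]
    by simp
qed

lemma sdiff_compose:
  fixes G :: "'l::{linorder, infinite} spoint \<Rightarrow> 'l spoint"
  assumes G: "fiber_map n x x' G" and f: "\<And>j. sdiff n x' j f"
  shows "sdiff n x k (\<lambda>z. f (G z))"
  using f
proof (induction k arbitrary: f)
  case (Suc k)
  have "sdiff n x k (\<lambda>z. pd B f (G z))" if "B \<in> sidx n" for B
    using that Suc.prems by (intro Suc.IH sdiff_pd)
  moreover have "sdiff n x k (\<lambda>z. pd A (\<lambda>z. G z B) z)" if "A \<in> sidx n" "B \<in> sidx n" for A B
    using fiber_mapD(2)[OF G that(2), of "Suc k"] that(1) by simp
  ultimately show ?case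
    by (intro sdiff_SucI[OF has_pd_compose[OF G Suc.prems]] sdiff_sum sdiff_mult)
qed simp

lemma fiber_map_compose:
  fixes G :: "'l::{linorder, infinite} spoint \<Rightarrow> 'l spoint"
  assumes "fiber_map n x x' G" "fiber_map n x' x'' F"
  shows "fiber_map n x x'' (F \<circ> G)"
  unfolding fiber_map_def o_def
  using fiber_mapD(1)[OF assms(1)] fiber_mapD(1)[OF assms(2)]
    sdiff_compose[OF assms(1) fiber_mapD(2)[OF assms(2)]] by auto

lemma pd_compose:
  fixes G :: "'l::{linorder, infinite} spoint \<Rightarrow> 'l spoint"
  assumes "fiber_map n x x' G" "fiber_map n x' x'' F" "z \<in> fiber n x" "A \<in> sidx n" "C \<in> sidx n"
  shows "pd A (\<lambda>z. F (G z) C) z =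
    (\<Sum>B\<in>sidx n. pd A (\<lambda>z. G z B) z * pd B (\<lambda>y. F y C) (G z))"
  by (rule pd_eqI[OF has_pd_compose[OF assms(1) fiber_mapD(2)[OF assms(2,5)] assms(3,4)]])

lemma fiber_map_pd_invol:
  fixes G :: "'l::{linorder, infinite} spoint \<Rightarrow> 'l spoint"
  assumes G: "fiber_map n x x' G" and z: "z \<in> fiber n x" and A: "A \<in> sidx n" and B: "B \<in> sidx n"
  shows "ginvol (pd A (\<lambda>z. G z B) z) = (psign A * psign B) *\<^sub>R pd A (\<lambda>z. G z B) z"
proof (rule has_pd_invol[OF fiber_mapD(3)[OF G z A B] z A])
  show "ginvol (G y B) = psign B *\<^sub>R G y B" if "y \<in> fiber n x" for y
    using fiber_parity[OF fiber_mapD(1)[OF G that]] by (simp add: has_parity_iff)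
qed

section \<open>Superfunctions are differentiable infinitely often\<close>

text \<open>
  On the points with a given body a superfunction is a power series in the souls of the
  coordinates. The coefficients \<open>a\<close> of words in the (non-commuting) variables may be arbitrary
  here; since the souls are nilpotent, the partial sums become constant.
\<close>

fun psum :: "nat \<Rightarrow> nat \<Rightarrow> (sindex list \<Rightarrow> 'l grassmann) \<Rightarrow> 'l::linorder spoint \<Rightarrow> 'l grassmann" where
  "psum n 0 a z = 0"
| "psum n (Suc K) a z = a [] + (\<Sum>B\<in>sidx n. gsoul (z B) * psum n K (\<lambda>v. a (B # v)) z)"

text \<open>The sign for moving an increment of the variable \<open>A\<close> past the variable \<open>B\<close>.\<close>

definition csign :: "sindex \<Rightarrow> sindex \<Rightarrow> real" where
  "csign A B = (case A of Inl _ \<Rightarrow> 1 | Inr _ \<Rightarrow> psign B)"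

text \<open>The coefficient of the derivative at a word \<open>v\<close> is the sum of
  \<open>a\<close> over all insertions of the letter \<open>A\<close> into \<open>v\<close>, each
  with the sign for moving the increment to the front past the letters before it.\<close>

fun dcoeff :: "sindex \<Rightarrow> (sindex list \<Rightarrow> 'l::linorder grassmann) \<Rightarrow> sindex list \<Rightarrow> 'l grassmann" where
  "dcoeff A a [] = a [A]"
| "dcoeff A a (B # v) = a (A # B # v) + csign A B *\<^sub>R dcoeff A (\<lambda>u. a (B # u)) v"

lemma gsoul_parity: "has_parity B b \<Longrightarrow> has_parity B (gsoul b)"
  by (cases B) (auto simp: gsoul_def geven_iff godd_iff gbody_godd[unfolded godd_iff] of_real_def)

lemma gsoul_commute:
  assumes "has_parity A h" "has_parity B b"
  shows "gsoul b * h = csign A B *\<^sub>R (h * gsoul b)"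
  using has_parity_right[OF assms(1), of "gsoul b"] gsoul_parity[OF assms(2)]
  by (cases A) (auto simp: csign_def has_parity_iff)

lemma psum_add: "psum n K (\<lambda>v. a v + b v) z = psum n K a z + psum n K b z"
  by (induction K arbitrary: a b) (simp_all add: algebra_simps sum.distrib)

lemma psum_scaleR: "psum n K (\<lambda>v. r *\<^sub>R a v) z = r *\<^sub>R psum n K a z"
  by (induction K arbitrary: a) (simp_all add: algebra_simps scaleR_sum_right)

lemma psum_zero: "psum n K (\<lambda>_. 0) z = 0"
  by (induction K) simp_all

lemma gsoul_increment: "gbody h = 0 \<Longrightarrow> gsoul (b + h) = gsoul b + h"
  by (simp add: gsoul_def)

text \<open>Splitting off the first letter, the increment comes either from this letter or, by
  induction, from the rest of the word, where it has to pass the letter at the cost of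
  \<open>csign\<close>; both at once give zero. The truncation drops from \<open>Suc K\<close> to
  \<open>K\<close> since differentiation deletes one letter.\<close>

lemma psum_increment:
  assumes z: "z \<in> svec n" and A: "A \<in> sidx n" and h: "has_parity A h" "h * h = 0"
  shows "psum n (Suc K) a (z(A := z A + h)) = psum n (Suc K) a z + h * psum n K (dcoeff A a) z"
proof (induction K arbitrary: a)
  case (Suc K)
  define Q where "Q B = psum n (Suc K) (\<lambda>v. a (B # v)) z" for B
  define R where "R B = psum n K (dcoeff A (\<lambda>v. a (B # v))) z" for B
  let ?z = "z(A := z A + h)"
  have s: "gsoul (?z B) = gsoul (z B) + (if B = A then h else 0)" for B
    using gsoul_increment[OF gbody_square_zero[OF h(2)]] by simp
  have hh: "h * (h * x) = 0" for x using h(2) by (simp add: mult.assoc[symmetric])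
  have sh: "gsoul (z B) * (h * R B) = csign A B *\<^sub>R (h * (gsoul (z B) * R B))" for B
    using gsoul_commute[OF h(1) svec_parity[OF z, of B]] by (simp add: mult.assoc[symmetric])
  have "psum n (Suc (Suc K)) a ?z = a [] + (\<Sum>B\<in>sidx n. gsoul (?z B) * psum n (Suc K) (\<lambda>v. a (B #
      v)) ?z)"
    by simp
  also have "(\<Sum>B\<in>sidx n. gsoul (?z B) * psum n (Suc K) (\<lambda>v. a (B # v)) ?z)
      = (\<Sum>B\<in>sidx n. gsoul (?z B) * (Q B + h * R B))"
    by (simp only: Suc.IH Q_def R_def)
  also have "\<dots> = (\<Sum>B\<in>sidx n. gsoul (z B) * Q B + csign A B *\<^sub>R (h * (gsoul (z B) * R B))
      + (if B = A then h * Q B else 0))"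
    unfolding s by (rule sum.cong[OF refl]) (simp add: algebra_simps sh hh)
  also have "\<dots> = (\<Sum>B\<in>sidx n. gsoul (z B) * Q B)
      + h * (\<Sum>B\<in>sidx n. csign A B *\<^sub>R (gsoul (z B) * R B)) + h * Q A"
    using A by (simp add: sum.distrib sum_distrib_left)
  finally have l0: "psum n (Suc (Suc K)) a ?z = a [] + ((\<Sum>B\<in>sidx n. gsoul (z B) * Q B)
      + h * (\<Sum>B\<in>sidx n. csign A B *\<^sub>R (gsoul (z B) * R B)) + h * Q A)" .
  have "psum n (Suc (Suc K)) a z = a [] + (\<Sum>B\<in>sidx n. gsoul (z B) * Q B)"
    by (simp only: psum.simps(2) Q_def)
  then have l: "psum n (Suc (Suc K)) a ?z = psum n (Suc (Suc K)) a z
      + h * ((\<Sum>B\<in>sidx n. csign A B *\<^sub>R (gsoul (z B) * R B)) + Q A)"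
    unfolding l0 by (simp add: algebra_simps del: psum.simps)
  have "psum n (Suc K) (dcoeff A a) z = a [A] +
     (\<Sum>B\<in>sidx n. gsoul (z B) * (psum n K (\<lambda>v. a (A # B # v)) z + csign A B *\<^sub>R R B))"
    by (simp add: psum_add psum_scaleR R_def)
  also have "\<dots> = (\<Sum>B\<in>sidx n. csign A B *\<^sub>R (gsoul (z B) * R B)) + Q A"
    by (simp add: Q_def algebra_simps sum.distrib)
  finally have r: "psum n (Suc K) (dcoeff A a) z
      = (\<Sum>B\<in>sidx n. csign A B *\<^sub>R (gsoul (z B) * R B)) + Q A" .
  show ?case unfolding r by (rule l)
qed simp

text \<open>The prefix \<open>x\<close> has degree at least \<open>k\<close>, and every letter adds
  at least one. A word with \<open>j\<close> further letters then exceeds \<open>card N\<close> and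
  vanishes, so longer words contribute nothing.\<close>

lemma psum_stable_aux:
  assumes "finite N" "\<And>B. B \<in> sidx n \<Longrightarrow> gdeg N 1 (gsoul (z B))"
  shows "gdeg N k x \<Longrightarrow> card N < k + j \<Longrightarrow> x * psum n (j + m) a z = x * psum n j a z"
proof (induction j arbitrary: k x a)
  case 0
  then have "x = 0" using gdeg_eq_zero[of N k x] assms(1) by simp
  then show ?case by simp
next
  case (Suc j)
  have "x * gsoul (z B) * psum n (j + m) b z = x * gsoul (z B) * psum n j b z"
    if "B \<in> sidx n" for B b
    using Suc.IH[of "k + 1"] gdeg_mult[OF Suc.prems(1) assms(2)[OF that]] Suc.prems(2) by simp
  then show ?case
    by (simp add: algebra_simps sum_distrib_left)
qed

lemma psum_stable:
  fixes z :: "'l::linorder spoint"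
  obtains K0 where "\<And>K (a :: _ \<Rightarrow> 'l grassmann). K0 \<le> K \<Longrightarrow> psum n K a z = psum n K0 a z"
proof -
  obtain N where N: "finite N" "\<And>B. B \<in> sidx n \<Longrightarrow> gdeg N 0 (gsoul (z B))"
    by (rule finite_generators[of "(\<lambda>B. gsoul (z B)) ` sidx n"]) auto
  have *: "psum n (Suc (card N) + m) a z = psum n (Suc (card N)) a z"
      for m and a :: "_ \<Rightarrow> 'l grassmann"
    using psum_stable_aux[OF N(1) gdeg_body_zero[OF N(2)] gdeg_one, where j = "Suc (card N)" and m
        = m] by simp
  show thesis
  proof
    show "psum n K a z = psum n (Suc (card N)) a z" if "Suc (card N) \<le> K"
        for K and a :: "_ \<Rightarrow> 'l grassmann"
      using *[where m = "K - Suc (card N)"] that by simp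
  qed
qed

definition pseries :: "nat \<Rightarrow> (nat \<Rightarrow> real) \<Rightarrow> ('l::linorder spoint \<Rightarrow> 'l grassmann) \<Rightarrow> (sindex list \<Rightarrow>
    'l grassmann) \<Rightarrow> bool"
  where "pseries n x f a \<longleftrightarrow> (\<forall>z\<in>fiber n x. \<exists>K0. \<forall>K\<ge>K0. f z = psum n K a z)"

lemma pseries_has_pd:
  fixes f :: "'l::linorder spoint \<Rightarrow> 'l grassmann"
  assumes f: "pseries n x f a" and z: "z \<in> fiber n x" and A: "A \<in> sidx n"
  shows "\<exists>g. has_pd f z A g \<and> (\<exists>K0. \<forall>K\<ge>K0. g = psum n K (dcoeff A a) z)"
proof -
  obtain K0 where K0: "\<And>K. K0 \<le> K \<Longrightarrow> psum n K (dcoeff A a) z = psum n K0 (dcoeff A a) z"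
    using psum_stable[of n z] by metis
  have "has_pd f z A (psum n K0 (dcoeff A a) z)"
    unfolding has_pd_def
  proof (intro allI impI)
    fix h :: "'l grassmann"
    assume h: "has_parity A h \<and> h * h = 0"
    let ?z = "z(A := z A + h)"
    have "?z \<in> fiber n x" using fiber_update z A h by blast
    then obtain K1 where K1: "\<And>K. K1 \<le> K \<Longrightarrow> f ?z = psum n K a ?z"
      using f unfolding pseries_def by blast
    obtain K2 where K2: "\<And>K. K2 \<le> K \<Longrightarrow> f z = psum n K a z"
      using f z unfolding pseries_def by blast
    \<comment> \<open>The truncation order needed at the moved point depends on \<open>h\<close>,
      which may bring in new generators. The derivative does not depend on it, because its series at
      \<open>z\<close> is constant from \<open>K0\<close> on.\<close>
    define K where "K = max K0 (max K1 K2)"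
    have "f ?z = psum n (Suc K) a z + h * psum n K (dcoeff A a) z"
      using K1[of "Suc K"] psum_increment[OF fiber_svec[OF z] A, of h K a] h by (simp add: K_def)
    moreover have "f z = psum n (Suc K) a z" using K2[of "Suc K"] by (simp add: K_def)
    moreover have "psum n K (dcoeff A a) z = psum n K0 (dcoeff A a) z"
      by (rule K0) (simp add: K_def)
    ultimately show "f ?z = f z + h * psum n K0 (dcoeff A a) z" by simp
  qed
  moreover have "\<forall>K\<ge>K0. psum n K0 (dcoeff A a) z = psum n K (dcoeff A a) z"
    by (intro allI impI K0[symmetric])
  ultimately show ?thesis by blast
qed

lemma pseries_sdiff:
  fixes f :: "'l::{linorder, infinite} spoint \<Rightarrow> 'l grassmann"
  assumes "pseries n x f a"
  shows "sdiff n x k f"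
  using assms
proof (induction k arbitrary: f a)
  case (Suc k)
  have *: "has_pd f z A (pd A f z) \<and> (\<exists>K0. \<forall>K\<ge>K0. pd A f z = psum n K (dcoeff A a) z)"
    if z: "z \<in> fiber n x" and A: "A \<in> sidx n" for A z
    using pseries_has_pd[OF Suc.prems z A] pd_eqI by blast
  then have "pseries n x (pd A f) (dcoeff A a)" if "A \<in> sidx n" for A
    using that by (simp add: pseries_def)
  then have "sdiff n x k (pd A f)" if "A \<in> sidx n" for A
    using that Suc.IH by blast
  then show ?case using * by simp
qed simp

lemma pseries_gbody:
  assumes "pseries n x f a" "z \<in> fiber n x"
  shows "gbody (f z) = gbody (a [])"
proof -
  obtain K0 where "\<forall>K\<ge>K0. f z = psum n K a z" using assms unfolding pseries_def by blast
  then have "f z = psum n (Suc K0) a z" by (simp del: psum.simps)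
  then show ?thesis by (simp add: gbody_sum)
qed

lemma pseries_sum:
  fixes f :: "'i \<Rightarrow> 'l::linorder spoint \<Rightarrow> 'l grassmann"
  assumes "finite I" "\<And>i. i \<in> I \<Longrightarrow> \<exists>a. pseries n x (f i) a"
  shows "\<exists>a. pseries n x (\<lambda>z. \<Sum>i\<in>I. f i z) a"
  using assms
proof (induction I rule: finite_induct)
  case empty
  then show ?case by (intro exI[of _ "\<lambda>_. 0"]) (simp add: pseries_def psum_zero)
next
  case (insert i I)
  obtain a b where ab: "pseries n x (f i) a" "pseries n x (\<lambda>z. \<Sum>i\<in>I. f i z) b"
    using insert by blast
  have "pseries n x (\<lambda>z. \<Sum>i\<in>insert i I. f i z) (\<lambda>v. a v + b v)"
    unfolding pseries_def
  proof
    fix z :: "'l spoint"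
    assume z: "z \<in> fiber n x"
    obtain K0 K1 where "\<forall>K\<ge>K0. f i z = psum n K a z" "\<forall>K\<ge>K1. (\<Sum>i\<in>I. f i z) = psum n K b z"
      using ab z unfolding pseries_def by blast
    then show "\<exists>K0. \<forall>K\<ge>K0. (\<Sum>i\<in>insert i I. f i z) = psum n K (\<lambda>v. a v + b v) z"
      using insert.hyps by (intro exI[of _ "max K0 K1"]) (simp add: psum_add, metis)
  qed
  then show ?case by blast
qed

lemma pseries_mult_soul:
  fixes f :: "'l::linorder spoint \<Rightarrow> 'l grassmann"
  assumes f: "pseries n x f a" and B: "B \<in> sidx n"
  shows "pseries n x (\<lambda>z. gsoul (z B) * f z) (\<lambda>v. case v of [] \<Rightarrow> 0 | C # u \<Rightarrow> if C
      = B then a u else 0)"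
    (is "pseries n x _ ?a")
  unfolding pseries_def
proof
  fix z :: "'l spoint"
  assume "z \<in> fiber n x"
  then obtain K0 where K0: "\<forall>K\<ge>K0. f z = psum n K a z" using f unfolding pseries_def by blast
  have "psum n (Suc K) ?a z = gsoul (z B) * psum n K a z" for K
  proof -
    have "gsoul (z C) * psum n K (\<lambda>v. ?a (C # v)) z = (if C
        = B then gsoul (z B) * psum n K a z else 0)"
      for C by (simp add: psum_zero)
    then have "psum n (Suc K) ?a z = (\<Sum>C\<in>sidx n. if C = B then gsoul (z B) * psum n K a z else 0)"
      by (simp only: psum.simps(2)) simp
    then show ?thesis using B by simp
  qed
  then have "gsoul (z B) * f z = psum n K ?a z" if "Suc K0 \<le> K" for K
    using that K0 by (cases K) auto
  then show "\<exists>K0. \<forall>K\<ge>K0. gsoul (z B) * f z = psum n K ?a z" by blast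
qed

lemma pseries_cong:
  "pseries n x f a \<Longrightarrow> (\<And>z. z \<in> fiber n x \<Longrightarrow> f z = g z) \<Longrightarrow> pseries n x g a"
  by (simp add: pseries_def)

lemma pseries_odd_monomial:
  assumes "pseries n x f a" "I \<subseteq> {..<n}"
  shows "\<exists>a. pseries n x (\<lambda>z. odd_monomial z I * f z) a"
proof -
  have "finite I" using assms(2) finite_subset by blast
  then have "set (sorted_list_of_set I) \<subseteq> {..<n}" using assms(2) by simp
  moreover have "\<exists>a. pseries n x (\<lambda>z. prod_list (map (\<lambda>j. z (Inr j)) js) * f z) a"
    if "set js \<subseteq> {..<n}" for js
    using that
  proof (induction js)
    case (Cons j js)
    then obtain b where "pseries n x (\<lambda>z. prod_list (map (\<lambda>j. z (Inr j)) js) * f z) b" by auto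
    then have p: "\<exists>b. pseries n x (\<lambda>z. gsoul (z (Inr j)) * (prod_list (map (\<lambda>j. z (Inr j)) js) * f
        z)) b"
      using Cons.prems by (intro exI) (rule pseries_mult_soul, auto)
    have "gsoul (z (Inr j)) = z (Inr j)" if "z \<in> fiber n x" for z :: "'a spoint"
      using fiber_parity[OF that, of "Inr j"] by (simp add: gsoul_def gbody_godd)
    then have "\<exists>b. pseries n x (\<lambda>z. z (Inr j) * (prod_list (map (\<lambda>j. z (Inr j)) js) * f z)) b"
      using p pseries_cong by (metis (no_types, lifting))
    then show ?case by (simp add: mult.assoc)
  qed (use assms(1) in auto)
  ultimately show ?thesis unfolding odd_monomial_def by blast
qed

lemma psum_words:
  "psum n K a z = (\<Sum>v | set v \<subseteq> sidx n \<and> length v < K. prod_list (map (\<lambda>B. gsoul (z B)) v) * a v)"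
proof (induction K arbitrary: a)
  case (Suc K)
  let ?W = "\<lambda>K. {v. set v \<subseteq> sidx n \<and> length v < K}"
  let ?m = "\<lambda>v. prod_list (map (\<lambda>B. gsoul (z B)) v)"
  have fin: "finite (?W K)" for K
    using finite_lists_length_le[OF finite_sidx, of n K] by (rule rev_finite_subset) auto
  have W: "?W (Suc K) = insert [] ((\<lambda>(B, v). B # v) ` (sidx n \<times> ?W K))"
  proof (intro equalityI subsetI)
    fix v assume "v \<in> ?W (Suc K)"
    then show "v \<in> insert [] ((\<lambda>(B, v). B # v) ` (sidx n \<times> ?W K))"
      by (cases v) (auto simp: image_iff)
  qed auto
  have "(\<Sum>v\<in>?W (Suc K). ?m v * a v) = a [] + (\<Sum>v\<in>(\<lambda>(B, v). B # v) ` (sidx n \<times> ?W K). ?m v * a v)"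
    unfolding W using fin by (subst sum.insert) auto
  also have "(\<Sum>v\<in>(\<lambda>(B, v). B # v) ` (sidx n \<times> ?W K). ?m v * a v)
      = (\<Sum>(B, v)\<in>sidx n \<times> ?W K. gsoul (z B) * (?m v * a (B # v)))"
    by (subst sum.reindex) (auto simp: inj_on_def mult.assoc case_prod_beta intro!: sum.cong)
  also have "\<dots> = (\<Sum>B\<in>sidx n. gsoul (z B) * (\<Sum>v\<in>?W K. ?m v * a (B # v)))"
    by (simp add: sum.cartesian_product[symmetric] sum_distrib_left)
  finally show ?case by (simp add: Suc.IH)
qed simp

lemma soul_words_vanish:
  fixes z :: "'l::linorder spoint"
  shows "\<exists>K0. \<forall>v. set v \<subseteq> sidx n \<and> K0 \<le> length v \<longrightarrow> prod_list (map (\<lambda>B. gsoul (z B)) v) = 0"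
proof -
  obtain N where N: "finite N" "\<And>B. B \<in> sidx n \<Longrightarrow> gdeg N 0 (gsoul (z B))"
    by (rule finite_generators[of "(\<lambda>B. gsoul (z B)) ` sidx n"]) auto
  have "gdeg N (length v) (prod_list (map (\<lambda>B. gsoul (z B)) v))" if "set v \<subseteq> sidx n" for v
    using that
  proof (induction v)
    case (Cons B v)
    then show ?case using gdeg_mult[OF gdeg_body_zero[OF N(2)[of B]]] by fastforce
  qed (simp add: gdeg_one)
  then show ?thesis using gdeg_eq_zero[OF _ N(1)] by (intro exI[of _ "Suc (card N)"]) force
qed

text \<open>The Taylor sum runs over sequences of indices, that is, over words in the even letters,
  so the coefficients can be read off; words containing an odd letter get 0. Words longer than the
  order of nilpotency of the souls vanish, which turns the sum into a truncation.\<close>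

lemma pseries_taylor:
  "pseries n x (taylor n c) (\<lambda>v. if \<exists>js. v = map Inl js
     then (1 / fact (length v)) *\<^sub>R gpartials (map projl v) c x else 0)"
  (is "pseries n x _ ?a")
  unfolding pseries_def
proof
  fix z :: "'a spoint" assume z: "z \<in> fiber n x"
  obtain K0 where K0: "\<And>v. set v \<subseteq> sidx n \<Longrightarrow> K0 \<le> length v \<Longrightarrow> prod_list (map (\<lambda>B. gsoul (z B)) v) = 0"
    using soul_words_vanish[of n z] by blast
  let ?t = "\<lambda>js. (1 / fact (length js)) *\<^sub>R (soul_monomial z js * gpartials js c (pbody z))"
  have m: "prod_list (map (\<lambda>B. gsoul (z B)) (map Inl js)) = soul_monomial z js" for js
    by (simp add: soul_monomial_def comp_def)
  have "taylor n c z = psum n K ?a z" if "K0 \<le> K" for K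
  proof -
    let ?W = "{v. set v \<subseteq> sidx n \<and> length v < K}"
    have fin: "finite ?W"
      using finite_lists_length_le[OF finite_sidx, of n K] by (rule rev_finite_subset) auto
    have fin': "finite {js. set js \<subseteq> {..<n} \<and> length js < K}"
      using finite_lists_length_le[OF finite_lessThan[of n], of K] by (rule rev_finite_subset) auto
    have short: "length js < K" if "set js \<subseteq> {..<n}" "soul_monomial z js \<noteq> 0" for js
    proof (rule ccontr)
      assume "\<not> length js < K"
      then have "soul_monomial z js = 0"
        unfolding m[symmetric] using that(1) \<open>K0 \<le> K\<close> by (intro K0) auto
      then show False using that(2) by simp
    qed
    have "taylor n c z = (\<Sum>js | set js \<subseteq> {..<n} \<and> length js < K. ?t js)"
      unfolding taylor_def using fin' short by (intro sum.mono_neutral_left) auto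
    also have "\<dots> = (\<Sum>v\<in>map Inl ` {js. set js \<subseteq> {..<n} \<and> length js < K}.
        prod_list (map (\<lambda>B. gsoul (z B)) v) * ?a v)"
    proof (subst sum.reindex, simp add: inj_on_def inj_map_eq_map, rule sum.cong[OF refl])
      fix js
      have p: "map projl (map Inl js) = js" for js :: "nat list" by (simp add: comp_def)
      show "?t js = ((\<lambda>v. prod_list (map (\<lambda>B. gsoul (z B)) v) * ?a v) \<circ> map Inl) js"
        using z by (auto simp: m p fiber_def simp del: map_map)
    qed
    also have "\<dots> = (\<Sum>v\<in>?W. prod_list (map (\<lambda>B. gsoul (z B)) v) * ?a v)"
    proof (intro sum.mono_neutral_left fin subsetI ballI)
      fix v assume v: "v \<in> ?W - map Inl ` {js. set js \<subseteq> {..<n} \<and> length js < K}"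
      have "\<nexists>js. v = map Inl js"
      proof
        assume "\<exists>js. v = map Inl js"
        then obtain js where js: "v = map Inl js" by blast
        then have "set js \<subseteq> {..<n}" "length js < K" using v by auto
        then show False using v js by blast
      qed
      then show "prod_list (map (\<lambda>B. gsoul (z B)) v) * ?a v = 0" by simp
    qed (auto simp: subset_iff)
    finally show ?thesis by (simp only: psum_words)
  qed
  then show "\<exists>K0. \<forall>K\<ge>K0. taylor n c z = psum n K ?a z" by blast
qed

lemma superfunction_pseries:
  assumes "superfunction n U f" "x \<in> U"
  shows "\<exists>a. pseries n x f a"
proof -
  obtain c where c: "\<And>z. z \<in> superdomain n U \<Longrightarrow> f z
      = (\<Sum>I\<in>Pow {..<n}. odd_monomial z I * taylor n (c I) z)"
    using assms(1) unfolding superfunction_def by blast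
  have "\<exists>a. pseries n x (\<lambda>z. \<Sum>I\<in>Pow {..<n}. odd_monomial z I * taylor n (c I) z) a"
    by (intro pseries_sum pseries_odd_monomial[OF pseries_taylor]) auto
  then show ?thesis
    using c fiber_superdomain[OF _ assms(2)] pseries_cong by (metis (no_types, lifting))
qed

lemma superfunction_sdiff:
  fixes f :: "'l::{linorder, infinite} spoint \<Rightarrow> 'l grassmann"
  assumes "superfunction n U f" "x \<in> U"
  shows "sdiff n x k f"
  using superfunction_pseries[OF assms] pseries_sdiff by blast

text \<open>The body of a power series in the souls is that of its constant coefficient. For this
  reason coordinate changes map all points over one body to points over one body.\<close>

lemma superfunction_gbody:
  assumes "superfunction n U f" "x \<in> U" "z \<in> fiber n x" "z' \<in> fiber n x"
  shows "gbody (f z) = gbody (f z')"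
  using superfunction_pseries[OF assms(1,2)] pseries_gbody assms(3,4) by metis

section \<open>Matrices over a Grassmann algebra\<close>

lemma square_mat_inverse_unique:
  fixes A :: "'a::ring_1 mat"
  assumes "A \<in> carrier_mat n n" "B \<in> carrier_mat n n" "C \<in> carrier_mat n n"
    and "B * A = 1\<^sub>m n" "A * C = 1\<^sub>m n"
  shows "B = C"
proof -
  have "B = B * (A * C)" using assms by simp
  also have "\<dots> = (B * A) * C" using assms(1-3) by (simp only: assoc_mult_mat)
  finally show ?thesis using assms by simp
qed

lemma mat_inv_eqI:
  fixes A :: "'a::ring_1 mat"
  assumes "A \<in> carrier_mat n n" "B \<in> carrier_mat n n" "A * B = 1\<^sub>m n" "B * A = 1\<^sub>m n"
  shows "mat_inv n A = B"
  unfolding mat_inv_def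
  by (rule the_equality) (use assms square_mat_inverse_unique in blast)+

lemma ring_inv_eqI:
  fixes a :: "'a::comm_ring_1"
  assumes "a * b = 1"
  shows "ring_inv a = b"
  unfolding ring_inv_def
proof (rule the_equality)
  show "a * b = 1 \<and> b * a = 1" using assms by (simp add: mult.commute)
  show "c = b" if "a * c = 1 \<and> c * a = 1" for c
  proof -
    have "c = c * (a * b)" using assms by simp
    also have "\<dots> = (c * a) * b" by (simp only: mult.assoc)
    finally show ?thesis using that by simp
  qed
qed

text \<open>Doubling: if \<open>1 - \<nu>\<^sup>2\<close> is invertible, then so is \<open>1 - \<nu>\<close>.\<close>

lemma gdeg_mat_inverse:
  fixes \<nu> :: "'l::linorder grassmann mat"
  assumes "finite N" "\<nu> \<in> carrier_mat n n" "\<And>i j. i < n \<Longrightarrow> j < n \<Longrightarrow> gdeg N k (\<nu> $$ (i, j))" "0 < k"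
  shows "\<exists>b\<in>carrier_mat n n. (1\<^sub>m n - \<nu>) * b = 1\<^sub>m n \<and> b * (1\<^sub>m n - \<nu>) = 1\<^sub>m n"
  using assms(2-4)
proof (induction "card N + 1 - k" arbitrary: k \<nu> rule: less_induct)
  case less
  note \<nu> = less.prems(1)
  show ?case
  proof (cases "card N < k")
    case True
    then have "\<nu> = 0\<^sub>m n n"
      using gdeg_eq_zero[OF less.prems(2) assms(1)] \<nu> by (intro eq_matI) auto
    then have "1\<^sub>m n - \<nu> = 1\<^sub>m n" by (intro eq_matI) auto
    then show ?thesis by (intro bexI[of _ "1\<^sub>m n"]) auto
  next
    case False
    have "gdeg N (k + k) ((\<nu> * \<nu>) $$ (i, j))" if "i < n" "j < n" for i j
    proof -
      have "(\<nu> * \<nu>) $$ (i, j) = (\<Sum>l = 0..<n. \<nu> $$ (i, l) * \<nu> $$ (l, j))"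
        using that \<nu> by (simp add: scalar_prod_def)
      then show ?thesis using that less.prems(2) by (auto intro!: gdeg_sum gdeg_mult)
    qed
    then have "\<exists>b\<in>carrier_mat n n. (1\<^sub>m n - \<nu> * \<nu>) * b = 1\<^sub>m n \<and> b * (1\<^sub>m n - \<nu> * \<nu>) = 1\<^sub>m n"
      using less.hyps[of "k + k" "\<nu> * \<nu>"] less.prems(3) \<nu> False by simp
    then obtain b where b: "b \<in> carrier_mat n n" "(1\<^sub>m n - \<nu> * \<nu>) * b = 1\<^sub>m n"
      "b * (1\<^sub>m n - \<nu> * \<nu>) = 1\<^sub>m n" by blast
    let ?p = "1\<^sub>m n + \<nu>" and ?m = "1\<^sub>m n - \<nu>"
    have c: "?p \<in> carrier_mat n n" "?m \<in> carrier_mat n n" using \<nu> by auto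
    have "?m * ?p = 1\<^sub>m n * ?p - \<nu> * ?p"
      using \<nu> by (intro minus_mult_distrib_mat) auto
    also have "\<nu> * ?p = \<nu> * 1\<^sub>m n + \<nu> * \<nu>"
      using \<nu> by (intro mult_add_distrib_mat) auto
    also have "1\<^sub>m n * ?p - \<dots> = 1\<^sub>m n - \<nu> * \<nu>"
      using \<nu> by (intro eq_matI) (auto simp del: index_mult_mat(1))
    finally have f1: "?m * ?p = 1\<^sub>m n - \<nu> * \<nu>" .
    have "?p * ?m = 1\<^sub>m n * ?m + \<nu> * ?m"
      using \<nu> by (intro add_mult_distrib_mat) auto
    also have "\<nu> * ?m = \<nu> * 1\<^sub>m n - \<nu> * \<nu>"
      using \<nu> by (intro mult_minus_distrib_mat) auto
    also have "1\<^sub>m n * ?m + \<dots> = 1\<^sub>m n - \<nu> * \<nu>"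
      using \<nu> by (intro eq_matI) (auto simp del: index_mult_mat(1))
    finally have f2: "?p * ?m = 1\<^sub>m n - \<nu> * \<nu>" .
    have r: "?m * (?p * b) = 1\<^sub>m n"
      using b(2) assoc_mult_mat[OF c(2,1) b(1)] by (simp only: f1)
    have l: "(b * ?p) * ?m = 1\<^sub>m n"
      using b(3) assoc_mult_mat[OF b(1) c] by (simp only: f2)
    have pb: "?p * b \<in> carrier_mat n n" "b * ?p \<in> carrier_mat n n"
      using c b(1) by (blast intro: mult_carrier_mat)+
    have "b * ?p = ?p * b"
      by (rule square_mat_inverse_unique[OF c(2) pb(2,1) l r])
    then show ?thesis using l r pb by metis
  qed
qed

lemma map_mat_gbody_mult:
  fixes A B :: "'l::linorder grassmann mat"
  assumes "A \<in> carrier_mat n k" "B \<in> carrier_mat k m"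
  shows "map_mat gbody (A * B) = map_mat gbody A * map_mat gbody B"
  using assms by (intro eq_matI) (auto simp: scalar_prod_def gbody_sum)

lemma mat_inverse_of_body:
  fixes A :: "'l::linorder grassmann mat"
  assumes A: "A \<in> carrier_mat n n" and d: "det (map_mat gbody A) \<noteq> 0"
  shows "\<exists>B\<in>carrier_mat n n. A * B = 1\<^sub>m n \<and> B * A = 1\<^sub>m n"
proof -
  have "map_mat gbody A \<in> Units (ring_mat TYPE(real) n ())"
    using A d by (intro det_non_zero_imp_unit) auto
  then obtain R where R: "R \<in> carrier_mat n n" "map_mat gbody A * R = 1\<^sub>m n" "R * map_mat gbody A
      = 1\<^sub>m n"
    unfolding Units_def ring_mat_def by auto
  define S :: "'l grassmann mat" where "S = map_mat of_real R"
  have S: "S \<in> carrier_mat n n" "map_mat gbody S = R" using R(1) by (auto simp: S_def intro!: eq_matI)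
  have unipotent: "\<exists>b\<in>carrier_mat n n. X * b = 1\<^sub>m n \<and> b * X = 1\<^sub>m n"
    if X: "X \<in> carrier_mat n n" "map_mat gbody X = 1\<^sub>m n" for X :: "'l grassmann mat"
  proof -
    define \<nu> where "\<nu> = 1\<^sub>m n - X"
    have \<nu>: "\<nu> \<in> carrier_mat n n" "X = 1\<^sub>m n - \<nu>" using X by (auto simp: \<nu>_def intro!: eq_matI)
    obtain N where N: "finite N" "\<And>i j. i < n \<Longrightarrow> j < n \<Longrightarrow> gdeg N 0 (\<nu> $$ (i, j))"
      by (rule finite_generators[of "(\<lambda>p. \<nu> $$ p) ` ({..<n} \<times> {..<n})"]) auto
    have "gbody (\<nu> $$ (i, j)) = 0" if "i < n" "j < n" for i j
    proof -
      have "gbody (X $$ (i, j)) = map_mat gbody X $$ (i, j)" using X(1) that by simp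
      then show ?thesis using X that by (auto simp: \<nu>_def)
    qed
    then have "gdeg N 1 (\<nu> $$ (i, j))" if "i < n" "j < n" for i j
      using N(2) that by (intro gdeg_body_zero) auto
    then show ?thesis using gdeg_mat_inverse[OF N(1) \<nu>(1), of 1] \<nu>(2) by auto
  qed
  obtain B1 where B1: "B1 \<in> carrier_mat n n" "A * S * B1 = 1\<^sub>m n"
    using unipotent[of "A * S"] A S R map_mat_gbody_mult[OF A S(1)] by (auto simp del: assoc_mult_mat)
  obtain B2 where B2: "B2 \<in> carrier_mat n n" "B2 * (S * A) = 1\<^sub>m n"
    using unipotent[of "S * A"] A S R map_mat_gbody_mult[OF S(1) A] by auto
  have r: "A * (S * B1) = 1\<^sub>m n" using B1 A S by (simp only: assoc_mult_mat)
  have l: "(B2 * S) * A = 1\<^sub>m n" using B2 A S by (simp only: assoc_mult_mat)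
  have c: "S * B1 \<in> carrier_mat n n" "B2 * S \<in> carrier_mat n n"
    using S B1(1) B2(1) by (blast intro: mult_carrier_mat)+
  have "B2 * S = S * B1" by (rule square_mat_inverse_unique[OF A c(2,1) l r])
  then show ?thesis using l r c by metis
qed

subsection \<open>Determinants of even matrices\<close>

definition even_mat :: "nat \<Rightarrow> 'l::linorder grassmann mat \<Rightarrow> bool" where
  "even_mat n A \<longleftrightarrow> A \<in> carrier_mat n n \<and> (\<forall>i<n. \<forall>j<n. geven (A $$ (i, j)))"

definition odd_mat :: "nat \<Rightarrow> 'l::linorder grassmann mat \<Rightarrow> bool" where
  "odd_mat n A \<longleftrightarrow> A \<in> carrier_mat n n \<and> (\<forall>i<n. \<forall>j<n. godd (A $$ (i, j)))"

lemma even_mat_carrier: "even_mat n A \<Longrightarrow> A \<in> carrier_mat n n"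
  by (simp add: even_mat_def)

lemma parity_mat_mult:
  "even_mat n A \<Longrightarrow> even_mat n B \<Longrightarrow> even_mat n (A * B)"
  "odd_mat n A \<Longrightarrow> odd_mat n B \<Longrightarrow> even_mat n (A * B)"
  "even_mat n A \<Longrightarrow> odd_mat n B \<Longrightarrow> odd_mat n (A * B)"
  by (auto simp: even_mat_def odd_mat_def geven_iff godd_iff scalar_prod_def sum_negf
      intro!: sum.cong)

lemma even_mat_add: "even_mat n A \<Longrightarrow> even_mat n B \<Longrightarrow> even_mat n (A + B)"
  by (auto simp: even_mat_def intro!: geven_add)

lemma even_mat_minus: "even_mat n A \<Longrightarrow> even_mat n B \<Longrightarrow> even_mat n (A - B)"
  by (auto simp: even_mat_def intro!: geven_minus minus_carrier_mat)

lemma even_mat_one: "even_mat n (1\<^sub>m n)"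
  by (auto simp: even_mat_def geven_zero geven_one)

text \<open>Applying \<open>ginvol\<close> to \<open>E * D = 1\<close> shows that its image of
  \<open>E\<close> is again a left inverse of the even matrix \<open>D\<close>, hence equal to
  \<open>E\<close>.\<close>

lemma even_mat_inverse:
  assumes D: "even_mat n D" and E: "E \<in> carrier_mat n n" "D * E = 1\<^sub>m n" "E * D = 1\<^sub>m n"
  shows "even_mat n E"
proof -
  have Dc: "D \<in> carrier_mat n n" using D by (rule even_mat_carrier)
  have "map_mat ginvol E * D = 1\<^sub>m n"
  proof (rule eq_matI)
    fix i j assume ij: "i < dim_row (1\<^sub>m n)" "j < dim_col (1\<^sub>m n)"
    have "(map_mat ginvol E * D) $$ (i, j) = (\<Sum>l = 0..<n. ginvol (E $$ (i, l)) * D $$ (l, j))"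
      using ij E(1) Dc by (simp add: scalar_prod_def)
    also have "\<dots> = (\<Sum>l = 0..<n. ginvol (E $$ (i, l) * D $$ (l, j)))"
      using ij D by (intro sum.cong) (auto simp: even_mat_def geven_iff)
    also have "\<dots> = ginvol ((E * D) $$ (i, j))"
      using ij E(1) Dc by (simp add: scalar_prod_def)
    finally show "(map_mat ginvol E * D) $$ (i, j) = 1\<^sub>m n $$ (i, j)" using ij E(3) by simp
  qed (use E Dc in auto)
  then have "map_mat ginvol E = E"
    using square_mat_inverse_unique[OF Dc, of "map_mat ginvol E" E] E by simp
  moreover have "ginvol (E $$ (i, j)) = map_mat ginvol E $$ (i, j)" if "i < n" "j < n" for i j
    using E(1) that by simp
  ultimately show ?thesis using E(1) by (auto simp: even_mat_def geven_iff)
qed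

lemma to_geven_simps:
  "geven a \<Longrightarrow> of_geven (to_geven a) = a" "to_geven 0 = 0" "to_geven 1 = 1"
  "geven a \<Longrightarrow> geven b \<Longrightarrow> to_geven (a + b) = to_geven a + to_geven b"
  "geven a \<Longrightarrow> geven b \<Longrightarrow> to_geven (a * b) = to_geven a * to_geven b"
  by (simp_all add: to_geven_inverse of_geven_inject[symmetric] zero_geven_ring.rep_eq geven_zero
      one_geven_ring.rep_eq geven_one plus_geven_ring.rep_eq times_geven_ring.rep_eq geven_add
          geven_mult)

lemma geven_of_geven [simp]: "geven (of_geven r)"
  using of_geven by blast

lemma to_geven_sum:
  assumes "\<And>i. i \<in> I \<Longrightarrow> geven (f i)"
  shows "geven (sum f I) \<and> to_geven (sum f I) = (\<Sum>i\<in>I. to_geven (f i))"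
  using assms by (induction I rule: infinite_finite_induct) (auto simp: to_geven_simps geven_zero
      intro: geven_add)

lemma even_det_mult:
  assumes A: "even_mat n A" and B: "even_mat n B"
  shows "even_det (A * B) = even_det A * even_det B"
proof -
  have "map_mat to_geven (A * B) = map_mat to_geven A * map_mat to_geven B"
  proof (rule eq_matI)
    fix i j assume "i < dim_row (map_mat to_geven A * map_mat to_geven B)"
      "j < dim_col (map_mat to_geven A * map_mat to_geven B)"
    then have ij: "i < n" "j < n" using A B by (auto simp: even_mat_def)
    have "to_geven ((A * B) $$ (i, j)) = to_geven (\<Sum>l = 0..<n. A $$ (i, l) * B $$ (l, j))"
      using ij even_mat_carrier[OF A] even_mat_carrier[OF B] by (simp add: scalar_prod_def)
    also have "\<dots> = (\<Sum>l = 0..<n. to_geven (A $$ (i, l)) * to_geven (B $$ (l, j)))"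
      using ij A B by (subst conjunct2[OF to_geven_sum])
        (auto simp: even_mat_def to_geven_simps intro!: geven_mult)
    finally show "map_mat to_geven (A * B) $$ (i, j)
        = (map_mat to_geven A * map_mat to_geven B) $$ (i, j)"
      using ij even_mat_carrier[OF A] even_mat_carrier[OF B] by (simp add: scalar_prod_def)
  qed (use A B in \<open>auto simp: even_mat_def\<close>)
  then show ?thesis
    using A B by (simp add: even_det_def det_mult[where n = n] even_mat_def)
qed

lemma even_det_one: "even_det (1\<^sub>m n :: 'l::linorder grassmann mat) = 1"
proof -
  have "map_mat to_geven (1\<^sub>m n :: 'l grassmann mat) = 1\<^sub>m n" by
      (intro eq_matI) (auto simp: to_geven_simps)
  then show ?thesis by (simp add: even_det_def)
qed

definition rbody :: "'l::linorder geven_ring \<Rightarrow> real" where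
  "rbody r = gbody (of_geven r)"

lemma rbody_simps [simp]:
  "rbody 0 = 0" "rbody 1 = 1" "rbody (r + q) = rbody r + rbody q"
  "rbody (r - q) = rbody r - rbody q" "rbody (- r) = - rbody r" "rbody (r * q) = rbody r * rbody q"
  by (simp_all add: rbody_def zero_geven_ring.rep_eq one_geven_ring.rep_eq plus_geven_ring.rep_eq
      minus_geven_ring.rep_eq uminus_geven_ring.rep_eq times_geven_ring.rep_eq)

lemma rbody_even_det:
  assumes "even_mat n A"
  shows "rbody (even_det A) = det (map_mat gbody A)"
proof -
  interpret comm_ring_hom "rbody :: 'a geven_ring \<Rightarrow> real" by unfold_locales auto
  have "map_mat rbody (map_mat to_geven A) = map_mat gbody A"
    using assms by (intro eq_matI) (auto simp: even_mat_def rbody_def to_geven_simps)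
  then show ?thesis unfolding even_det_def hom_det[symmetric] by simp
qed

text \<open>A permutation other than the identity moves some \<open>i\<close>, hence also
  \<open>p i\<close>, and thus contributes two off-diagonal entries of \<kappa>, whose product is
  zero. The identity contributes 1.\<close>

lemma det_one_plus:
  fixes \<kappa> :: "'a::comm_ring_1 mat"
  assumes \<kappa>: "\<kappa> \<in> carrier_mat n n" and diag: "\<And>i. i < n \<Longrightarrow> \<kappa> $$ (i, i) = 0"
    and null: "\<And>i j k l. i < n \<Longrightarrow> j < n \<Longrightarrow> k < n \<Longrightarrow> l < n \<Longrightarrow> \<kappa> $$ (i, j) * \<kappa> $$ (k, l) = 0"
  shows "det (1\<^sub>m n + \<kappa>) = 1"
proof -
  let ?A = "1\<^sub>m n + \<kappa>"
  have A: "?A \<in> carrier_mat n n" using \<kappa> by simp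
  have van: "(\<Prod>i = 0..<n. ?A $$ (i, p i)) = 0" if p: "p permutes {0..<n}" "p \<noteq> id" for p
  proof -
    obtain i where i: "p i \<noteq> i" using p(2) by (auto simp: fun_eq_iff)
    then have "i \<in> {0..<n}" using p(1) by (auto simp: permutes_def)
    moreover from this have "p i \<in> {0..<n}" "p (p i) \<in> {0..<n}" using p(1)
        by (simp_all add: permutes_in_image)
    ultimately have lt: "i < n" "p i < n" "p (p i) < n" by auto
    have pi: "p (p i) \<noteq> p i" using i p(1) by (metis permutes_inj injD)
    have "(\<Prod>i = 0..<n. ?A $$ (i, p i))
        = ?A $$ (i, p i) * (?A $$ (p i, p (p i)) * (\<Prod>j\<in>{0..<n} - {i} - {p i}. ?A $$ (j, p j)))"
      using lt i by (subst prod.remove[of _ i], simp, simp, subst prod.remove[of _ "p i"]) auto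
    also have "\<dots> = (\<kappa> $$ (i, p i) * \<kappa> $$ (p i, p (p i))) * (\<Prod>j\<in>{0..<n} - {i} - {p i}. ?A $$ (j, p j))"
      using lt i pi \<kappa> by (auto simp: mult.assoc)
    finally show ?thesis using null lt by simp
  qed
  have "det ?A = (\<Sum>p | p permutes {0..<n}. signof p * (\<Prod>i = 0..<n. ?A $$ (i, p i)))"
    using det_def'[OF A] .
  also have "\<dots> = (\<Sum>p\<in>{id}. signof p * (\<Prod>i = 0..<n. ?A $$ (i, p i)))"
    using van by (intro sum.mono_neutral_right) (auto simp: finite_permutations permutes_id)
  also have "\<dots> = (\<Prod>i = 0..<n. ?A $$ (i, i))" by simp
  also have "\<dots> = 1" using \<kappa> diag by (intro prod.neutral) auto
  finally show ?thesis .
qed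

section \<open>Splitting off the index 0: the normal and the tangential block\<close>

definition bdiag :: "'a::zero \<Rightarrow> 'a mat \<Rightarrow> 'a mat" where
  "bdiag a A = four_block_mat (mat 1 1 (\<lambda>_. a)) (0\<^sub>m 1 (dim_col A)) (0\<^sub>m (dim_row A) 1) A"

lemma bdiag_carrier: "A \<in> carrier_mat n n \<Longrightarrow> bdiag a A \<in> carrier_mat (Suc n) (Suc n)"
  by (auto simp: bdiag_def)

lemma bdiag_index:
  "A \<in> carrier_mat n n \<Longrightarrow> i < Suc n \<Longrightarrow> j < Suc n \<Longrightarrow> bdiag a A $$ (i, j) =
    (case i of 0 \<Rightarrow> (case j of 0 \<Rightarrow> a | Suc l \<Rightarrow> 0) | Suc k \<Rightarrow> (case j of 0 \<Rightarrow> 0 | Suc l \<Rightarrow> A $$ (k, l)))"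
  by (auto simp: bdiag_def split: nat.splits)

lemma bdiag_mult:
  fixes A B :: "'a::ring_1 mat"
  assumes "A \<in> carrier_mat n n" "B \<in> carrier_mat n n"
  shows "bdiag a A * bdiag b B = bdiag (a * b) (A * B)"
proof (rule eq_matI)
  fix i j assume "i < dim_row (bdiag (a * b) (A * B))" "j < dim_col (bdiag (a * b) (A * B))"
  then have ij: "i < Suc n" "j < Suc n" using assms by (auto simp: bdiag_def)
  have c: "A * B \<in> carrier_mat n n" "bdiag a A \<in> carrier_mat (Suc n) (Suc n)" "bdiag b B \<in>
      carrier_mat (Suc n) (Suc n)"
    using assms bdiag_carrier by auto
  have "(bdiag a A * bdiag b B) $$ (i, j) = (\<Sum>l<Suc n. bdiag a A $$ (i, l) * bdiag b B $$ (l, j))"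
    using ij c by (simp add: scalar_prod_def atLeast0LessThan del: sum.lessThan_Suc)
  also have "\<dots> = bdiag a A $$ (i, 0) * bdiag b B $$ (0, j) + (\<Sum>l<n. bdiag a A $$ (i, Suc l) *
      bdiag b B $$ (Suc l, j))"
    by (rule sum.lessThan_Suc_shift)
  also have "\<dots> = bdiag (a * b) (A * B) $$ (i, j)"
    using ij assms by (auto simp: bdiag_index[OF assms(1)] bdiag_index[OF assms(2)] bdiag_index[OF
        c(1)]
        scalar_prod_def atLeast0LessThan split: nat.splits)
  finally show "(bdiag a A * bdiag b B) $$ (i, j) = bdiag (a * b) (A * B) $$ (i, j)" .
qed (use assms in \<open>auto simp: bdiag_def\<close>)

lemma bdiag_minus:
  fixes A B :: "'a::ring_1 mat"
  assumes "A \<in> carrier_mat n n" "B \<in> carrier_mat n n"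
  shows "bdiag a A - bdiag b B = bdiag (a - b) (A - B)"
  using assms by (intro eq_matI) (auto simp: bdiag_def)

lemma bdiag_one: "bdiag 1 (1\<^sub>m n) = 1\<^sub>m (Suc n)"
  by (intro eq_matI) (auto simp: bdiag_def)

lemma even_det_bdiag:
  assumes "A \<in> carrier_mat n n"
  shows "even_det (bdiag a A) = to_geven a * even_det A"
proof -
  let ?h = "map_mat to_geven A"
  have "map_mat to_geven (bdiag a A) = four_block_mat (mat 1 1 (\<lambda>_. to_geven a)) (0\<^sub>m 1 n) (0\<^sub>m n
      1) ?h"
    using assms by (intro eq_matI) (auto simp: bdiag_def to_geven_simps)
  then show ?thesis
    using assms det_four_block_mat_lower_left_zero_col[of "mat 1 1 (\<lambda>_. to_geven a)" "0\<^sub>m 1 n" n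
        "0\<^sub>m n 1" ?h]
    by (simp add: even_det_def det_single)
qed

section \<open>Square roots of even elements\<close>

text \<open>Newton's iteration without inverses: it raises the degree of the error \<open>a - s\<^sup>2\<close>.\<close>

lemma geven_sqrt_aux:
  fixes a s :: "'l::linorder grassmann"
  assumes "finite N" "geven a" "geven s" "gdeg N 1 (1 - s)" "gdeg N k (a - s * s)" "0 < k"
  shows "\<exists>r. geven r \<and> r * r = a \<and> gbody r = gbody s"
  using assms(3-6)
proof (induction "card N + 1 - k" arbitrary: k s rule: less_induct)
  case less
  show ?case
  proof (cases "card N < k")
    case True
    then have "a - s * s = 0" using gdeg_eq_zero less.prems(3) assms(1) by blast
    then show ?thesis using less.prems(1) by auto
  next
    case False
    define e where "e = a - s * s"
    have e: "geven e" "gdeg N k e" "gdeg N 1 e"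
      using less.prems assms(2) gdeg_mono[of N k e 1]
          by (auto simp: e_def intro: geven_minus geven_mult)
    let ?s = "s + (1 / 2) *\<^sub>R e"
    have c: "s * e = e * s" by (rule geven_commute[OF less.prems(1)])
    have two: "(1 / 2) *\<^sub>R x + (1 / 2) *\<^sub>R x = x" for x :: "'l grassmann"
      by (simp add: scaleR_left_distrib[symmetric])
    have ae: "a = e + s * s" by (simp add: e_def)
    \<comment> \<open>The new error is \<open>(1 - s) e - e^2 / 4\<close>. Since
      \<open>1 - s\<close> and \<open>e\<close> have degree at least one, both terms gain a degree;
      this is why dividing by 2 instead of \<open>2 s\<close> suffices.\<close>
    have "a - ?s * ?s = e - ((1 / 2) *\<^sub>R (e * s) + (1 / 2) *\<^sub>R (e * s)) - (1 / 4) *\<^sub>R (e * e)"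
      by (subst ae) (simp add: algebra_simps c)
    also have "\<dots> = (1 - s) * e + (- ((1 / 4) *\<^sub>R (e * e)))"
      unfolding two by (simp add: algebra_simps c)
    finally have "a - ?s * ?s = (1 - s) * e + (- ((1 / 4) *\<^sub>R (e * e)))" .
    moreover have "gdeg N (k + 1) ((1 - s) * e)" "gdeg N (k + 1) (e * e)"
      using gdeg_mult[OF less.prems(2) e(2)] gdeg_mult[OF e(2,3)] by (simp_all add: add.commute)
    ultimately have d: "gdeg N (k + 1) (a - ?s * ?s)"
      by (simp only:) (intro gdeg_add gdeg_uminus gdeg_scaleR)
    have "1 - ?s = (1 - s) + (- ((1 / 2) *\<^sub>R e))" by simp
    then have "gdeg N 1 (1 - ?s)"
      using less.prems(2) e(3) by (simp only:) (intro gdeg_add gdeg_uminus gdeg_scaleR)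
    moreover have "geven ?s" using less.prems(1) e(1) by (simp add: geven_iff)
    ultimately have "\<exists>r. geven r \<and> r * r = a \<and> gbody r = gbody ?s"
      using less.hyps[of "k + 1" ?s] d False by simp
    moreover have "gbody e = 0" using e(3) by (auto simp: gdeg_def gbody_def)
    ultimately show ?thesis by simp
  qed
qed

lemma geven_sqrt:
  fixes a :: "'l::linorder grassmann"
  assumes "geven a" "0 < gbody a" "\<sigma> = 1 \<or> \<sigma> = -1"
  shows "\<exists>r. geven r \<and> r * r = a \<and> sgn (gbody r) = \<sigma>"
proof -
  define b where "b = (1 / gbody a) *\<^sub>R a"
  obtain N where N: "finite N" "gdeg N 0 (b - 1)"
    using finite_generators[of "{b - 1}"] by auto
  have "geven b" using assms(1) by (simp add: b_def geven_iff)
  moreover have "gdeg N 1 (b - 1 * 1)"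
    using assms(2) gdeg_body_zero[OF N(2)] by (simp add: b_def)
  ultimately obtain r where r: "geven r" "r * r = b" "gbody r = 1"
    using geven_sqrt_aux[OF N(1), of b 1 1] geven_one by auto
  define q where "q = (\<sigma> * sqrt (gbody a)) *\<^sub>R r"
  have "q * q = (\<sigma> * \<sigma>) *\<^sub>R (sqrt (gbody a) * sqrt (gbody a)) *\<^sub>R b"
    by (simp add: q_def r(2) mult_ac)
  also have "\<dots> = a" using assms(2,3) by (auto simp: b_def)
  finally have "q * q = a" .
  moreover have "geven q" using r(1) by (simp add: q_def geven_iff)
  moreover have "sgn (gbody q) = \<sigma>" using assms(2,3) r(3) by (auto simp: q_def sgn_mult)
  ultimately show ?thesis by blast
qed

text \<open>Normalising the body of \<open>a\<close> to 1 gives \<open>x = x * \<nu>\<close> with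
  \<nu> of body zero, so \<open>x\<close> lies in every power of the augmentation ideal.\<close>

lemma gbody_nonzero_cancel:
  fixes a :: "'l::linorder grassmann"
  assumes "x * a = 0" "gbody a \<noteq> 0"
  shows "x = 0"
proof -
  define \<nu> where "\<nu> = 1 - (1 / gbody a) *\<^sub>R a"
  obtain N where N: "finite N" "gdeg N 0 \<nu>" "gdeg N 0 x"
    by (rule finite_generators[of "{\<nu>, x}"]) auto
  have \<nu>: "gdeg N 1 \<nu>" using N(2) assms(2) by (intro gdeg_body_zero) (simp_all add: \<nu>_def)
  have x: "x * \<nu> = x" using assms(1) by (simp add: \<nu>_def algebra_simps)
  have "gdeg N k x" for k
  proof (induction k)
    case (Suc k)
    then show ?case using gdeg_mult[OF Suc.IH \<nu>] x by simp
  qed (rule N(3))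
  then show ?thesis using gdeg_eq_zero N(1) by blast
qed

definition sqrt_of :: "'l::linorder geven_ring \<Rightarrow> real \<Rightarrow> 'l geven_ring \<Rightarrow> bool" where
  "sqrt_of q \<sigma> r \<longleftrightarrow> of_geven (r * r) = sgn (rbody q) *\<^sub>R of_geven q \<and> sgn (rbody r) = \<sigma>"

text \<open>Two roots \<open>t\<close>, \<open>r\<close> satisfy \<open>(t - r) (t + r) = 0\<close>.
  As their bodies have the same nonzero sign, the second factor has nonzero body and can be
  cancelled.\<close>

lemma sqrt_of_ex1:
  fixes q :: "'l::linorder geven_ring"
  assumes "rbody q \<noteq> 0" "\<sigma> = 1 \<or> \<sigma> = -1"
  shows "\<exists>!r. sqrt_of q \<sigma> r"
proof -
  let ?a = "sgn (rbody q) *\<^sub>R of_geven q"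
  have "geven ?a" using geven_of_geven[of q] unfolding geven_iff by simp
  moreover have "0 < gbody ?a" using assms(1) by (simp add: rbody_def[symmetric] sgn_if)
  ultimately obtain r where r: "geven r" "r * r = ?a" "sgn (gbody r) = \<sigma>"
    using geven_sqrt assms(2) by blast
  show ?thesis
  proof (rule ex1I)
    show s: "sqrt_of q \<sigma> (to_geven r)"
      using r by (simp add: sqrt_of_def times_geven_ring.rep_eq rbody_def to_geven_simps)
    fix t assume t: "sqrt_of q \<sigma> t"
    let ?r = "of_geven (to_geven r)" and ?t = "of_geven t"
    have sq: "?t * ?t = ?r * ?r" "sgn (gbody ?t) = sgn (gbody ?r)"
      using s t by (simp_all add: sqrt_of_def times_geven_ring.rep_eq rbody_def)
    have "?t * ?r = ?r * ?t" by (rule geven_commute) simp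
    then have "(?t - ?r) * (?t + ?r) = 0" using sq(1) by (simp add: algebra_simps)
    moreover have "sgn (gbody ?t) \<noteq> 0" using t assms(2) by (auto simp: sqrt_of_def rbody_def)
    then have "gbody (?t + ?r) \<noteq> 0"
      using sq(2) by (auto simp: sgn_if split: if_splits)
    ultimately have "?t - ?r = 0" by (rule gbody_nonzero_cancel)
    then show "t = to_geven r" by (simp add: of_geven_inject)
  qed
qed

text \<open>The prescribed sign is multiplied by that of \<open>a\<close>, so the factor extracted
  from the root is \<open>a\<close> itself and not its absolute value.\<close>

lemma sqrt_of_scale:
  fixes q :: "'l::linorder geven_ring"
  assumes a: "rbody a \<noteq> 0" and q: "rbody q \<noteq> 0" "\<sigma> = 1 \<or> \<sigma> = -1"
  shows "(THE r. sqrt_of (a * a * q) (sgn (rbody a) * \<sigma>) r) = a * (THE r. sqrt_of q \<sigma> r)"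
proof (rule the1_equality)
  have sq: "0 < rbody a * rbody a" using a by (simp add: zero_less_mult_iff linorder_neq_iff) linarith
  then have nz: "rbody (a * a * q) \<noteq> 0" using a q(1) by simp
  show "\<exists>!r. sqrt_of (a * a * q) (sgn (rbody a) * \<sigma>) r"
    using q(2) a by (intro sqrt_of_ex1[OF nz]) (auto simp: sgn_if)
  define r where "r = (THE r. sqrt_of q \<sigma> r)"
  have "sqrt_of q \<sigma> r" unfolding r_def by (rule theI'[OF sqrt_of_ex1[OF q]])
  then have r: "of_geven (r * r) = sgn (rbody q) *\<^sub>R of_geven q" "sgn (rbody r) = \<sigma>"
    by (auto simp: sqrt_of_def)
  have "of_geven ((a * r) * (a * r)) = of_geven ((a * a) * (r * r))" by (simp add: mult_ac)
  also have "\<dots> = of_geven (a * a) * of_geven (r * r)" by (simp only: times_geven_ring.rep_eq)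
  also have "\<dots> = sgn (rbody q) *\<^sub>R of_geven (a * a * q)"
    using r(1) by (simp add: times_geven_ring.rep_eq)
  also have "sgn (rbody q) = sgn (rbody (a * a * q))" using a by (simp add: sgn_mult)
  finally show "sqrt_of (a * a * q) (sgn (rbody a) * \<sigma>) (a * (THE r. sqrt_of q \<sigma> r))"
    using r(2) unfolding r_def[symmetric] by (simp add: sqrt_of_def sgn_mult)
qed

section \<open>The Berezinian of a supermatrix\<close>

definition Ber_mat :: "nat \<Rightarrow> 'l::linorder grassmann mat \<Rightarrow> 'l grassmann mat \<Rightarrow> 'l grassmann mat
    \<Rightarrow> 'l grassmann mat \<Rightarrow> 'l geven_ring" where
  "Ber_mat n A B C D = even_det (A - B * mat_inv n D * C) * ring_inv (even_det D)"

text \<open>Matrices of first order in \<epsilon>. The product of any two of them vanishes.\<close>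

definition eps_mat :: "'l::linorder grassmann \<Rightarrow> nat \<Rightarrow> 'l grassmann mat \<Rightarrow> bool" where
  "eps_mat \<epsilon> n P \<longleftrightarrow> P \<in> carrier_mat n n \<and> (\<forall>i<n. \<forall>j<n. \<exists>x. P $$ (i, j) = \<epsilon> * x)"

lemma eps_null:
  assumes "godd \<epsilon>"
  shows "(\<epsilon> * x) * (\<epsilon> * y) = 0"
  using has_parity_sandwich[of "Inr 0" \<epsilon> x] godd_square[OF assms] assms
  by (simp add: mult.assoc[symmetric])

lemma eps_sum:
  fixes f :: "'i \<Rightarrow> 'l::linorder grassmann"
  assumes "\<And>i. i \<in> I \<Longrightarrow> \<exists>x. f i = \<epsilon> * x"
  shows "\<exists>x. sum f I = \<epsilon> * x"
proof -
  have "\<forall>i\<in>I. \<exists>x. f i = \<epsilon> * x" using assms by blast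
  then obtain g where "\<forall>i\<in>I. f i = \<epsilon> * g i" using bchoice[of I "\<lambda>i x. f i = \<epsilon> * x"] by blast
  then have "sum f I = \<epsilon> * sum g I" by (simp add: sum_distrib_left)
  then show ?thesis by blast
qed

lemma eps_mat_mult:
  assumes "godd \<epsilon>" "eps_mat \<epsilon> n P"
  shows "X \<in> carrier_mat n n \<Longrightarrow> eps_mat \<epsilon> n (P * X)" "X \<in> carrier_mat n n \<Longrightarrow> eps_mat \<epsilon> n (X * P)"
    "eps_mat \<epsilon> n Q \<Longrightarrow> P * Q = 0\<^sub>m n n"
proof -
  have P: "P \<in> carrier_mat n n" "\<And>i j. i < n \<Longrightarrow> j < n \<Longrightarrow> \<exists>x. P $$ (i, j) = \<epsilon> * x"
    using assms(2) by (auto simp: eps_mat_def)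
  have l: "\<exists>y. a * (\<epsilon> * x) = \<epsilon> * y" for a x
  proof -
    have "a * (\<epsilon> * x) = \<epsilon> * (ginvol a * x)"
      using godd_commute[OF assms(1), of "ginvol a"] by (simp add: mult.assoc[symmetric])
    then show ?thesis by blast
  qed
  show "eps_mat \<epsilon> n (P * X)" if X: "X \<in> carrier_mat n n"
  proof -
    have "\<exists>x. (P * X) $$ (i, j) = \<epsilon> * x" if ij: "i < n" "j < n" for i j
    proof -
      have "(P * X) $$ (i, j) = (\<Sum>l = 0..<n. P $$ (i, l) * X $$ (l, j))"
        using ij P(1) X by (simp add: scalar_prod_def)
      moreover have "\<exists>x. P $$ (i, l) * X $$ (l, j) = \<epsilon> * x" if lt: "l \<in> {0..<n}" for l
      proof -
        obtain x where "P $$ (i, l) = \<epsilon> * x" using P(2)[OF ij(1)] lt by auto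
        then show ?thesis by (simp only: mult.assoc) blast
      qed
      ultimately show ?thesis by (simp only:) (rule eps_sum)
    qed
    then show ?thesis using P(1) X by (simp add: eps_mat_def)
  qed
  show "eps_mat \<epsilon> n (X * P)" if X: "X \<in> carrier_mat n n"
  proof -
    have "\<exists>x. (X * P) $$ (i, j) = \<epsilon> * x" if ij: "i < n" "j < n" for i j
    proof -
      have "(X * P) $$ (i, j) = (\<Sum>l = 0..<n. X $$ (i, l) * P $$ (l, j))"
        using ij P(1) X by (simp add: scalar_prod_def)
      moreover have "\<exists>x. X $$ (i, l) * P $$ (l, j) = \<epsilon> * x" if lt: "l \<in> {0..<n}" for l
      proof -
        obtain x where "P $$ (l, j) = \<epsilon> * x" using P(2)[OF _ ij(2)] lt by auto
        then show ?thesis using l by simp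
      qed
      ultimately show ?thesis by (simp only:) (rule eps_sum)
    qed
    then show ?thesis using P(1) X by (simp add: eps_mat_def)
  qed
  show "P * Q = 0\<^sub>m n n" if "eps_mat \<epsilon> n Q"
  proof (rule eq_matI)
    have Q: "Q \<in> carrier_mat n n" "\<And>i j. i < n \<Longrightarrow> j < n \<Longrightarrow> \<exists>x. Q $$ (i, j) = \<epsilon> * x"
      using that by (auto simp: eps_mat_def)
    fix i j assume "i < dim_row (0\<^sub>m n n :: 'a grassmann mat)" "j < dim_col (0\<^sub>m n n :: 'a
        grassmann mat)"
    then have ij: "i < n" "j < n" by auto
    have "P $$ (i, l) * Q $$ (l, j) = 0" if "l < n" for l
      using P(2)[OF ij(1) that] Q(2)[OF that ij(2)] eps_null[OF assms(1)] by auto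
    then show "(P * Q) $$ (i, j) = 0\<^sub>m n n $$ (i, j)"
      using ij P(1) Q(1) by (simp add: scalar_prod_def)
  qed (use P(1) that in \<open>auto simp: eps_mat_def\<close>)
qed

lemma eps_mat_add:
  assumes "eps_mat \<epsilon> n P" "eps_mat \<epsilon> n Q"
  shows "eps_mat \<epsilon> n (P + Q)" "eps_mat \<epsilon> n (P - Q)"
proof -
  have c: "P \<in> carrier_mat n n" "Q \<in> carrier_mat n n" using assms by (auto simp: eps_mat_def)
  have "\<exists>x. (P + Q) $$ (i, j) = \<epsilon> * x" "\<exists>x. (P - Q) $$ (i, j) = \<epsilon> * x" if ij: "i < n" "j < n" for i j
  proof -
    obtain x y where "P $$ (i, j) = \<epsilon> * x" "Q $$ (i, j) = \<epsilon> * y"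
      using assms ij unfolding eps_mat_def by blast
    then have "(P + Q) $$ (i, j) = \<epsilon> * (x + y)" "(P - Q) $$ (i, j) = \<epsilon> * (x - y)"
      using c ij by (simp_all add: algebra_simps)
    then show "\<exists>x. (P + Q) $$ (i, j) = \<epsilon> * x" "\<exists>x. (P - Q) $$ (i, j) = \<epsilon> * x" by blast+
  qed
  then show "eps_mat \<epsilon> n (P + Q)" "eps_mat \<epsilon> n (P - Q)"
    using c by (simp_all add: eps_mat_def minus_carrier_mat)
qed

lemma even_det_one_plus_eps:
  assumes \<epsilon>: "godd \<epsilon>" and \<kappa>: "eps_mat \<epsilon> n \<kappa>" "even_mat n \<kappa>" and diag: "\<And>i. i < n \<Longrightarrow> \<kappa> $$ (i, i) = 0"
  shows "even_det (1\<^sub>m n + \<kappa>) = 1"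
proof -
  have c: "\<kappa> \<in> carrier_mat n n" using \<kappa>(2) by (rule even_mat_carrier)
  have "map_mat to_geven (1\<^sub>m n + \<kappa>) = 1\<^sub>m n + map_mat to_geven \<kappa>"
    using c \<kappa>(2) by (intro eq_matI) (auto simp: to_geven_simps even_mat_def geven_one geven_zero)
  moreover have "det (1\<^sub>m n + map_mat to_geven \<kappa>) = 1"
  proof (rule det_one_plus)
    fix i j k l assume ij: "i < n" "j < n" "k < n" "l < n"
    obtain x y where "\<kappa> $$ (i, j) = \<epsilon> * x" "\<kappa> $$ (k, l) = \<epsilon> * y"
      using \<kappa>(1) ij unfolding eps_mat_def by blast
    then have "\<kappa> $$ (i, j) * \<kappa> $$ (k, l) = 0" using eps_null[OF \<epsilon>] by simp
    then show "map_mat to_geven \<kappa> $$ (i, j) * map_mat to_geven \<kappa> $$ (k, l) = 0"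
      using ij c \<kappa>(2) to_geven_simps(2,5) by (metis carrier_matD even_mat_def index_map_mat(1))
  qed (use c diag in \<open>auto simp: to_geven_simps\<close>)
  ultimately show ?thesis by (simp add: even_det_def)
qed

lemma square_mat_ring:
  fixes X Y Z :: "'a::ring_1 mat"
  assumes "X \<in> carrier_mat n n" "Y \<in> carrier_mat n n" "Z \<in> carrier_mat n n"
  shows "X * (Y + Z) = X * Y + X * Z" "(X + Y) * Z = X * Z + Y * Z"
    "X * (Y - Z) = X * Y - X * Z" "(X - Y) * Z = X * Z - Y * Z" "X * Y * Z = X * (Y * Z)"
  using mult_add_distrib_mat[OF assms] add_mult_distrib_mat[OF assms]
    mult_minus_distrib_mat[OF assms] minus_mult_distrib_mat[OF assms] assoc_mult_mat[OF assms]
  by auto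

lemma square_mat_closed:
  fixes X Y :: "'a::ring_1 mat"
  assumes "X \<in> carrier_mat n n" "Y \<in> carrier_mat n n"
  shows "X + Y \<in> carrier_mat n n" "X - Y \<in> carrier_mat n n" "X * Y \<in> carrier_mat n n"
  using assms by (auto simp: minus_carrier_mat)

text \<open>
  The supermatrix with blocks \<open>A, B, C, D\<close> is multiplied from the right by \<open>1 + \<epsilon>N\<close>, \<open>\<epsilon>\<^sup>2 = 0\<close>.
  In general this changes the Berezinian by the factor \<open>1 + str (\<epsilon>N)\<close>; here all contributions to
  the trace vanish separately.
\<close>

lemma Ber_mat_perturb:
  fixes A B C D E m q u v :: "'l::linorder grassmann mat"
  assumes \<epsilon>: "godd \<epsilon>"
    and A: "even_mat n A" and B: "odd_mat n B" and C: "odd_mat n C" and D: "even_mat n D"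
    and E: "E \<in> carrier_mat n n" "D * E = 1\<^sub>m n" "E * D = 1\<^sub>m n"
    and m: "eps_mat \<epsilon> n m" "even_mat n m" and q: "eps_mat \<epsilon> n q" "even_mat n q"
    and u: "eps_mat \<epsilon> n u" "odd_mat n u" and v: "eps_mat \<epsilon> n v"
    and d1: "\<And>i. i < n \<Longrightarrow> (m - u * (E * C)) $$ (i, i) = 0"
    and d2: "\<And>i. i < n \<Longrightarrow> (q + E * C * u) $$ (i, i) = 0"
  shows "Ber_mat n (A + A * m + B * v) (A * u + B + B * q) (C + C * m + D * v) (C * u + D + D * q)
    = Ber_mat n A B C D"
proof -
  define c where "c = E * C"
  define \<kappa> where "\<kappa> = q + c * u"
  define Z where "Z = A - B * c"
  define \<mu> where "\<mu> = m - u * c"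
  have Ac: "A \<in> carrier_mat n n" and Bc: "B \<in> carrier_mat n n" and Cc: "C \<in> carrier_mat n n"
    and Dc: "D \<in> carrier_mat n n" and mc: "m \<in> carrier_mat n n" and qc: "q \<in> carrier_mat n n"
    and uc: "u \<in> carrier_mat n n" and vc: "v \<in> carrier_mat n n"
    using A B C D m q u v by (auto simp: even_mat_def odd_mat_def eps_mat_def)
  have cc: "c \<in> carrier_mat n n" unfolding c_def using E(1) Cc by simp
  have \<kappa>c: "\<kappa> \<in> carrier_mat n n" unfolding \<kappa>_def using qc cc uc by simp
  have Zc: "Z \<in> carrier_mat n n" unfolding Z_def using Bc cc by (simp add: minus_carrier_mat)
  have \<mu>c: "\<mu> \<in> carrier_mat n n" unfolding \<mu>_def using uc cc by (simp add: minus_carrier_mat)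
  note carr = Ac Bc Cc Dc mc qc uc vc cc \<kappa>c Zc \<mu>c E(1)
  note ring = square_mat_ring[of _ n] square_mat_closed one_carrier_mat carr
  have Dcc: "D * c = C" unfolding c_def using carr E(2) by (simp add: assoc_mult_mat[symmetric])
  note eps = eps_mat_mult[OF \<epsilon>]
  have \<kappa>eps: "eps_mat \<epsilon> n \<kappa>" unfolding \<kappa>_def using q u cc by (intro eps_mat_add eps)
  have codd: "odd_mat n c" unfolding c_def
    by (rule parity_mat_mult(3)[OF even_mat_inverse[OF D E] C])
  have \<kappa>even: "even_mat n \<kappa>" unfolding \<kappa>_def
    using q u codd by (intro even_mat_add parity_mat_mult(2))
  have \<mu>eps: "eps_mat \<epsilon> n \<mu>" unfolding \<mu>_def using m u cc by (intro eps_mat_add eps)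
  have \<mu>even: "even_mat n \<mu>" unfolding \<mu>_def
    using m u codd by (intro even_mat_minus parity_mat_mult(2))
  have Zeven: "even_mat n Z" unfolding Z_def
    using A B codd by (intro even_mat_minus parity_mat_mult(2))
  have inv: "mat_inv n D = E" using carr E by (intro mat_inv_eqI)

  let ?D = "C * u + D + D * q"
  \<comment> \<open>As \<open>C = D c\<close>, the odd contribution \<open>C u\<close> also has
    \<open>D\<close> as a left factor. The new block is \<open>D\<close> times a unipotent matrix,
    with inverse \<open>(1 - \<kappa>) E\<close>.\<close>
  have D': "?D = D * (1\<^sub>m n + \<kappa>)"
  proof -
    have "D * (1\<^sub>m n + \<kappa>) = D * 1\<^sub>m n + D * \<kappa>"
      by (intro ring)
    also have "D * \<kappa> = D * q + D * (c * u)"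
      unfolding \<kappa>_def by (intro ring)
    also have "D * (c * u) = C * u"
      using assoc_mult_mat[OF Dc cc uc] Dcc by simp
    finally show ?thesis
      using carr by (intro eq_matI) (auto simp del: index_mult_mat(1))
  qed
  have \<kappa>\<kappa>: "\<kappa> * \<kappa> = 0\<^sub>m n n" using eps(3)[OF \<kappa>eps \<kappa>eps] .
  have un: "(1\<^sub>m n + \<kappa>) * (1\<^sub>m n - \<kappa>) = 1\<^sub>m n" "(1\<^sub>m n - \<kappa>) * (1\<^sub>m n + \<kappa>) = 1\<^sub>m n"
  proof -
    have "(1\<^sub>m n + \<kappa>) * (1\<^sub>m n - \<kappa>) = 1\<^sub>m n * (1\<^sub>m n - \<kappa>) + \<kappa> * (1\<^sub>m n - \<kappa>)"
      by (intro ring)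
    also have "\<kappa> * (1\<^sub>m n - \<kappa>) = \<kappa> * 1\<^sub>m n - \<kappa> * \<kappa>"
      by (intro ring)
    finally show "(1\<^sub>m n + \<kappa>) * (1\<^sub>m n - \<kappa>) = 1\<^sub>m n"
      unfolding \<kappa>\<kappa> using carr by (auto intro!: eq_matI simp del: index_mult_mat(1))
    have "(1\<^sub>m n - \<kappa>) * (1\<^sub>m n + \<kappa>) = 1\<^sub>m n * (1\<^sub>m n + \<kappa>) - \<kappa> * (1\<^sub>m n + \<kappa>)"
      by (intro ring)
    also have "\<kappa> * (1\<^sub>m n + \<kappa>) = \<kappa> * 1\<^sub>m n + \<kappa> * \<kappa>"
      by (intro ring)
    finally show "(1\<^sub>m n - \<kappa>) * (1\<^sub>m n + \<kappa>) = 1\<^sub>m n"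
      unfolding \<kappa>\<kappa> using carr by (auto intro!: eq_matI simp del: index_mult_mat(1))
  qed
  let ?E = "(1\<^sub>m n - \<kappa>) * E"
  have pc: "1\<^sub>m n + \<kappa> \<in> carrier_mat n n" "1\<^sub>m n - \<kappa> \<in> carrier_mat n n"
    using \<kappa>c by (auto simp: minus_carrier_mat)
  have DE: "?D * ?E = 1\<^sub>m n"
  proof -
    have "?D * ?E = D * ((1\<^sub>m n + \<kappa>) * ((1\<^sub>m n - \<kappa>) * E))"
      unfolding D' by (rule assoc_mult_mat[OF Dc pc(1), of _ n]) (use pc E(1) in auto)
    also have "(1\<^sub>m n + \<kappa>) * ((1\<^sub>m n - \<kappa>) * E) = ((1\<^sub>m n + \<kappa>) * (1\<^sub>m n - \<kappa>)) * E"
      by (rule assoc_mult_mat[OF pc E(1), symmetric])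
    finally show ?thesis using E by (simp add: un)
  qed
  have ED: "?E * ?D = 1\<^sub>m n"
  proof -
    have "?E * ?D = (1\<^sub>m n - \<kappa>) * (E * (D * (1\<^sub>m n + \<kappa>)))"
      unfolding D' by (rule assoc_mult_mat[OF pc(2) E(1), of _ n]) (use pc Dc in auto)
    also have "E * (D * (1\<^sub>m n + \<kappa>)) = (E * D) * (1\<^sub>m n + \<kappa>)"
      by (rule assoc_mult_mat[OF E(1) Dc pc(1), symmetric])
    finally show ?thesis by (simp only: E(3) left_mult_one_mat[OF pc(1)] un)
  qed
  have inv': "mat_inv n ?D = ?E" using carr pc DE ED by (intro mat_inv_eqI) auto

  let ?w = "c * m + v"
  have w: "eps_mat \<epsilon> n ?w" using m v cc by (intro eps_mat_add eps)
  have wc: "?w \<in> carrier_mat n n" using carr by simp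
  have EC: "E * (C + C * m + D * v) = c + ?w"
  proof -
    have "E * (C + C * m + D * v) = E * (C + C * m) + E * (D * v)"
      by (intro ring)
    also have "E * (C + C * m) = E * C + E * (C * m)"
      by (intro ring)
    also have "E * (C * m) = c * m"
      unfolding c_def by (intro square_mat_ring(5)[of _ n, symmetric] carr)
    also have "E * (D * v) = (E * D) * v"
      by (intro square_mat_ring(5)[of _ n, symmetric] carr)
    finally show ?thesis using carr E(3) by (auto simp: c_def[symmetric] intro!: eq_matI simp del:
        index_mult_mat(1))
  qed
  have E'C: "?E * (C + C * m + D * v) = c + (?w - \<kappa> * c)"
  proof -
    have "?E * (C + C * m + D * v) = (1\<^sub>m n - \<kappa>) * (c + ?w)"
      unfolding EC[symmetric] by (intro ring)
    also have "\<dots> = 1\<^sub>m n * (c + ?w) - \<kappa> * (c + ?w)"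
      by (intro ring)
    also have "\<kappa> * (c + ?w) = \<kappa> * c + \<kappa> * ?w"
      by (intro ring)
    also have "\<kappa> * ?w = 0\<^sub>m n n" by (rule eps(3)[OF \<kappa>eps w])
    finally show ?thesis using carr wc by (auto intro!: eq_matI simp del: index_mult_mat(1))
  qed
  let ?\<beta> = "A * u + B * q"
  have \<beta>: "eps_mat \<epsilon> n ?\<beta>" using u q Ac Bc by (intro eps_mat_add eps)
  have \<beta>c: "?\<beta> \<in> carrier_mat n n" using carr by simp
  let ?y = "?w - \<kappa> * c"
  have y: "eps_mat \<epsilon> n ?y" by (rule eps_mat_add(2)[OF w eps(1)[OF \<kappa>eps cc]])
  have yc: "?y \<in> carrier_mat n n" using carr by (simp add: minus_carrier_mat)
  have BEC: "(A * u + B + B * q) * (c + ?y) = B * c + B * ?y + ?\<beta> * c"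
  proof -
    have "A * u + B + B * q = B + ?\<beta>" using carr by (auto intro!: eq_matI simp del: index_mult_mat(1))
    then have "(A * u + B + B * q) * (c + ?y) = B * (c + ?y) + ?\<beta> * (c + ?y)"
      by (simp only:) (intro ring)
    also have "B * (c + ?y) = B * c + B * ?y"
      by (intro ring)
    also have "?\<beta> * (c + ?y) = ?\<beta> * c + ?\<beta> * ?y"
      by (intro ring)
    also have "?\<beta> * ?y = 0\<^sub>m n n" by (rule eps(3)[OF \<beta> y])
    finally show ?thesis using carr \<beta>c yc by (auto intro!: eq_matI simp del: index_mult_mat(1))
  qed
  have By: "B * ?y = B * (c * m) + B * v - (B * (q * c) + B * (c * (u * c)))"
  proof -
    have "\<kappa> * c = q * c + c * u * c" unfolding \<kappa>_def by (intro ring)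
    moreover have "c * u * c = c * (u * c)" by (intro ring)
    moreover have "B * (q * c + c * (u * c)) = B * (q * c) + B * (c * (u * c))"
      by (intro ring)
    ultimately have "B * (\<kappa> * c) = B * (q * c) + B * (c * (u * c))" by (simp only:)
    moreover have "B * ?y = B * ?w - B * (\<kappa> * c)" by (intro ring)
    moreover have "B * ?w = B * (c * m) + B * v" by (intro ring)
    ultimately show ?thesis by (simp only:)
  qed
  have \<beta>c': "?\<beta> * c = A * (u * c) + B * (q * c)"
  proof -
    have "?\<beta> * c = A * u * c + B * q * c" by (intro ring)
    moreover have "A * u * c = A * (u * c)" "B * q * c = B * (q * c)"
      by (intro square_mat_ring[of _ n] carr)+
    ultimately show ?thesis by simp
  qed
  have Z\<mu>: "Z * (1\<^sub>m n + \<mu>) = A - B * c + (A * m - B * (c * m)) - (A * (u * c) - B * (c * (u * c)))"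
  proof -
    have "Z * (1\<^sub>m n + \<mu>) = Z * 1\<^sub>m n + Z * \<mu>" by (intro ring)
    also have "Z * \<mu> = Z * m - Z * (u * c)" unfolding \<mu>_def by (intro ring)
    also have "Z * m = A * m - B * c * m" unfolding Z_def by (intro ring)
    also have "B * c * m = B * (c * m)" by (intro ring)
    also have "Z * (u * c) = A * (u * c) - B * c * (u * c)" unfolding Z_def by (intro ring)
    also have "B * c * (u * c) = B * (c * (u * c))" by (intro ring)
    also have "Z * 1\<^sub>m n = A - B * c" unfolding Z_def[symmetric] by (rule right_mult_one_mat[OF Zc])
    finally show ?thesis using carr by (auto intro!: eq_matI simp del: index_mult_mat(1))
  qed
  \<comment> \<open>The terms \<open>B v\<close> and \<open>B q c\<close> cancel; what remains is
    the old Schur complement \<open>Z\<close> times \<open>1 + m - u c\<close>.\<close>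
  have schur: "A + A * m + B * v - (A * u + B + B * q) * ?E * (C + C * m + D * v) = Z * (1\<^sub>m n + \<mu>)"
  proof -
    have "(A * u + B + B * q) * ?E * (C + C * m + D * v)
        = (A * u + B + B * q) * (?E * (C + C * m + D * v))"
      by (intro ring)
    moreover have "a + am + bv - (bc + (bcm + bv - (bqc + bcuc)) + (auc + bqc))
        = a - bc + (am - bcm) - (auc - bcuc)" for a am bv bc bcm bqc bcuc auc :: "'l grassmann"
      by simp
    ultimately show ?thesis
      unfolding E'C BEC By \<beta>c' Z\<mu> using carr
      by (intro eq_matI) (simp_all del: index_mult_mat(1) assoc_mult_mat)
  qed
  have Z': "A - B * E * C = Z" unfolding Z_def c_def using carr by simp
  have d\<mu>: "even_det (1\<^sub>m n + \<mu>) = 1"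
    using d1 by (intro even_det_one_plus_eps[OF \<epsilon> \<mu>eps \<mu>even]) (simp add: \<mu>_def c_def)
  have d\<kappa>: "even_det (1\<^sub>m n + \<kappa>) = 1"
    using d2 by (intro even_det_one_plus_eps[OF \<epsilon> \<kappa>eps \<kappa>even]) (simp add: \<kappa>_def c_def)
  have "even_det (Z * (1\<^sub>m n + \<mu>)) = even_det Z"
    using even_det_mult[OF Zeven, of "1\<^sub>m n + \<mu>"] d\<mu> even_mat_add[OF even_mat_one \<mu>even] by simp
  moreover have "even_det ?D = even_det D"
    using even_det_mult[OF D, of "1\<^sub>m n + \<kappa>"] d\<kappa> even_mat_add[OF even_mat_one \<kappa>even] by (simp add: D')
  ultimately show ?thesis
    unfolding Ber_mat_def inv' schur inv Z' by simp
qed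

text \<open>The normal block is triangular, with entries \<open>a\<close>, \<open>b\<close>, 0,
  \<open>d\<close>. The zero in its lower left corner removes \<open>b\<close> from the Schur
  complement, and \<open>a / d\<close> equals the square of \<open>a\<close>.\<close>

lemma Ber_mat_bdiag:
  fixes A B C D E :: "'l::linorder grassmann mat"
  assumes A: "A \<in> carrier_mat n n" and B: "B \<in> carrier_mat n n" and C: "C \<in> carrier_mat n n"
    and D: "even_mat n D" and E: "E \<in> carrier_mat n n" "D * E = 1\<^sub>m n" "E * D = 1\<^sub>m n"
    and a: "geven a" "geven d" "a * d = 1"
  shows "Ber_mat (Suc n) (bdiag a A) (bdiag b B) (bdiag 0 C) (bdiag d D)
    = to_geven a * to_geven a * Ber_mat n A B C D"
proof -
  have Dc: "D \<in> carrier_mat n n" using D by (rule even_mat_carrier)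
  have da: "d * a = 1" using geven_commute[OF a(2)] a(3) by metis
  have "mat_inv (Suc n) (bdiag d D) = bdiag a E"
    using Dc E a(3) da by (intro mat_inv_eqI) (auto simp: bdiag_mult bdiag_carrier bdiag_one)
  moreover have "mat_inv n D = E" using Dc E by (intro mat_inv_eqI)
  moreover have "bdiag a A - bdiag b B * bdiag a E * bdiag 0 C = bdiag a (A - B * E * C)"
    using A B C E(1) by (simp add: bdiag_mult[of _ n] bdiag_minus[of _ n])
  moreover have "ring_inv (even_det (bdiag d D)) = to_geven a * even_det E"
  proof (rule ring_inv_eqI)
    have "even_det D * even_det E = 1"
      using even_det_mult[OF D even_mat_inverse[OF D E]] E(2) by (simp add: even_det_one)
    moreover have "to_geven d * to_geven a = 1"
      using to_geven_simps(5)[OF a(2,1)] by (simp add: da to_geven_simps(3))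
    moreover have "even_det (bdiag d D) * (to_geven a * even_det E)
        = (to_geven d * to_geven a) * (even_det D * even_det E)"
      using even_det_bdiag[OF Dc] by (simp add: mult_ac)
    ultimately show "even_det (bdiag d D) * (to_geven a * even_det E) = 1" by simp
  qed
  moreover have "ring_inv (even_det D) = even_det E"
    using even_det_mult[OF D even_mat_inverse[OF D E]] E(2) by
        (intro ring_inv_eqI) (simp add: even_det_one)
  moreover have "even_det (bdiag a (A - B * E * C)) = to_geven a * even_det (A - B * E * C)"
    using B C E(1) by (intro even_det_bdiag[of _ n]) (auto intro!: minus_carrier_mat)
  ultimately show ?thesis by (simp add: Ber_mat_def mult_ac)
qed

section \<open>The odd Poisson bivector\<close>

lemma homogeneous_commute:
  assumes "ginvol a = r *\<^sub>R a" "ginvol b = t *\<^sub>R b" "r = 1 \<or> r = -1" "t = 1 \<or> t = -1"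
  shows "a * b = (if r = -1 \<and> t = -1 then -1 else 1) *\<^sub>R (b * a)"
proof -
  consider "geven a" "r = 1" | "geven b" "t = 1" | "godd a" "godd b" "r = -1" "t = -1"
    using assms by (auto simp: geven_iff godd_iff)
  then show ?thesis
  proof cases
    case 1
    then show ?thesis using geven_commute[OF 1(1), of b] by simp
  next
    case 2
    then show ?thesis using geven_commute[OF 2(1), of a] by simp
  next
    case 3
    then show ?thesis using godd_commute[OF 3(1), of b] by (simp add: godd_iff)
  qed
qed

definition unit_vec :: "sindex \<Rightarrow> 'l::linorder grassmann \<Rightarrow> 'l spoint" where
  "unit_vec A h = (\<lambda>B. if B = A then h else 0)"

lemma unit_vec_svec: "A \<in> sidx n \<Longrightarrow> has_parity A h \<Longrightarrow> unit_vec A h \<in> svec n"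
  by (auto simp: unit_vec_def svec_def)

lemma form_at_unit_vec:
  assumes "A \<in> sidx n" "B \<in> sidx n"
  shows "form_at n \<Omega> z (unit_vec A h) (unit_vec B k) = h * \<Omega> A B z * k"
proof -
  have "unit_vec A h C * \<Omega> C E z * unit_vec B k E = (if C = A then (if E
      = B then h * \<Omega> A B z * k else 0) else 0)"
    for C E by (simp add: unit_vec_def)
  then have "form_at n \<Omega> z (unit_vec A h) (unit_vec B k)
      = (\<Sum>C\<in>sidx n. \<Sum>E\<in>sidx n. if C = A then (if E = B then h * \<Omega> A B z * k else 0) else 0)"
    by (simp add: form_at_def)
  also have "\<dots> = (\<Sum>C\<in>sidx n. if C = A then (\<Sum>E\<in>sidx n. if E = B then h * \<Omega> A B z * k else 0) else 0)"
    by (intro sum.cong) auto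
  finally show ?thesis using assms by simp
qed

lemma parity_cancel_right:
  fixes g g' :: "'l::{linorder, infinite} grassmann"
  assumes "\<And>h. has_parity A h \<Longrightarrow> h * h = 0 \<Longrightarrow> g * h = g' * h"
  shows "g = g'"
proof -
  have "pinvol A g = pinvol A g'"
    by (rule parity_cancel[of A]) (metis assms has_parity_right)
  then show ?thesis by (metis pinvol_simps(10))
qed

text \<open>The form is given by its values on even vectors. Unit vectors with coefficients
  \<open>h\<close>, \<open>k\<close> of the appropriate parity isolate one component, and cancelling
  \<open>h\<close> and \<open>k\<close> yields its parity and its symmetry: antisymmetric unless
  both indices are odd.\<close>

lemma odd_two_form_symmetry:
  fixes \<Omega> :: "'l::{linorder, infinite} two_form"
  assumes \<Omega>: "odd_two_form n U \<Omega>" and z: "z \<in> superdomain n U" and A: "A \<in> sidx n" and B: "B \<in> sidx n"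
  shows odd_two_form_invol: "ginvol (\<Omega> A B z) = - (psign A * psign B) *\<^sub>R \<Omega> A B z"
    and odd_two_form_swap: "\<Omega> B A z = - csign A B *\<^sub>R \<Omega> A B z"
proof -
  have val: "godd (h * \<Omega> A B z * k) \<and> k * \<Omega> B A z * h = - (h * \<Omega> A B z * k)"
    if "has_parity A h" "has_parity B k" "A \<in> sidx n" "B \<in> sidx n" for h k A B
  proof -
    have "unit_vec A h \<in> svec n" "unit_vec B k \<in> svec n" using that by (simp_all add: unit_vec_svec)
    then have "godd (form_at n \<Omega> z (unit_vec A h) (unit_vec B k)) \<and>
        form_at n \<Omega> z (unit_vec B k) (unit_vec A h) = - form_at n \<Omega> z (unit_vec A h) (unit_vec B k)"
      using \<Omega> z unfolding odd_two_form_def by blast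
    then show ?thesis unfolding form_at_unit_vec[OF that(3,4)] form_at_unit_vec[OF that(4,3)] .
  qed
  have inv: "ginvol (\<Omega> A B z) = - (psign A * psign B) *\<^sub>R \<Omega> A B z" if "A \<in> sidx n" "B \<in> sidx n"
      for A B
  proof (rule parity_cancel[of A], rule parity_cancel_right[of B])
    fix h k :: "'l grassmann" assume h: "has_parity A h" and k: "has_parity B k"
    have "ginvol h * ginvol (\<Omega> A B z) * ginvol k = - (h * \<Omega> A B z * k)"
      using val[OF h k that] by (simp add: godd_iff)
    then have "(psign A * psign B) *\<^sub>R ((psign A * psign B) *\<^sub>R (h * ginvol (\<Omega> A B z) * k))
        = (psign A * psign B) *\<^sub>R (- (h * \<Omega> A B z * k))"
      using h k by (simp add: has_parity_iff mult_ac)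
    then show "h * ginvol (\<Omega> A B z) * k = h * - (psign A * psign B) *\<^sub>R \<Omega> A B z * k"
      by (cases A; cases B) auto
  qed
  show "ginvol (\<Omega> A B z) = - (psign A * psign B) *\<^sub>R \<Omega> A B z" using inv A B .
  have "csign A B *\<^sub>R pinvol B (pinvol A (\<Omega> B A z)) = - \<Omega> A B z"
  proof (rule parity_cancel[of A], rule parity_cancel_right[of B])
    fix h k :: "'l grassmann" assume h: "has_parity A h" and k: "has_parity B k"
    have pk: "pinvol A k = csign A B *\<^sub>R k"
      using k by (cases A) (auto simp: csign_def has_parity_iff)
    have "k * \<Omega> B A z * h = h * (pinvol A k * pinvol A (\<Omega> B A z))"
      using has_parity_right[OF h, of "k * \<Omega> B A z"] by simp
    also have "\<dots> = csign A B *\<^sub>R (h * (k * pinvol A (\<Omega> B A z)))" by (simp add: pk)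
    also have "k * pinvol A (\<Omega> B A z) = pinvol B (pinvol A (\<Omega> B A z)) * k"
      by (rule has_parity_left[OF k])
    finally show "h * csign A B *\<^sub>R pinvol B (pinvol A (\<Omega> B A z)) * k = h * - \<Omega> A B z * k"
      using val[OF h k A B] by (simp add: mult.assoc)
  qed
  then show "\<Omega> B A z = - csign A B *\<^sub>R \<Omega> A B z"
    using inv[OF B A] by (cases A; cases B) (auto simp: csign_def neg_eq_iff_add_eq_0
        eq_neg_iff_add_eq_0 add.commute)
qed

section \<open>Invertibility of the component matrix of the form\<close>

definition sidx_nth :: "nat \<Rightarrow> nat \<Rightarrow> sindex" where
  "sidx_nth n i = (if i < n then Inl i else Inr (i - n))"

lemma sidx_nth_bij: "bij_betw (sidx_nth n) {0..<2 * n} (sidx n)"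
  by (rule bij_betwI[where g = "\<lambda>A. case A of Inl i \<Rightarrow> i | Inr i \<Rightarrow> n + i"])
    (auto simp: sidx_nth_def split: sum.splits)

lemma sum_sidx_nth: "(\<Sum>i = 0..<2 * n. f (sidx_nth n i)) = sum f (sidx n)"
  by (rule sum.reindex_bij_betw[OF sidx_nth_bij])

lemma gmono_parity_above:
  fixes N :: "'l::{linorder, infinite} set"
  assumes "finite N"
  shows "\<exists>T. finite T \<and> N \<subseteq> T \<and> has_parity A (gmono T)"
proof -
  obtain l where l: "l \<notin> N" using assms by (metis ex_new_if_finite infinite_UNIV)
  have "\<exists>T. finite T \<and> N \<subseteq> T \<and> even (card T) = b" for b
  proof (cases "even (card N) = b")
    case True
    then show ?thesis using assms by blast
  next
    case False
    then show ?thesis using assms l by (intro exI[of _ "insert l N"]) auto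
  qed
  then show ?thesis by (cases A) (metis gmono_parity has_parity.simps)+
qed

text \<open>
  A kernel vector of the body of \<open>\<Omega>\<close>, multiplied by a monomial that is annihilated by all
  generators occurring in \<open>\<Omega>\<close>, is orthogonal to all vectors.
\<close>

lemma nondegenerate_body_det:
  fixes \<Omega> :: "'l::{linorder, infinite} two_form"
  assumes \<Omega>: "odd_two_form n U \<Omega>" and z: "z \<in> superdomain n U"
    and nd: "nondegenerate_at n (form_at n \<Omega> z)"
  shows "det (map_mat gbody (mat (2 * n) (2 * n) (\<lambda>(i, j). \<Omega> (sidx_nth n i) (sidx_nth n j) z))) \<noteq> 0"
    (is "det ?M \<noteq> 0")
proof
  assume "det ?M = 0"
  moreover have M: "?M \<in> carrier_mat (2 * n) (2 * n)" by simp
  ultimately have "det ?M\<^sup>T = 0" using det_transpose[OF M] by simp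
  then obtain v where v: "v \<in> carrier_vec (2 * n)" "v \<noteq> 0\<^sub>v (2 * n)" "?M\<^sup>T *\<^sub>v v = 0\<^sub>v (2 * n)"
    using det_0_iff_vec_prod_zero_field[of "?M\<^sup>T" "2 * n"] M by auto
  define r where "r A = (case A of Inl i \<Rightarrow> v $ i | Inr i \<Rightarrow> v $ (n + i))" for A
  have r_nth: "r (sidx_nth n i) = v $ i" if "i < 2 * n" for i
    using that by (auto simp: r_def sidx_nth_def)
  have ker: "(\<Sum>A\<in>sidx n. r A * gbody (\<Omega> A B z)) = 0" if B: "B \<in> sidx n" for B
  proof -
    obtain j where j: "j < 2 * n" "B = sidx_nth n j"
      using B bij_betw_imp_surj_on[OF sidx_nth_bij, of n] by (metis atLeastLessThan_iff imageE)
    have "(?M\<^sup>T *\<^sub>v v) $ j = (\<Sum>i = 0..<2 * n. gbody (\<Omega> (sidx_nth n i) B z) * v $ i)"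
      using j v(1) by (simp add: scalar_prod_def)
    also have "\<dots> = (\<Sum>i = 0..<2 * n. r (sidx_nth n i) * gbody (\<Omega> (sidx_nth n i) B z))"
      by (intro sum.cong) (auto simp: r_nth)
    also have "\<dots> = (\<Sum>A\<in>sidx n. r A * gbody (\<Omega> A B z))"
      by (rule sum_sidx_nth)
    finally show ?thesis using v(3) j(1) by simp
  qed
  obtain i0 where i0: "i0 < 2 * n" "v $ i0 \<noteq> 0" using v(1,2)
      by (metis carrier_vecD eq_vecI index_zero_vec)
  define A0 where "A0 = sidx_nth n i0"
  have A0: "A0 \<in> sidx n" "r A0 \<noteq> 0"
    using i0 r_nth bij_betwE[OF sidx_nth_bij, of n] by (auto simp: A0_def)
  obtain N where N: "finite N" "\<And>A B. A \<in> sidx n \<Longrightarrow> B \<in> sidx n \<Longrightarrow> gdeg N 0 (\<Omega> A B z)"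
    by (rule finite_generators[of "(\<lambda>(A, B). \<Omega> A B z) ` (sidx n \<times> sidx n)"]) auto
  obtain T where T: "finite T" "N \<subseteq> T" "has_parity A0 (gmono T)"
    using gmono_parity_above[OF N(1)] by blast
  \<comment> \<open>Keeping only the components of the parity of \<open>A0\<close> makes
    \<open>u\<close> an even tangent vector. It remains in the kernel because the body of \<Omega>
    pairs only coordinates of opposite parity.\<close>
  define u :: "'l spoint" where
    "u A = (if A \<in> sidx n \<and> psign A = psign A0 then r A *\<^sub>R gmono T else 0)" for A
  have "u \<in> svec n"
    using T(3) by (auto simp: svec_def u_def has_parity_iff)
  moreover have "form_at n \<Omega> z u w = 0" for w
  proof -
    have col: "(\<Sum>A\<in>sidx n. u A * \<Omega> A B z) = 0" if B: "B \<in> sidx n" for B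
    proof -
      have absorb: "gmono T * \<Omega> A B z = gbody (\<Omega> A B z) *\<^sub>R gmono T" if "A \<in> sidx n" for A
        using N(2)[OF that B] T(1,2) by (intro gmono_mult_absorb) (auto simp: gdeg_def)
      have odd0: "gbody (\<Omega> A B z) = 0" if "A \<in> sidx n" "psign A = psign B" for A
        using odd_two_form_invol[OF \<Omega> z that(1) B] that(2)
        by (intro gbody_godd) (cases B; simp add: godd_iff)
      have "u A * \<Omega> A B z = (if psign A = psign A0 then (r A * gbody (\<Omega> A B z)) *\<^sub>R gmono T else 0)"
        if "A \<in> sidx n" for A using that absorb by (simp add: u_def)
      then have "(\<Sum>A\<in>sidx n. u A * \<Omega> A B z)
          = (\<Sum>A\<in>sidx n. if psign A = psign A0 then r A * gbody (\<Omega> A B z) else 0) *\<^sub>R gmono T"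
        by (simp add: scaleR_sum_left if_distrib[of "\<lambda>x. x *\<^sub>R gmono T"] cong: if_cong)
      also have "(\<Sum>A\<in>sidx n. if psign A = psign A0 then r A * gbody (\<Omega> A B z) else 0) = 0"
      proof (cases "psign B = psign A0")
        case True
        then show ?thesis using odd0 by (intro sum.neutral) auto
      next
        case False
        then have "psign A \<noteq> psign A0 \<Longrightarrow> psign A = psign B" for A
          by (cases A; cases B; cases A0) auto
        then have "(\<Sum>A\<in>sidx n. if psign A = psign A0 then r A * gbody (\<Omega> A B z) else 0)
            = (\<Sum>A\<in>sidx n. r A * gbody (\<Omega> A B z))"
          using odd0 by (intro sum.cong) auto
        then show ?thesis using ker[OF B] by simp
      qed
      finally show ?thesis by simp
    qed
    have "form_at n \<Omega> z u w = (\<Sum>B\<in>sidx n. \<Sum>A\<in>sidx n. u A * \<Omega> A B z * w B)"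
      unfolding form_at_def by (rule sum.swap)
    also have "\<dots> = (\<Sum>B\<in>sidx n. (\<Sum>A\<in>sidx n. u A * \<Omega> A B z) * w B)"
      by (simp add: sum_distrib_right)
    finally show ?thesis using col by simp
  qed
  ultimately have "u = (\<lambda>_. 0)" using nd unfolding nondegenerate_at_def by blast
  then have "u A0 = 0" by simp
  then show False using A0 gmono_nonzero[OF T(1)] by (simp add: u_def)
qed

text \<open>The predicate inside the description operator of \<open>poisson_bivector\<close>. The
  zeros outside \<open>sidx n\<close> make the inverse unique as a function.\<close>

definition bivector_inverse :: "nat \<Rightarrow> (sindex \<Rightarrow> sindex \<Rightarrow> 'l::linorder grassmann) \<Rightarrow> (sindex \<Rightarrow>
    sindex \<Rightarrow> 'l grassmann) \<Rightarrow> bool"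
  where "bivector_inverse n W P \<longleftrightarrow>
     (\<forall>A B. A \<notin> sidx n \<or> B \<notin> sidx n \<longrightarrow> P A B = 0) \<and>
     (\<forall>A\<in>sidx n. \<forall>C\<in>sidx n.
        (\<Sum>B\<in>sidx n. W A B * P B C) = (if A = C then 1 else 0) \<and>
        (\<Sum>B\<in>sidx n. P A B * W B C) = (if A = C then 1 else 0))"

lemma bivector_inverse_right:
  assumes P: "bivector_inverse n W P"
    and Q: "\<And>A C. A \<in> sidx n \<Longrightarrow> C \<in> sidx n \<Longrightarrow> (\<Sum>B\<in>sidx n. W A B * Q B C) = (if A = C then 1 else 0)"
    and AC: "A \<in> sidx n" "C \<in> sidx n"
  shows "Q A C = P A C"
proof -
  have "P A C = (\<Sum>B\<in>sidx n. P A B * (if B = C then 1 else 0))"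
    using AC(2) by (simp add: if_distrib[of "\<lambda>x. _ * x"] cong: if_cong)
  also have "\<dots> = (\<Sum>B\<in>sidx n. P A B * (\<Sum>E\<in>sidx n. W B E * Q E C))"
    using Q AC(2) by simp
  also have "\<dots> = (\<Sum>B\<in>sidx n. \<Sum>E\<in>sidx n. P A B * W B E * Q E C)"
    by (simp add: sum_distrib_left mult.assoc)
  also have "\<dots> = (\<Sum>E\<in>sidx n. (\<Sum>B\<in>sidx n. P A B * W B E) * Q E C)"
    by (subst sum.swap) (simp add: sum_distrib_right)
  also have "\<dots> = (\<Sum>E\<in>sidx n. if A = E then Q A C else 0)"
    using P AC(1) unfolding bivector_inverse_def by (intro sum.cong) auto
  finally show ?thesis using AC(1) by simp
qed

lemma poisson_bivector_inverse:
  fixes \<Omega> :: "'l::{linorder, infinite} two_form"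
  assumes \<Omega>: "odd_symplectic n U \<Omega>" and z: "z \<in> superdomain n U"
  shows "bivector_inverse n (\<lambda>A B. \<Omega> A B z) (poisson_bivector n \<Omega> z)"
proof -
  have \<Omega>': "odd_two_form n U \<Omega>" "nondegenerate_at n (form_at n \<Omega> z)"
    using \<Omega> z by (auto simp: odd_symplectic_def)
  let ?M = "mat (2 * n) (2 * n) (\<lambda>(i, j). \<Omega> (sidx_nth n i) (sidx_nth n j) z)"
  have M: "?M \<in> carrier_mat (2 * n) (2 * n)" by simp
  obtain R where R: "R \<in> carrier_mat (2 * n) (2 * n)" "?M * R = 1\<^sub>m (2 * n)" "R * ?M = 1\<^sub>m (2 * n)"
    using mat_inverse_of_body[OF M nondegenerate_body_det[OF \<Omega>'(1) z \<Omega>'(2)]] by auto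
  define e where "e A = (case A of Inl i \<Rightarrow> i | Inr i \<Rightarrow> n + i)" for A :: sindex
  define P where "P A B = (if A \<in> sidx n \<and> B \<in> sidx n then R $$ (e A, e B) else 0)" for A B
  have e: "e A < 2 * n" "sidx_nth n (e A) = A" if "A \<in> sidx n" for A
    using that by (auto simp: e_def sidx_nth_def split: sum.splits)
  have e': "sidx_nth n i \<in> sidx n" "e (sidx_nth n i) = i" if "i < 2 * n" for i
    using that by (auto simp: e_def sidx_nth_def)
  have einj: "e A = e C \<longleftrightarrow> A = C" if "A \<in> sidx n" "C \<in> sidx n" for A C
    using e that by metis
  have inv: "bivector_inverse n (\<lambda>A B. \<Omega> A B z) P"
    unfolding bivector_inverse_def
  proof (intro conjI ballI allI impI)
    fix A C assume AC: "A \<in> sidx n" "C \<in> sidx n"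
    have "(\<Sum>B\<in>sidx n. \<Omega> A B z * P B C) = (\<Sum>i = 0..<2 * n. \<Omega> A (sidx_nth n i) z * P (sidx_nth n i) C)"
      by (rule sum_sidx_nth[symmetric])
    also have "\<dots> = (\<Sum>i = 0..<2 * n. ?M $$ (e A, i) * R $$ (i, e C))"
      using AC e e' by (intro sum.cong) (auto simp: P_def)
    also have "\<dots> = (?M * R) $$ (e A, e C)"
      using AC e R(1) by (simp add: scalar_prod_def)
    also have "\<dots> = (if A = C then 1 else 0)"
      unfolding R(2) using AC e einj by simp
    finally show "(\<Sum>B\<in>sidx n. \<Omega> A B z * P B C) = (if A = C then 1 else 0)" .
    have "(\<Sum>B\<in>sidx n. P A B * \<Omega> B C z) = (\<Sum>i = 0..<2 * n. P A (sidx_nth n i) * \<Omega> (sidx_nth n i) C z)"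
      by (rule sum_sidx_nth[symmetric])
    also have "\<dots> = (\<Sum>i = 0..<2 * n. R $$ (e A, i) * ?M $$ (i, e C))"
      using AC e e' by (intro sum.cong) (auto simp: P_def)
    also have "\<dots> = (R * ?M) $$ (e A, e C)"
      using AC e R(1) by (simp add: scalar_prod_def)
    also have "\<dots> = (if A = C then 1 else 0)"
      unfolding R(3) using AC e einj by simp
    finally show "(\<Sum>B\<in>sidx n. P A B * \<Omega> B C z) = (if A = C then 1 else 0)" .
  qed (auto simp: P_def)
  have "poisson_bivector n \<Omega> z = (THE P. bivector_inverse n (\<lambda>A B. \<Omega> A B z) P)"
    by (simp add: poisson_bivector_def bivector_inverse_def)
  also have "\<dots> = P"
  proof (rule the_equality, fact inv, intro ext)
    fix Q A C assume Q: "bivector_inverse n (\<lambda>A B. \<Omega> A B z) Q"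
    show "Q A C = P A C"
    proof (cases "A \<in> sidx n \<and> C \<in> sidx n")
      case True
      then show ?thesis
        using Q by (intro bivector_inverse_right[OF inv]) (auto simp: bivector_inverse_def)
    next
      case False
      then show ?thesis using Q inv by (auto simp: bivector_inverse_def)
    qed
  qed
  finally show ?thesis using inv by simp
qed

text \<open>The parity involution and transposition, each with suitable signs, turn \<open>P\<close>
  into another right inverse of \<Omega>, which must be \<open>P\<close> again.\<close>

lemma poisson_bivector_symmetry:
  fixes \<Omega> :: "'l::{linorder, infinite} two_form"
  assumes \<Omega>: "odd_symplectic n U \<Omega>" and z: "z \<in> superdomain n U" and A: "A \<in> sidx n" and B: "B \<in>
      sidx n"
  defines "P \<equiv> poisson_bivector n \<Omega> z"
  shows poisson_bivector_invol: "ginvol (P A B) = - (psign A * psign B) *\<^sub>R P A B"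
    and poisson_bivector_swap: "P B A = (if psign A = 1 \<and> psign B = 1 then 1 else -1) *\<^sub>R P A B"
proof -
  have inv: "bivector_inverse n (\<lambda>A B. \<Omega> A B z) P"
    unfolding P_def using \<Omega> z by (rule poisson_bivector_inverse)
  have \<Omega>': "odd_two_form n U \<Omega>" using \<Omega> by (simp add: odd_symplectic_def)
  note W = odd_two_form_invol[OF \<Omega>' z] odd_two_form_swap[OF \<Omega>' z]
  have id: "(\<Sum>E\<in>sidx n. \<Omega> C E z * P E F) = (if C = F then 1 else 0)"
    "(\<Sum>E\<in>sidx n. P C E * \<Omega> E F z) = (if C = F then 1 else 0)"
    if "C \<in> sidx n" "F \<in> sidx n" for C F
    using inv that by (auto simp: bivector_inverse_def)
  have i: "- (psign A * psign B) *\<^sub>R ginvol (P A B) = P A B" if "A \<in> sidx n" "B \<in> sidx n" for A B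
  proof (rule bivector_inverse_right[OF inv _ that])
    fix C F assume CF: "C \<in> sidx n" "F \<in> sidx n"
    have "\<Omega> C E z * - (psign E * psign F) *\<^sub>R ginvol (P E F)
        = (psign C * psign F) *\<^sub>R ginvol (\<Omega> C E z * P E F)" if "E \<in> sidx n" for E
      using W(1)[OF CF(1) that] by (cases C; cases E) simp_all
    then have "(\<Sum>E\<in>sidx n. \<Omega> C E z * - (psign E * psign F) *\<^sub>R ginvol (P E F))
        = (psign C * psign F) *\<^sub>R ginvol (\<Sum>E\<in>sidx n. \<Omega> C E z * P E F)"
      by (simp add: scaleR_sum_right)
    then show "(\<Sum>E\<in>sidx n. \<Omega> C E z * - (psign E * psign F) *\<^sub>R ginvol (P E F)) = (if C
        = F then 1 else 0)"
      using id(1)[OF CF] by auto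
  qed
  have inv': "ginvol (P A B) = - (psign A * psign B) *\<^sub>R P A B" if "A \<in> sidx n" "B \<in> sidx n" for A B
    using arg_cong[OF i[OF that], of "\<lambda>x. - (psign A * psign B) *\<^sub>R x"] by (cases A; cases B) auto
  show "ginvol (P A B) = - (psign A * psign B) *\<^sub>R P A B" using inv' A B .
  have "(if psign A = 1 \<and> psign B = 1 then 1 else -1) *\<^sub>R P B A = P A B"
  proof (rule bivector_inverse_right[OF inv _ A B])
    fix C F assume CF: "C \<in> sidx n" "F \<in> sidx n"
    let ?s = "if psign C = -1 \<and> psign F = 1 then -1 else 1 :: real"
    have "\<Omega> C E z * (if psign E = 1 \<and> psign F = 1 then 1 else -1) *\<^sub>R P F E
        = ?s *\<^sub>R (P F E * \<Omega> E C z)"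
      if E: "E \<in> sidx n" for E
    proof -
      have "\<Omega> C E z * P F E = (if - (psign C * psign E) = -1 \<and> - (psign F * psign E)
          = -1 then -1 else 1) *\<^sub>R (P F E * \<Omega> C E z)"
        by (rule homogeneous_commute[OF W(1)[OF CF(1) E] inv'[OF CF(2) E]]) (cases C; cases E;
            cases F; simp)+
      then show ?thesis using W(2)[OF CF(1) E]
        by (cases C; cases E; cases F) (simp_all add: csign_def)
    qed
    then have "(\<Sum>E\<in>sidx n. \<Omega> C E z * (if psign E = 1 \<and> psign F = 1 then 1 else -1) *\<^sub>R P F E)
        = ?s *\<^sub>R (\<Sum>E\<in>sidx n. P F E * \<Omega> E C z)"
      unfolding scaleR_sum_right by (rule sum.cong[OF refl])
    also have "\<dots> = (if C = F then 1 else 0)" using id(2)[OF CF(2,1)] by auto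
    finally show "(\<Sum>E\<in>sidx n. \<Omega> C E z * (if psign E = 1 \<and> psign F = 1 then 1 else -1) *\<^sub>R P F E)
        = (if C = F then 1 else 0)" .
  qed
  then show "P B A = (if psign A = 1 \<and> psign B = 1 then 1 else -1) *\<^sub>R P A B"
    by (auto simp: minus_equation_iff[of "P B A"] split: if_splits)
qed

section \<open>Darboux coordinates and canonical transformations\<close>

text \<open>The derivative of \<open>f\<close> in an odd variable has parity opposite to
  \<open>f\<close>; hence \<open>- ginvol\<close> produces the sign of the bracket without assuming
  \<open>f\<close> homogeneous.\<close>

definition canonical_bracket :: "nat \<Rightarrow> ('l::linorder spoint \<Rightarrow> 'l grassmann) \<Rightarrow> ('l spoint \<Rightarrow> 'l
    grassmann) \<Rightarrow> 'l spoint \<Rightarrow> 'l grassmann"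
  where "canonical_bracket n f g y =
    (\<Sum>\<mu><n. pd (Inl \<mu>) f y * pd (Inr \<mu>) g y - ginvol (pd (Inr \<mu>) f y) * pd (Inl \<mu>) g y)"

text \<open>The table of brackets of Darboux coordinates, which is also the matrix of the canonical
  bivector.\<close>

definition kron :: "sindex \<Rightarrow> sindex \<Rightarrow> 'l::linorder grassmann" where
  "kron A B = (case A of
      Inl \<mu> \<Rightarrow> (case B of Inl \<nu> \<Rightarrow> 0 | Inr \<nu> \<Rightarrow> if \<mu> = \<nu> then 1 else 0)
    | Inr \<mu> \<Rightarrow> (case B of Inl \<nu> \<Rightarrow> if \<mu> = \<nu> then -1 else 0 | Inr \<nu> \<Rightarrow> 0))"

lemma kron_simps [simp]:
  "kron (Inl \<mu>) (Inl \<nu>) = 0" "kron (Inr \<mu>) (Inr \<nu>) = 0"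
  "kron (Inl \<mu>) (Inr \<nu>) = (if \<mu> = \<nu> then 1 else 0)"
  "kron (Inr \<mu>) (Inl \<nu>) = (if \<mu> = \<nu> then -1 else 0)"
  by (simp_all add: kron_def)

lemma kron_right:
  fixes f :: "sindex \<Rightarrow> 'l::linorder grassmann"
  shows "\<nu> < n \<Longrightarrow> (\<Sum>A\<in>sidx n. f A * kron A (Inl \<nu>)) = - f (Inr \<nu>)"
    and "\<nu> < n \<Longrightarrow> (\<Sum>A\<in>sidx n. f A * kron A (Inr \<nu>)) = f (Inl \<nu>)"
  by (simp_all add: sum_sidx if_distrib[of "\<lambda>x. _ * x"] cong: if_cong)

lemma kron_left:
  fixes f :: "sindex \<Rightarrow> 'l::linorder grassmann"
  shows "\<nu> < n \<Longrightarrow> (\<Sum>A\<in>sidx n. kron (Inl \<nu>) A * f A) = f (Inr \<nu>)"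
    and "\<nu> < n \<Longrightarrow> (\<Sum>A\<in>sidx n. kron (Inr \<nu>) A * f A) = - f (Inl \<nu>)"
  by (simp_all add: sum_sidx if_distrib[of "\<lambda>x. x * _"] cong: if_cong)

lemma canonical_bracket_kron:
  "canonical_bracket n f g y =
    (\<Sum>B\<in>sidx n. (\<Sum>A\<in>sidx n. pinvol A (pd A f y) * kron A B) * pd B g y)"
proof -
  have "(\<Sum>B\<in>sidx n. (\<Sum>A\<in>sidx n. pinvol A (pd A f y) * kron A B) * pd B g y)
      = (\<Sum>\<mu><n. - pinvol (Inr \<mu>) (pd (Inr \<mu>) f y) * pd (Inl \<mu>) g y)
        + (\<Sum>\<mu><n. pinvol (Inl \<mu>) (pd (Inl \<mu>) f y) * pd (Inr \<mu>) g y)"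
    unfolding sum_sidx[of "\<lambda>B. (\<Sum>A\<in>sidx n. pinvol A (pd A f y) * kron A B) * pd B g y"]
    by (intro arg_cong2[where f = "(+)"] sum.cong refl) (simp_all add: kron_right)
  then show ?thesis
    by (simp add: canonical_bracket_def sum_subtractf sum_negf)
qed

text \<open>A chart domain is a full preimage under \<open>pbody\<close>, so it contains the whole
  fiber of each of its points. There the chart and its inverse are mutually inverse, and
  superfunctions have constant body, so fibers go to fibers.\<close>

lemma coord_system_fiber_maps:
  fixes w :: "'l::{linorder, infinite} spoint \<Rightarrow> 'l spoint"
  assumes c: "(D, w) \<in> coord_systems n U" and z: "z \<in> D"
  shows "fiber n (pbody z) \<subseteq> D" "D \<subseteq> superdomain n U"
    and "fiber_map n (pbody z) (pbody (w z)) w"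
    and "fiber_map n (pbody (w z)) (pbody z) (inv_into D w)"
    and "p \<in> D \<Longrightarrow> inv_into D w (w p) = p"
    and "y \<in> fiber n (pbody (w z)) \<Longrightarrow> w (inv_into D w y) = y"
    and "w z \<in> fiber n (pbody (w z))" "fiber n (pbody (w z)) \<subseteq> superdomain n (pbody ` w ` D)"
proof -
  obtain V V' where V: "V \<subseteq> U" "D = superdomain n V" "bij_betw w D (superdomain n V')"
    "\<And>A. A \<in> sidx n \<Longrightarrow> superfunction n V (\<lambda>z. w z A)"
    "\<And>A. A \<in> sidx n \<Longrightarrow> superfunction n V' (\<lambda>y. inv_into D w y A)"
    using c unfolding coord_systems_def by auto
  have xV: "pbody z \<in> V" using z V(2) by (simp add: superdomain_def)
  have wD: "w p \<in> superdomain n V'" if "p \<in> D" for p using bij_betw_apply[OF V(3) that] .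
  have iD: "inv_into D w y \<in> D" if "y \<in> superdomain n V'" for y
    using V(3) that by (metis bij_betw_imp_surj_on inv_into_into)
  have x'V': "pbody (w z) \<in> V'" using wD[OF z] by (simp add: superdomain_def)
  have sv: "p \<in> superdomain n V \<Longrightarrow> p \<in> svec n" for p :: "'l spoint" and V
      by (simp add: superdomain_def)
  show sub: "fiber n (pbody z) \<subseteq> D" using V(2) xV fiber_superdomain by blast
  show "D \<subseteq> superdomain n U" using V(1,2) by (auto simp: superdomain_def)
  have zf: "z \<in> fiber n (pbody z)" using z V(2) superdomain_fiber by blast
  show wzf: "w z \<in> fiber n (pbody (w z))" using wD[OF z] superdomain_fiber by blast
  show inv: "inv_into D w (w p) = p" if "p \<in> D" for p
    using V(3) that by (simp add: bij_betw_def inv_into_f_f)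
  have sub': "fiber n (pbody (w z)) \<subseteq> superdomain n V'" using x'V' fiber_superdomain by blast
  then show "w (inv_into D w y) = y" if "y \<in> fiber n (pbody (w z))" for y
    using V(3) that by (metis bij_betw_imp_surj_on f_inv_into_f subsetD)
  have body: "pbody (f p) = pbody (f q)"
    if "\<And>A. A \<in> sidx n \<Longrightarrow> superfunction n V (\<lambda>z. f z A)" "x \<in> V" "p \<in> fiber n x" "q \<in> fiber n x"
      "f p \<in> svec n" "f q \<in> svec n" for f :: "'l spoint \<Rightarrow> 'l spoint" and V x p q
  proof
    fix i
    show "pbody (f p) i = pbody (f q) i"
    proof (cases "i < n")
      case True
      then show ?thesis using superfunction_gbody[OF that(1) that(2-4), of "Inl i"]
          by (simp add: pbody_def)
    next
      case False
      then show ?thesis using svec_zero[OF that(5), of "Inl i"] svec_zero[OF that(6), of "Inl i"]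
          by (simp add: pbody_def)
    qed
  qed
  have "w p \<in> fiber n (pbody (w z))" if p: "p \<in> fiber n (pbody z)" for p
  proof -
    have pD: "p \<in> D" using p sub by blast
    have "pbody (w p) = pbody (w z)"
      by (rule body[OF V(4) xV p zf sv[OF wD[OF pD]] sv[OF wD[OF z]]])
    then show ?thesis using superdomain_fiber[OF wD[OF pD]] by simp
  qed
  then show "fiber_map n (pbody z) (pbody (w z)) w"
    using superfunction_sdiff[OF V(4) xV] by (simp add: fiber_map_def)
  have "inv_into D w y \<in> fiber n (pbody z)" if y: "y \<in> fiber n (pbody (w z))" for y
  proof -
    have yD: "inv_into D w y \<in> D" using y sub' iD by blast
    have "pbody (inv_into D w y) = pbody (inv_into D w (w z))"
      using yD z V(2) inv[OF z] by (intro body[OF V(5) x'V' y wzf] sv[of _ V]) simp_all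
    then show ?thesis using superdomain_fiber[of _ n V] yD V(2) inv[OF z] by metis
  qed
  then show "fiber_map n (pbody (w z)) (pbody z) (inv_into D w)"
    using superfunction_sdiff[OF V(5) x'V'] by (simp add: fiber_map_def)
  show "fiber n (pbody (w z)) \<subseteq> superdomain n (pbody ` w ` D)"
    using z by (auto simp: superdomain_def fiber_def)
qed

lemma odd_bracket_eq:
  fixes \<Omega> :: "'l::{linorder, infinite} two_form"
  assumes f: "fiber_map n (pbody z) x' w" and z: "z \<in> fiber n (pbody z)" and CE: "C \<in> sidx n" "E \<in>
      sidx n"
  shows "odd_bracket n \<Omega> (\<lambda>y. w y C) (\<lambda>y. w y E) z =
    (\<Sum>A\<in>sidx n. \<Sum>B\<in>sidx n. pinvol A (pd A (\<lambda>y. w y C) z) * poisson_bivector n \<Omega> z A B * pd B (\<lambda>y.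
        w y E) z)"
  unfolding odd_bracket_def
  using pd_right_eq[OF fiber_mapD(3)[OF f z _ CE(1)]] by (intro sum.cong) auto

text \<open>\<open>darboux_systems\<close> prescribes brackets of even with odd coordinates in this
  order only; the opposite order follows termwise from the parity and symmetry of the bivector and
  the parities of the derivatives.\<close>

lemma odd_bracket_antisymmetric:
  fixes \<Omega> :: "'l::{linorder, infinite} two_form"
  assumes \<Omega>: "odd_symplectic n U \<Omega>" and zU: "z \<in> superdomain n U"
    and f: "fiber_map n (pbody z) x' w" and i: "i < n" "j < n"
  shows "odd_bracket n \<Omega> (\<lambda>y. w y (Inr i)) (\<lambda>y. w y (Inl j)) z
    = - odd_bracket n \<Omega> (\<lambda>y. w y (Inl j)) (\<lambda>y. w y (Inr i)) z"
proof -
  have z: "z \<in> fiber n (pbody z)" using zU by (rule superdomain_fiber)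
  let ?P = "poisson_bivector n \<Omega> z"
  let ?g = "\<lambda>A. pd A (\<lambda>y. w y (Inr i)) z" and ?f = "\<lambda>A. pd A (\<lambda>y. w y (Inl j)) z"
  have sgn: "ginvol (?g A) = (- psign A) *\<^sub>R ?g A" "ginvol (?f A) = psign A *\<^sub>R ?f A"
      if "A \<in> sidx n" for A
    using fiber_map_pd_invol[OF f z that, of "Inr i"] fiber_map_pd_invol[OF f z that, of "Inl j"]
        i by auto
  have key: "pinvol A (?g A) * ?P A B * ?f B = - (pinvol B (?f B) * ?P B A * ?g A)"
    if A: "A \<in> sidx n" and B: "B \<in> sidx n" for A B
  proof -
    have gP: "?g A * ?P A B = (if - psign A = -1 \<and> - (psign A * psign B)
        = -1 then -1 else 1) *\<^sub>R (?P A B * ?g A)"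
      using sgn(1)[OF A] poisson_bivector_invol[OF \<Omega> zU A B]
      by (rule homogeneous_commute) (cases A; cases B; simp)+
    have "ginvol (?g A * ?P A B) = psign B *\<^sub>R (?g A * ?P A B)"
      using sgn(1)[OF A] poisson_bivector_invol[OF \<Omega> zU A B] by (cases A; cases B) simp_all
    then have gPf: "?g A * ?P A B * ?f B = (if psign B = -1 \<and> psign B
        = -1 then -1 else 1) *\<^sub>R (?f B * (?g A * ?P A B))"
      using sgn(2)[OF B] by (rule homogeneous_commute) (cases B; simp)+
    show ?thesis
      using gP gPf sgn(1)[OF A] sgn(2)[OF B] poisson_bivector_swap[OF \<Omega> zU A B]
      by (cases A; cases B) (simp_all add: mult.assoc)
  qed
  have "odd_bracket n \<Omega> (\<lambda>y. w y (Inr i)) (\<lambda>y. w y (Inl j)) z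
      = (\<Sum>A\<in>sidx n. \<Sum>B\<in>sidx n. pinvol A (?g A) * ?P A B * ?f B)"
    using i by (intro odd_bracket_eq[OF f z]) auto
  also have "\<dots> = (\<Sum>A\<in>sidx n. \<Sum>B\<in>sidx n. - (pinvol B (?f B) * ?P B A * ?g A))"
    using key by (intro sum.cong) auto
  also have "\<dots> = - (\<Sum>B\<in>sidx n. \<Sum>A\<in>sidx n. pinvol B (?f B) * ?P B A * ?g A)"
    by (subst sum.swap) (simp add: sum_negf)
  also have "(\<Sum>B\<in>sidx n. \<Sum>A\<in>sidx n. pinvol B (?f B) * ?P B A * ?g A)
      = odd_bracket n \<Omega> (\<lambda>y. w y (Inl j)) (\<lambda>y. w y (Inr i)) z"
    using i by (intro odd_bracket_eq[OF f z, symmetric]) auto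
  finally show ?thesis .
qed

lemma darboux_bracket:
  fixes \<Omega> :: "'l::{linorder, infinite} two_form"
  assumes \<Omega>: "odd_symplectic n U \<Omega>" and c: "(D, w) \<in> darboux_systems n U \<Omega>" and z: "z \<in> D"
    and CE: "C \<in> sidx n" "E \<in> sidx n"
  shows "(\<Sum>A\<in>sidx n. \<Sum>B\<in>sidx n. pinvol A (pd A (\<lambda>y. w y C) z) * poisson_bivector n \<Omega> z A B * pd B
      (\<lambda>y. w y E) z)
    = kron C E"
proof -
  have cs: "(D, w) \<in> coord_systems n U" using c by (simp add: darboux_systems_def)
  note m = coord_system_fiber_maps[OF cs z]
  have zU: "z \<in> superdomain n U" using m(2) z by blast
  have "odd_bracket n \<Omega> (\<lambda>y. w y C) (\<lambda>y. w y E) z = kron C E"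
    using c z CE odd_bracket_antisymmetric[OF \<Omega> zU m(3)]
    by (cases C; cases E) (auto simp: darboux_systems_def)
  then show ?thesis using odd_bracket_eq[OF m(3) superdomain_fiber[OF zU] CE] by simp
qed

text \<open>The brackets of the new coordinates are expanded by the chain rule through the old ones.
  The bivector enclosed by derivatives of the old coordinates is \<open>kron\<close> again, and what
  remains is the canonical bracket of the components of \<open>F\<close>.\<close>

lemma transition_canonical:
  fixes \<Omega> :: "'l::{linorder, infinite} two_form"
  assumes \<Omega>: "odd_symplectic n U \<Omega>"
    and c: "(D, w) \<in> darboux_systems n U \<Omega>" and c': "(D', w') \<in> darboux_systems n U \<Omega>"
    and z: "z \<in> D" "z \<in> D'" and y: "y \<in> fiber n (pbody (w z))" and CE: "C \<in> sidx n" "E \<in> sidx n"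
  defines "F \<equiv> w' \<circ> inv_into D w"
  shows "canonical_bracket n (\<lambda>y. F y C) (\<lambda>y. F y E) y = kron C E"
proof -
  have cs: "(D, w) \<in> coord_systems n U" "(D', w') \<in> coord_systems n U"
    using c c' by (simp_all add: darboux_systems_def)
  note m = coord_system_fiber_maps[OF cs(1) z(1)] and m' = coord_system_fiber_maps[OF cs(2) z(2)]
  have F: "fiber_map n (pbody (w z)) (pbody (w' z)) F"
    unfolding F_def by (rule fiber_map_compose[OF m(4) m'(3)])
  define p where "p = inv_into D w y"
  have p: "p \<in> fiber n (pbody z)" unfolding p_def by (rule fiber_mapD(1)[OF m(4) y])
  have pD: "p \<in> D" "p \<in> D'" using p m(1) m'(1) by auto
  have wp: "w p = y" unfolding p_def by (rule m(6)[OF y])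
  let ?P = "poisson_bivector n \<Omega> p"
  let ?W = "\<lambda>A B. pd A (\<lambda>q. w q B) p" and ?X = "\<lambda>A B. pd A (\<lambda>q. F q B) y"
  have chain: "pd A (\<lambda>q. w' q B) p = (\<Sum>H\<in>sidx n. ?W A H * ?X H B)" if "A \<in> sidx n" "B \<in> sidx n"
      for A B
  proof -
    have "pd A (\<lambda>q. w' q B) p = pd A (\<lambda>q. F (w q) B) p"
    proof (rule pd_cong[OF p that(1)])
      show "w' q B = F (w q) B" if "q \<in> fiber n (pbody z)" for q
        using m(5)[of q] m(1) that by (auto simp: F_def)
    qed
    also have "\<dots> = (\<Sum>H\<in>sidx n. ?W A H * pd H (\<lambda>q. F q B) (w p))"
      by (rule pd_compose[OF m(3) F p that])
    finally show ?thesis by (simp add: wp)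
  qed
  \<comment> \<open>The chain rule for right derivatives: the same factors in the opposite order,
    without a sign.\<close>
  have swap: "pinvol A (?W A H * ?X H C) = pinvol H (?X H C) * pinvol A (?W A H)"
    if A: "A \<in> sidx n" and H: "H \<in> sidx n" for A H
  proof -
    have "?W A H * ?X H C = (if psign A * psign H = -1 \<and> psign H * psign C
        = -1 then -1 else 1) *\<^sub>R (?X H C * ?W A H)"
      by (rule homogeneous_commute[OF fiber_map_pd_invol[OF m(3) p A H] fiber_map_pd_invol[OF F y
          H CE(1)]])
        (cases A; cases H; cases C; simp)+
    then show ?thesis
      using fiber_map_pd_invol[OF m(3) p A H] fiber_map_pd_invol[OF F y H CE(1)]
      by (cases A; cases H; cases C) simp_all
  qed
  have "kron C E = (\<Sum>A\<in>sidx n. \<Sum>B\<in>sidx n. pinvol A (pd A (\<lambda>q. w' q C) p) * ?P A B * pd B (\<lambda>q. w' q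
      E) p)"
    by (rule darboux_bracket[OF \<Omega> c' pD(2) CE, symmetric])
  also have "\<dots> = (\<Sum>A\<in>sidx n. \<Sum>B\<in>sidx n. (\<Sum>H\<in>sidx n. pinvol H (?X H C) * pinvol A (?W A H)) * ?P A
      B * (\<Sum>K\<in>sidx n. ?W B K * ?X K E))"
    using chain CE swap by (intro sum.cong refl) (simp add: pinvol_simps(11))
  also have "\<dots> = (\<Sum>A\<in>sidx n. \<Sum>B\<in>sidx n. \<Sum>K\<in>sidx n. \<Sum>H\<in>sidx n.
      pinvol H (?X H C) * (pinvol A (?W A H) * ?P A B * ?W B K) * ?X K E)"
    by (simp add: sum_distrib_left sum_distrib_right mult.assoc)
  also have "\<dots> = (\<Sum>A\<in>sidx n. \<Sum>K\<in>sidx n. \<Sum>H\<in>sidx n. \<Sum>B\<in>sidx n.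
      pinvol H (?X H C) * (pinvol A (?W A H) * ?P A B * ?W B K) * ?X K E)"
    by (rule sum.cong[OF refl], rule trans[OF sum.swap], rule sum.cong[OF refl], rule sum.swap)
  also have "\<dots> = (\<Sum>K\<in>sidx n. \<Sum>H\<in>sidx n. \<Sum>A\<in>sidx n. \<Sum>B\<in>sidx n.
      pinvol H (?X H C) * (pinvol A (?W A H) * ?P A B * ?W B K) * ?X K E)"
    by (rule trans[OF sum.swap], rule sum.cong[OF refl], rule sum.swap)
  also have "\<dots> = (\<Sum>K\<in>sidx n. \<Sum>H\<in>sidx n. pinvol H (?X H C) *
      (\<Sum>A\<in>sidx n. \<Sum>B\<in>sidx n. pinvol A (?W A H) * ?P A B * ?W B K) * ?X K E)"
    by (simp add: sum_distrib_left sum_distrib_right)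
  also have "\<dots> = (\<Sum>K\<in>sidx n. \<Sum>H\<in>sidx n. pinvol H (?X H C) * kron H K * ?X K E)"
    using darboux_bracket[OF \<Omega> c pD(1)] by (intro sum.cong refl) simp
  also have "\<dots> = canonical_bracket n (\<lambda>y. F y C) (\<lambda>y. F y E) y"
    by (simp only: canonical_bracket_kron sum_distrib_right)
  finally show ?thesis by simp
qed

section \<open>Canonical transformations preserving the surface\<close>

text \<open>The assumptions are symmetric in \<open>F\<close> and \<open>G\<close>, so that through
  \<open>swapped\<close> each fact on one Jacobian matrix is available for the other.\<close>

locale canonical_pair =
  fixes n :: nat and x x' :: "nat \<Rightarrow> real" and F G :: "'l::{linorder, infinite} spoint \<Rightarrow> 'l spoint"
  assumes F: "fiber_map n x x' F" and G: "fiber_map n x' x G"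
    and GF: "y \<in> fiber n x \<Longrightarrow> G (F y) = y" and FG: "y \<in> fiber n x' \<Longrightarrow> F (G y) = y"
    and canonical_F: "y \<in> fiber n x \<Longrightarrow> C \<in> sidx n \<Longrightarrow> E \<in> sidx n \<Longrightarrow>
      canonical_bracket n (\<lambda>y. F y C) (\<lambda>y. F y E) y = kron C E"
    and canonical_G: "y \<in> fiber n x' \<Longrightarrow> C \<in> sidx n \<Longrightarrow> E \<in> sidx n \<Longrightarrow>
      canonical_bracket n (\<lambda>y. G y C) (\<lambda>y. G y E) y = kron C E"
begin

abbreviation dF :: "sindex \<Rightarrow> sindex \<Rightarrow> 'l spoint \<Rightarrow> 'l grassmann" where
  "dF A B \<equiv> pd A (\<lambda>y. F y B)"

abbreviation dG :: "sindex \<Rightarrow> sindex \<Rightarrow> 'l spoint \<Rightarrow> 'l grassmann" where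
  "dG A B \<equiv> pd A (\<lambda>y. G y B)"

lemma swapped: "canonical_pair n x' x G F"
  using canonical_pair_axioms unfolding canonical_pair_def by blast

lemma jac_inverse:
  assumes y: "y \<in> fiber n x" and AC: "A \<in> sidx n" "C \<in> sidx n"
  shows "(\<Sum>B\<in>sidx n. dF A B y * dG B C (F y)) = (if A = C then 1 else 0)"
proof -
  have "(\<Sum>B\<in>sidx n. dF A B y * dG B C (F y)) = pd A (\<lambda>y. G (F y) C) y"
    by (rule pd_compose[OF F G y AC, symmetric])
  also have "\<dots> = pd A (\<lambda>y. y C) y" by (rule pd_cong[OF y AC(1)]) (simp add: GF)
  also have "\<dots> = (if A = C then 1 else 0)" by (rule pd_eqI[OF has_pd_coord])
  finally show ?thesis .
qed

text \<open>Multiplying the canonical relations by the inverse Jacobian matrix makes them linear.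
  This is the odd analogue of expressing the inverse of a symplectic matrix by its
  transpose.\<close>

lemma duality:
  assumes y: "y \<in> fiber n x" and CH: "C \<in> sidx n" "H \<in> sidx n"
  shows "(\<Sum>E\<in>sidx n. kron C E * dG E H (F y)) = (\<Sum>A\<in>sidx n. pinvol A (dF A C y) * kron A H)"
proof -
  let ?K = "\<lambda>B. \<Sum>A\<in>sidx n. pinvol A (dF A C y) * kron A B"
  have "(\<Sum>E\<in>sidx n. kron C E * dG E H (F y))
      = (\<Sum>E\<in>sidx n. canonical_bracket n (\<lambda>y. F y C) (\<lambda>y. F y E) y * dG E H (F y))"
    using canonical_F[OF y CH(1)] by (intro sum.cong refl) simp
  also have "\<dots> = (\<Sum>E\<in>sidx n. \<Sum>B\<in>sidx n. ?K B * (dF B E y * dG E H (F y)))"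
    unfolding canonical_bracket_kron by (simp only: sum_distrib_right mult.assoc)
  also have "\<dots> = (\<Sum>B\<in>sidx n. ?K B * (\<Sum>E\<in>sidx n. dF B E y * dG E H (F y)))"
    by (subst sum.swap) (simp only: sum_distrib_left)
  also have "\<dots> = (\<Sum>B\<in>sidx n. if B = H then ?K H else 0)"
    using jac_inverse[OF y _ CH(2)] by (intro sum.cong refl) simp
  finally show ?thesis using CH(2) by simp
qed

lemma
  assumes y: "y \<in> fiber n x" and i: "i < n" "j < n"
  shows dF_rl: "dF (Inr j) (Inl i) y = dG (Inr i) (Inl j) (F y)"
    and dF_ll: "dF (Inl j) (Inl i) y = dG (Inr i) (Inr j) (F y)"
    and dF_rr: "dF (Inr j) (Inr i) y = dG (Inl i) (Inl j) (F y)"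
    and dF_lr: "dF (Inl j) (Inr i) y = - dG (Inl i) (Inr j) (F y)"
  using duality[OF y, of "Inl i" "Inl j"] duality[OF y, of "Inl i" "Inr j"]
    duality[OF y, of "Inr i" "Inl j"] duality[OF y, of "Inr i" "Inr j"] i
    fiber_map_pd_invol[OF F y, of "Inr j" "Inl i"] fiber_map_pd_invol[OF F y, of "Inr j" "Inr i"]
  by (simp_all add: kron_left kron_right)

text \<open>The mixed blocks are odd and have body zero, so the body of the Jacobian matrix is block
  diagonal and each block is inverted by the corresponding one of \<open>G\<close>.\<close>

lemma body_inverse:
  assumes y: "y \<in> fiber n x" and p: "p = Inl \<or> p = Inr"
  shows "det (map_mat gbody (jac n p p F y)) \<noteq> 0"
proof -
  let ?A = "map_mat gbody (jac n p p F y)" and ?B = "map_mat gbody (jac n p p G (F y))"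
  have odd0: "gbody (dF A B y) = 0" if "A \<in> sidx n" "B \<in> sidx n" "psign A * psign B = -1" for A B
    using fiber_map_pd_invol[OF F y that(1,2)] that(3) by (intro gbody_godd) (simp add: godd_iff)
  have "?A * ?B = 1\<^sub>m n"
  proof (rule eq_matI)
    fix i j assume "i < dim_row (1\<^sub>m n :: real mat)" "j < dim_col (1\<^sub>m n :: real mat)"
    then have ij: "i < n" "j < n" by auto
    have s: "p i \<in> sidx n" "p j \<in> sidx n" using p ij by auto
    have "(?A * ?B) $$ (i, j) = (\<Sum>l<n. gbody (dF (p i) (p l) y) * gbody (dG (p l) (p j) (F y)))"
      using ij by (simp add: jac_def scalar_prod_def atLeast0LessThan)
    also have "\<dots> = gbody (\<Sum>B\<in>sidx n. dF (p i) B y * dG B (p j) (F y))"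
      using p s odd0[OF s(1)] by (auto simp: sum_sidx gbody_sum)
    also have "\<dots> = (if p i = p j then 1 else 0)"
      using jac_inverse[OF y s] by simp
    finally show "(?A * ?B) $$ (i, j) = 1\<^sub>m n $$ (i, j)" using p ij by auto
  qed (simp_all add: jac_def)
  then have "det ?A * det ?B = 1"
    using det_mult[of ?A n ?B] by (simp add: jac_def)
  then show ?thesis by auto
qed

lemma jac_parity:
  assumes "y \<in> fiber n x"
  shows "even_mat n (jac n Inl Inl F y)" "even_mat n (jac n Inr Inr F y)"
    "odd_mat n (jac n Inl Inr F y)" "odd_mat n (jac n Inr Inl F y)"
  using fiber_map_pd_invol[OF F assms]
  by (auto simp: even_mat_def odd_mat_def jac_def geven_iff godd_iff)

end

section \<open>Derivatives along and across the slice\<close>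

definition on_slice :: "'l::linorder spoint \<Rightarrow> bool" where
  "on_slice y \<longleftrightarrow> y (Inl 0) = 0 \<and> y (Inr 0) = 0"

definition tangent :: "nat \<Rightarrow> sindex \<Rightarrow> bool" where
  "tangent n A \<longleftrightarrow> A \<in> sidx n \<and> A \<noteq> Inl 0 \<and> A \<noteq> Inr 0"

lemma tangent_pd_zero:
  fixes f :: "'l::{linorder, infinite} spoint \<Rightarrow> 'l grassmann"
  assumes f: "\<And>y. y \<in> fiber n x \<Longrightarrow> on_slice y \<Longrightarrow> f y = 0"
    and y: "y \<in> fiber n x" "on_slice y" and A: "tangent n A"
  shows "pd A f y = 0"
proof (rule pd_eqI)
  show "has_pd f y A 0"
    unfolding has_pd_def
  proof (intro allI impI)
    fix h :: "'l grassmann" assume h: "has_parity A h \<and> h * h = 0"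
    have "y(A := y A + h) \<in> fiber n x" "on_slice (y(A := y A + h))"
      using fiber_update[OF y(1)] h y(2) A by (auto simp: tangent_def on_slice_def)
    then show "f (y(A := y A + h)) = f y + h * 0" using f y by simp
  qed
qed

text \<open>Moving first in one variable and then in the other reaches the same point as the
  opposite order; the terms containing both increments are compared. One increment is even, so no
  sign appears.\<close>

lemma mixed_partial:
  fixes f :: "'l::{linorder, infinite} spoint \<Rightarrow> 'l grassmann"
  assumes f: "sdiff n x 2 f" and z: "z \<in> fiber n x" and i: "i < n" "j < n"
  shows "pd (Inr j) (pd (Inl i) f) z = pd (Inl i) (pd (Inr j) f) z"
proof (rule parity_cancel[of "Inl i"], rule parity_cancel[of "Inr j"])
  fix h k :: "'l grassmann"
  assume h: "has_parity (Inl i) h" "h * h = 0" and k: "has_parity (Inr j) k" "k * k = 0"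
  have A: "Inl i \<in> sidx n" "Inr j \<in> sidx n" using i by auto
  have f1: "has_pd f y A (pd A f y)" if "y \<in> fiber n x" "A \<in> sidx n" for y A
    by (rule sdiff_has_pd[OF f _ that]) simp
  have f2: "has_pd (pd B f) y A (pd A (pd B f) y)" if "y \<in> fiber n x" "A \<in> sidx n" "B \<in> sidx n"
      for y A B
    using f that by (intro sdiff_has_pd[of n x "Suc 0"]) (auto simp: numeral_2_eq_2)
  let ?z1 = "z(Inl i := z (Inl i) + h)" and ?z2 = "z(Inr j := z (Inr j) + k)"
  have z12: "?z1 \<in> fiber n x" "?z2 \<in> fiber n x" using fiber_update[OF z] A h k by auto
  have "f (?z1(Inr j := ?z1 (Inr j) + k)) = f (?z2(Inl i := ?z2 (Inl i) + h))"
    by (intro arg_cong[of _ _ f]) (auto simp: fun_eq_iff)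
  moreover have "f (?z1(Inr j := ?z1 (Inr j) + k)) = f ?z1 + k * pd (Inr j) f ?z1"
    by (rule has_pdD[OF f1[OF z12(1) A(2)] k])
  moreover have "f ?z1 = f z + h * pd (Inl i) f z"
    by (rule has_pdD[OF f1[OF z A(1)] h])
  moreover have "pd (Inr j) f ?z1 = pd (Inr j) f z + h * pd (Inl i) (pd (Inr j) f) z"
    by (rule has_pdD[OF f2[OF z A(1,2)] h])
  moreover have "f (?z2(Inl i := ?z2 (Inl i) + h)) = f ?z2 + h * pd (Inl i) f ?z2"
    by (rule has_pdD[OF f1[OF z12(2) A(1)] h])
  moreover have "f ?z2 = f z + k * pd (Inr j) f z"
    by (rule has_pdD[OF f1[OF z A(2)] k])
  moreover have "pd (Inl i) f ?z2 = pd (Inl i) f z + k * pd (Inr j) (pd (Inl i) f) z"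
    by (rule has_pdD[OF f2[OF z A(2,1)] k])
  ultimately have "k * (h * pd (Inl i) (pd (Inr j) f) z) = h * (k * pd (Inr j) (pd (Inl i) f) z)"
    by (simp add: algebra_simps)
  moreover have "h * k = k * h" using has_parity_left[OF h(1), of k] by simp
  ultimately show "k * (h * pd (Inr j) (pd (Inl i) f) z) = k * (h * pd (Inl i) (pd (Inr j) f) z)"
    by (metis mult.assoc)
qed

locale adapted_pair = canonical_pair n x x' F G
  for n x x' and F G :: "'l::{linorder, infinite} spoint \<Rightarrow> 'l spoint" +
  assumes n_pos: "0 < n"
    and slice: "y \<in> fiber n x \<Longrightarrow> on_slice (F y) \<longleftrightarrow> on_slice y"
begin

lemma swapped_adapted: "adapted_pair n x' x G F"
proof -
  interpret s: canonical_pair n x' x G F by (rule swapped)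
  show ?thesis
    by unfold_locales (use n_pos slice FG fiber_mapD(1)[OF G] in metis)+
qed

lemma dF_tangent:
  assumes "y \<in> fiber n x" "on_slice y" "tangent n A"
  shows "dF A (Inl 0) y = 0" "dF A (Inr 0) y = 0"
  using slice tangent_pd_zero[OF _ assms, of "\<lambda>y. F y (Inl 0)"] tangent_pd_zero[OF _ assms, of
      "\<lambda>y. F y (Inr 0)"]
  by (auto simp: on_slice_def)

lemma dG_tangent:
  assumes "y \<in> fiber n x'" "on_slice y" "tangent n A"
  shows "dG A (Inl 0) y = 0" "dG A (Inr 0) y = 0"
  using adapted_pair.dF_tangent[OF swapped_adapted assms] .

text \<open>Duality turns the normal derivative of a tangential coordinate into a tangential
  derivative of an old normal coordinate, and the latter is zero along the slice.\<close>

lemma dF_normal: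
  assumes y: "y \<in> fiber n x" "on_slice y" and i: "0 < i" "i < n"
  shows "dF (Inr 0) (Inl i) y = 0" "dF (Inr 0) (Inr i) y = 0"
    "dF (Inl 0) (Inl i) y = 0" "dF (Inl 0) (Inr i) y = 0"
proof -
  have s: "F y \<in> fiber n x'" "on_slice (F y)"
    using y slice fiber_mapD(1)[OF F] by auto
  have t: "tangent n (Inl i)" "tangent n (Inr i)" using i by (auto simp: tangent_def)
  show "dF (Inr 0) (Inl i) y = 0" "dF (Inr 0) (Inr i) y = 0"
    "dF (Inl 0) (Inl i) y = 0" "dF (Inl 0) (Inr i) y = 0"
    using dF_rl[OF y(1) i(2) n_pos] dF_rr[OF y(1) i(2) n_pos] dF_ll[OF y(1) i(2) n_pos] dF_lr[OF
        y(1) i(2) n_pos]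
      dG_tangent[OF s t(1)] dG_tangent[OF s t(2)] by simp_all
qed

text \<open>On even functions the odd bracket is symmetric: its two terms coincide instead of
  cancelling, so the vanishing bracket of \<open>x^0\<close> with itself is a genuine
  equation.\<close>

lemma bracket_G0:
  assumes y: "y \<in> fiber n x'"
  shows "(\<Sum>\<mu><n. dG (Inl \<mu>) (Inl 0) y * dG (Inr \<mu>) (Inl 0) y) = 0" (is "?Q = 0")
proof -
  have "0 = canonical_bracket n (\<lambda>y. G y (Inl 0)) (\<lambda>y. G y (Inl 0)) y"
    using canonical_G[OF y, of "Inl 0" "Inl 0"] n_pos by simp
  also have "\<dots> = (\<Sum>\<mu><n. 2 *\<^sub>R (dG (Inl \<mu>) (Inl 0) y * dG (Inr \<mu>) (Inl 0) y))"
    unfolding canonical_bracket_def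
  proof (rule sum.cong[OF refl])
    fix \<mu> assume "\<mu> \<in> {..<n}"
    then have \<mu>: "Inl \<mu> \<in> sidx n" "Inr \<mu> \<in> sidx n" "Inl 0 \<in> sidx n" using n_pos by auto
    have i: "ginvol (dG (Inr \<mu>) (Inl 0) y) = - dG (Inr \<mu>) (Inl 0) y"
      using fiber_map_pd_invol[OF G y \<mu>(2,3)] by simp
    have "geven (dG (Inl \<mu>) (Inl 0) y)"
      using fiber_map_pd_invol[OF G y \<mu>(1,3)] by (simp add: geven_iff)
    then have "dG (Inl \<mu>) (Inl 0) y * dG (Inr \<mu>) (Inl 0) y
        = dG (Inr \<mu>) (Inl 0) y * dG (Inl \<mu>) (Inl 0) y"
      by (rule geven_commute)
    then show "dG (Inl \<mu>) (Inl 0) y * dG (Inr \<mu>) (Inl 0) y - ginvol (dG (Inr \<mu>) (Inl 0) y) * dG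
        (Inl \<mu>) (Inl 0) y
        = 2 *\<^sub>R (dG (Inl \<mu>) (Inl 0) y * dG (Inr \<mu>) (Inl 0) y)"
      by (simp add: i scaleR_2)
  qed
  also have "\<dots> = 2 *\<^sub>R ?Q" by (simp only: scaleR_sum_right)
  finally show ?thesis by simp
qed

text \<open>
  The normal part of the Jacobian matrix is \<open>(a, b; 0, 1/a)\<close>: the vector field \<open>\<partial>/\<partial>\<theta>\<^sub>0\<close> is
  Hamiltonian with Hamiltonian \<open>x\<^sup>0\<close>, which vanishes on the surface.
\<close>

lemma normal_block:
  assumes y: "y \<in> fiber n x" "on_slice y"
  shows dF_normal_rl: "dF (Inr 0) (Inl 0) y = 0"
    and dF_normal_inverse: "dF (Inl 0) (Inl 0) y * dF (Inr 0) (Inr 0) y = 1"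
proof -
  let ?a = "dF (Inl 0) (Inl 0) y" and ?c = "dF (Inr 0) (Inl 0) y" and ?d = "dF (Inr 0) (Inr 0) y"
  have s: "F y \<in> fiber n x'" "on_slice (F y)"
    using y slice fiber_mapD(1)[OF F] by auto
  have idx: "Inl 0 \<in> sidx n" "Inr 0 \<in> sidx n" using n_pos by auto
  have even: "geven ?d" "geven ?a" and odd: "godd ?c"
    using fiber_map_pd_invol[OF F y(1)] idx by (simp_all add: geven_iff godd_iff)
  have c: "dG (Inr 0) (Inl 0) (F y) = ?c" and d: "dG (Inl 0) (Inl 0) (F y) = ?d"
    and a: "dG (Inr 0) (Inr 0) (F y) = ?a"
    using dF_rl[OF y(1) n_pos n_pos] dF_rr[OF y(1) n_pos n_pos] dF_ll[OF y(1) n_pos n_pos] by simp_all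
  obtain m where m: "n = Suc m" using n_pos by (cases n) auto
  have "0 = (\<Sum>\<mu><Suc m. dG (Inl \<mu>) (Inl 0) (F y) * dG (Inr \<mu>) (Inl 0) (F y))"
    using bracket_G0[OF s(1)] m by simp
  also have "\<dots> = ?d * ?c"
    using dG_tangent[OF s] m by (subst sum.lessThan_Suc_shift) (simp add: c d tangent_def)
  finally have "?c * ?d = 0" using geven_commute[OF even(1), of ?c] by simp
  have "1 = (\<Sum>B\<in>sidx n. dF (Inr 0) B y * dG B (Inr 0) (F y))"
    using jac_inverse[OF y(1) idx(2) idx(2)] by simp
  also have "\<dots> = ?c * dG (Inl 0) (Inr 0) (F y) + ?d * ?a"
    unfolding sum_sidx m sum.lessThan_Suc_shift using dF_normal[OF y] by (simp add: m a)
  finally have one: "?c * dG (Inl 0) (Inr 0) (F y) + ?d * ?a = 1" by simp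
  \<comment> \<open>Since \<open>?c\<close> is odd, the unit 1 forces \<open>?d\<close> to have
    nonzero body, and then \<open>?c * ?d = 0\<close> gives \<open>?c = 0\<close>.\<close>
  have "gbody (?c * dG (Inl 0) (Inr 0) (F y) + ?d * ?a) = 1" unfolding one by simp
  then have "gbody ?d \<noteq> 0" using gbody_godd[OF odd] by auto
  then show c0: "?c = 0" using \<open>?c * ?d = 0\<close> gbody_nonzero_cancel by blast
  show "?a * ?d = 1" using one geven_commute[OF even(1), of ?a] by (simp add: c0)
qed

lemma dG_normal_rl:
  assumes "y \<in> fiber n x'" "on_slice y"
  shows "dG (Inr 0) (Inl 0) y = 0"
  using adapted_pair.dF_normal_rl[OF swapped_adapted assms] .

lemma G0_second_tangent:
  assumes y: "y \<in> fiber n x'" "on_slice y" and A: "tangent n A" and B: "tangent n B"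
  shows "pd A (dG B (Inl 0)) y = 0"
  by (rule tangent_pd_zero[OF _ y A]) (rule dG_tangent(1)[OF _ _ B])

text \<open>\<open>bracket_G0\<close> holds on the whole fiber and may be differentiated across the
  slice. At slice points every first derivative of \<open>x^0\<close> vanishes except the one along
  the new \<open>x^0\<close>, which is invertible; it multiplies the second derivative in
  question.\<close>

lemma G0_second_normal:
  assumes y: "y \<in> fiber n x'" "on_slice y"
  shows "pd (Inl 0) (dG (Inr 0) (Inl 0)) y = 0" "pd (Inr 0) (dG (Inl 0) (Inl 0)) y = 0"
proof -
  have idx: "Inl 0 \<in> sidx n" using n_pos by simp
  let ?e = "pd (Inl 0) (dG (Inr 0) (Inl 0)) y"
  have sd: "sdiff n x' 2 (\<lambda>y. G y (Inl 0))" by (rule fiber_mapD(2)[OF G idx])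
  have hp: "has_pd (dG B (Inl 0)) y (Inl 0) (pd (Inl 0) (dG B (Inl 0)) y)" if "B \<in> sidx n" for B
    using sd that idx y by (intro sdiff_has_pd[of n x' "Suc 0"]) (auto simp: numeral_2_eq_2)
  have "has_pd (\<lambda>y. \<Sum>\<mu><n. dG (Inl \<mu>) (Inl 0) y * dG (Inr \<mu>) (Inl 0) y) y (Inl 0)
      (\<Sum>\<mu><n. pd (Inl 0) (dG (Inl \<mu>) (Inl 0)) y * dG (Inr \<mu>) (Inl 0) y
        + pinvol (Inl 0) (dG (Inl \<mu>) (Inl 0) y) * pd (Inl 0) (dG (Inr \<mu>) (Inl 0)) y)"
            (is "has_pd ?Q _ _ ?q")
    using hp by (intro has_pd_sum has_pd_mult) auto
  moreover have "has_pd ?Q y (Inl 0) 0"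
    by (rule has_pd_cong[OF has_pd_const[of 0] y(1) idx]) (simp add: bracket_G0)
  ultimately have "?q = 0" by (rule has_pd_unique)
  obtain m where m: "n = Suc m" using n_pos by (cases n) auto
  have "?q = dG (Inl 0) (Inl 0) y * ?e"
    unfolding m sum.lessThan_Suc_shift using dG_tangent[OF y] dG_normal_rl[OF y] m
        by (simp add: tangent_def)
  then have "dG (Inl 0) (Inl 0) y * ?e = 0" using \<open>?q = 0\<close> by simp
  have inv: "dG (Inl 0) (Inl 0) y * dG (Inr 0) (Inr 0) y = 1"
    by (rule adapted_pair.dF_normal_inverse[OF swapped_adapted y])
  have "geven (dG (Inl 0) (Inl 0) y)" using fiber_map_pd_invol[OF G y(1) idx idx]
      by (simp add: geven_iff)
  then have "?e * dG (Inl 0) (Inl 0) y = 0"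
    using geven_commute \<open>dG (Inl 0) (Inl 0) y * ?e = 0\<close> by metis
  moreover have "gbody (dG (Inl 0) (Inl 0) y) \<noteq> 0" using arg_cong[OF inv, of gbody] by auto
  ultimately show e: "?e = 0" by (rule gbody_nonzero_cancel)
  show "pd (Inr 0) (dG (Inl 0) (Inl 0)) y = 0"
    using mixed_partial[OF sd y(1) n_pos n_pos] e by simp
qed

end

section \<open>The square root of the Berezinian along the surface\<close>

lemma det_bdiag:
  fixes A :: "'a::comm_ring_1 mat"
  assumes "A \<in> carrier_mat n n"
  shows "det (bdiag a A) = a * det A"
  using assms det_four_block_mat_lower_left_zero_col[of "mat 1 1 (\<lambda>_. a)" "0\<^sub>m 1 n" n "0\<^sub>m n 1" A]
  by (simp add: bdiag_def det_single)

lemma map_mat_gbody_bdiag: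
  "A \<in> carrier_mat n n \<Longrightarrow> map_mat gbody (bdiag a A) = bdiag (gbody a) (map_mat gbody A)"
  by (intro eq_matI) (auto simp: bdiag_def)

lemma mat_mult_index:
  fixes X Y :: "'a::semiring_0 mat"
  assumes "X \<in> carrier_mat n k" "Y \<in> carrier_mat k m" "i < n" "j < m"
  shows "(X * Y) $$ (i, j) = (\<Sum>l = 0..<k. X $$ (i, l) * Y $$ (l, j))"
  using assms by (simp add: scalar_prod_def)

lemma Ber_eq_Ber_mat:
  "Ber n F z = Ber_mat n (jac n Inl Inl F z) (jac n Inl Inr F z) (jac n Inr Inl F z) (jac n Inr
      Inr F z)"
  by (simp add: Ber_def Ber_mat_def Let_def)

lemma sqrt_Ber_eq_sqrt_of:
  "sqrt_Ber n F z = of_geven (THE r. sqrt_of (Ber n F z) (sgn (rbody (even_det (jac n Inl Inl F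
      z)))) r)"
  by (simp add: sqrt_Ber_def sqrt_of_def rbody_def)

text \<open>The odd blocks drop out of the body of the Schur complement. A nonzero body of the
  Berezinian is what makes its root exist and be unique.\<close>

lemma rbody_Ber_mat:
  fixes A B C D E :: "'l::linorder grassmann mat"
  assumes A: "even_mat n A" and B: "odd_mat n B" and C: "odd_mat n C" and D: "even_mat n D"
    and E: "E \<in> carrier_mat n n" "D * E = 1\<^sub>m n" "E * D = 1\<^sub>m n" and d: "det (map_mat gbody A) \<noteq> 0"
  shows "rbody (Ber_mat n A B C D) \<noteq> 0"
proof -
  have cc: "A \<in> carrier_mat n n" "B \<in> carrier_mat n n" "C \<in> carrier_mat n n" "D \<in> carrier_mat n n"
    using A B C D by (auto simp: even_mat_def odd_mat_def)
  have Ee: "even_mat n E" by (rule even_mat_inverse[OF D E])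
  have ECc: "E * C \<in> carrier_mat n n" by (rule square_mat_closed[OF E(1) cc(3)])
  have assoc: "B * E * C = B * (E * C)" by (rule square_mat_ring(5)[OF cc(2) E(1) cc(3)])
  have Z: "even_mat n (A - B * E * C)"
    unfolding assoc using A B parity_mat_mult(3)[OF Ee C] by (intro even_mat_minus parity_mat_mult(2))
  have "gbody ((B * (E * C)) $$ (i, j)) = 0" if "i < n" "j < n" for i j
  proof -
    have "(B * (E * C)) $$ (i, j) = (\<Sum>l = 0..<n. B $$ (i, l) * (E * C) $$ (l, j))"
      by (rule mat_mult_index[OF cc(2) ECc that])
    moreover have "gbody (B $$ (i, l)) = 0" if "l < n" for l
      using B that \<open>i < n\<close> by (auto simp: odd_mat_def gbody_godd)
    ultimately show ?thesis by (simp add: gbody_sum)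
  qed
  then have "map_mat gbody (A - B * E * C) = map_mat gbody A"
    unfolding assoc using cc ECc by (intro eq_matI) (auto simp del: index_mult_mat(1))
  then have "rbody (even_det (A - B * E * C)) \<noteq> 0" using rbody_even_det[OF Z] d by simp
  moreover have one: "even_det D * even_det E = 1"
    using even_det_mult[OF D Ee] E(2) by (simp add: even_det_one)
  moreover have "rbody (even_det E) \<noteq> 0"
    using arg_cong[OF one, of rbody] by auto
  moreover have "mat_inv n D = E" using cc(4) E by (intro mat_inv_eqI)
  ultimately show ?thesis by (simp add: Ber_mat_def ring_inv_eqI)
qed

section \<open>Index maps, and the passage between the slice and coordinates on the surface\<close>

definition flip :: "sindex \<Rightarrow> sindex" where
  "flip A = (case A of Inl i \<Rightarrow> Inr i | Inr i \<Rightarrow> Inl i)"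

lemma flip_simps [simp]: "flip (Inl i) = Inr i" "flip (Inr i) = Inl i" "flip A \<in> sidx n \<longleftrightarrow> A \<in> sidx n"
  by (simp_all add: flip_def split: sum.split)

definition sucidx :: "sindex \<Rightarrow> sindex" where
  "sucidx A = (case A of Inl i \<Rightarrow> Inl (Suc i) | Inr i \<Rightarrow> Inr (Suc i))"

lemma sucidx_simps [simp]: "sucidx (Inl i) = Inl (Suc i)" "sucidx (Inr i) = Inr (Suc i)"
  "sucidx A \<in> sidx (Suc k) \<longleftrightarrow> A \<in> sidx k"
  by (simp_all add: sucidx_def split: sum.split)

lemma drop0_sucidx: "drop0 z A = z (sucidx A)"
  by (simp add: drop0_def sucidx_def split: sum.split)

lemma insert0_simps [simp]: "insert0 y (Inl 0) = 0" "insert0 y (Inr 0) = 0"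
  "insert0 y (Inl (Suc i)) = y (Inl i)" "insert0 y (Inr (Suc i)) = y (Inr i)"
  by (simp_all add: insert0_def)

lemma insert0_drop0: "on_slice y \<Longrightarrow> insert0 (drop0 y) = y"
proof
  fix A assume "on_slice y"
  then show "insert0 (drop0 y) A = y A"
    by (cases A) (auto simp: on_slice_def insert0_def drop0_def split: nat.split)
qed

lemma drop0_insert0 [simp]: "drop0 (insert0 y) = y"
  by (auto simp: drop0_def fun_eq_iff split: sum.split)

lemma insert0_update: "insert0 (y(A := h)) = (insert0 y)(sucidx A := h)"
proof
  fix B
  show "insert0 (y(A := h)) B = ((insert0 y)(sucidx A := h)) B"
    by (cases A; cases B) (auto simp: insert0_def split: nat.split)
qed

lemma on_slice_insert0: "on_slice (insert0 y)"
  by (simp add: on_slice_def)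

lemma insert0_svec: "y \<in> svec k \<Longrightarrow> insert0 y \<in> svec (Suc k)"
  unfolding svec_def
proof (clarify, intro conjI allI impI)
  fix A assume y: "\<forall>A. has_parity A (y A)" "\<forall>A. A \<notin> sidx k \<longrightarrow> y A = 0"
  show "has_parity A (insert0 y A)"
    using y(1)[rule_format, of "Inl _"] y(1)[rule_format, of "Inr _"]
    by (cases A) (auto simp: insert0_def geven_zero godd_def split: nat.split)
  show "insert0 y A = 0" if "A \<notin> sidx (Suc k)"
    using that y(2) by (cases A) (auto simp: insert0_def split: nat.split)
qed

lemma drop0_svec: "y \<in> svec (Suc k) \<Longrightarrow> drop0 y \<in> svec k"
  unfolding svec_def
proof (clarify, intro conjI allI impI)
  fix A assume y: "\<forall>A. has_parity A (y A)" "\<forall>A. A \<notin> sidx (Suc k) \<longrightarrow> y A = 0"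
  show "has_parity A (drop0 y A)"
    using y(1)[rule_format, of "sucidx A"] by (cases A) (auto simp: drop0_sucidx)
  show "drop0 y A = 0" if "A \<notin> sidx k"
    using that y(2) by (simp add: drop0_sucidx)
qed

lemma fiber_drop0: "y \<in> fiber (Suc k) x \<Longrightarrow> drop0 y \<in> fiber k (\<lambda>i. x (Suc i))"
  using drop0_svec by (auto simp: fiber_def pbody_def drop0_def)

lemma fiber_insert0:
  "y \<in> fiber k (\<lambda>i. x (Suc i)) \<Longrightarrow> x 0 = 0 \<Longrightarrow> insert0 y \<in> fiber (Suc k) x"
  using insert0_svec by (auto simp: fiber_def pbody_def insert0_def fun_eq_iff split: nat.split)

context adapted_pair
begin

lemma dF_theta0:
  assumes "y \<in> fiber n x" "B \<in> sidx n"
  shows "dF (Inr 0) B y = dG (flip B) (Inl 0) (F y)"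
  using dF_rl[OF assms(1) _ n_pos] dF_rr[OF assms(1) _ n_pos] assms(2) by (cases B) auto

text \<open>The matrix added to the identity in the right factor by which the Jacobian matrix
  changes when \<theta>_0 moves by \<epsilon>. The sign \<open>psign C\<close> arises from moving
  \<epsilon> behind \<open>dF A C\<close>.\<close>

definition incr :: "'l grassmann \<Rightarrow> 'l spoint \<Rightarrow> sindex \<Rightarrow> sindex \<Rightarrow> 'l grassmann" where
  "incr \<epsilon> y C B = psign C *\<^sub>R (\<epsilon> * pd C (dG (flip B) (Inl 0)) (F y))"

lemma jac_increment:
  assumes y: "y \<in> fiber n x" and AB: "A \<in> sidx n" "B \<in> sidx n" and \<epsilon>: "godd \<epsilon>"
  shows "dF A B (y(Inr 0 := y (Inr 0) + \<epsilon>)) = dF A B y + (\<Sum>C\<in>sidx n. dF A C y * incr \<epsilon> y C B)"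
proof -
  let ?y = "y(Inr 0 := y (Inr 0) + \<epsilon>)"
  let ?T = "dG (flip B) (Inl 0)"
  have idx: "Inl 0 \<in> sidx n" "Inr 0 \<in> sidx n" using n_pos by auto
  have par: "has_parity (Inr 0) \<epsilon>" "\<epsilon> * \<epsilon> = 0" using \<epsilon> by (simp_all add: godd_square)
  have sd: "sdiff n x' 2 ?T"
    using AB(2) by (intro sdiff_pd[OF fiber_mapD(2)[OF G idx(1)]]) simp
  have shifted: "F (p(Inr 0 := p (Inr 0) + \<epsilon>)) B = F p B + \<epsilon> * ?T (F p)" if p: "p \<in> fiber n x" for p
    using has_pdD[OF fiber_mapD(3)[OF F p idx(2) AB(2)] par] dF_theta0[OF p AB(2)] by simp
  let ?R = "\<Sum>C\<in>sidx n. dF A C y * pd C ?T (F y)"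
  have hp: "has_pd (\<lambda>p. F p B + \<epsilon> * ?T (F p)) y A (dF A B y + (0 * ?T (F y) + pinvol A \<epsilon> * ?R))"
    by (intro has_pd_add has_pd_mult has_pd_const fiber_mapD(3)[OF F y AB] has_pd_compose[OF F sd
        y AB(1)])
  have "has_pd (\<lambda>y. F y B) ?y A (dF A B y + pinvol A \<epsilon> * ?R)"
    unfolding has_pd_def
  proof (intro allI impI)
    fix h :: "'l grassmann" assume h: "has_parity A h \<and> h * h = 0"
    let ?p = "y(A := y A + h)"
    have p: "?p \<in> fiber n x" using fiber_update[OF y AB(1)] h by blast
    \<comment> \<open>The two increments commute, also for \<open>A = Inr 0\<close>. The derivative
      at the moved point is thus that of \<open>F p B + \<epsilon> * ?T (F p)\<close> at
      \<open>p = y\<close>.\<close>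
    have "?y(A := ?y A + h) = ?p(Inr 0 := ?p (Inr 0) + \<epsilon>)" by (auto simp: fun_eq_iff)
    then have "F (?y(A := ?y A + h)) B = F ?p B + \<epsilon> * ?T (F ?p)" using shifted[OF p] by simp
    also have "\<dots> = F y B + \<epsilon> * ?T (F y) + h * (dF A B y + (0 * ?T (F y) + pinvol A \<epsilon> * ?R))"
      using h by (intro has_pdD[OF hp]) auto
    finally show "F (?y(A := ?y A + h)) B = F ?y B + h * (dF A B y + pinvol A \<epsilon> * ?R)"
      using shifted[OF y] by simp
  qed
  then have "dF A B ?y = dF A B y + pinvol A \<epsilon> * ?R" by (rule pd_eqI)
  also have "pinvol A \<epsilon> * ?R = (\<Sum>C\<in>sidx n. dF A C y * incr \<epsilon> y C B)"
    unfolding sum_distrib_left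
  proof (rule sum.cong[OF refl])
    fix C assume C: "C \<in> sidx n"
    have "pinvol A \<epsilon> = psign A *\<^sub>R \<epsilon>" using \<epsilon> by (cases A) (simp_all add: godd_iff)
    moreover have "\<epsilon> * dF A C y = (psign A * psign C) *\<^sub>R (dF A C y * \<epsilon>)"
      using godd_commute[OF \<epsilon>, of "dF A C y"] fiber_map_pd_invol[OF F y AB(1) C] by simp
    ultimately have "pinvol A \<epsilon> * dF A C y = psign C *\<^sub>R (dF A C y * \<epsilon>)" by simp
    then show "pinvol A \<epsilon> * (dF A C y * pd C ?T (F y)) = dF A C y * incr \<epsilon> y C B"
      unfolding incr_def mult.assoc[symmetric] by (simp add: mult.assoc)
  qed
  finally show ?thesis .
qed

lemma incr_invol:
  assumes y: "y \<in> fiber n x" and CB: "C \<in> sidx n" "B \<in> sidx n" and \<epsilon>: "godd \<epsilon>"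
  shows "ginvol (incr \<epsilon> y C B) = (psign C * psign B) *\<^sub>R incr \<epsilon> y C B"
proof -
  have idx: "Inl 0 \<in> sidx n" using n_pos by simp
  have Fy: "F y \<in> fiber n x'" by (rule fiber_mapD(1)[OF F y])
  have fB: "flip B \<in> sidx n" using CB(2) by simp
  have hp: "has_pd (dG (flip B) (Inl 0)) (F y) C (pd C (dG (flip B) (Inl 0)) (F y))"
    using CB Fy fB fiber_mapD(2)[OF G idx, of 2] by
        (intro sdiff_has_pd[of n x' "Suc 0"]) (auto simp: numeral_2_eq_2)
  have "ginvol (pd C (dG (flip B) (Inl 0)) (F y))
      = (psign C * psign (flip B)) *\<^sub>R pd C (dG (flip B) (Inl 0)) (F y)"
    using fiber_map_pd_invol[OF G _ fB idx] by (intro has_pd_invol[OF hp Fy CB(1)]) simp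
  then show ?thesis using \<epsilon> by (cases C; cases B) (simp_all add: incr_def godd_iff)
qed

abbreviation blk :: "'l grassmann \<Rightarrow> 'l spoint \<Rightarrow> (nat \<Rightarrow> sindex) \<Rightarrow> (nat \<Rightarrow> sindex) \<Rightarrow> 'l grassmann
    mat" where
  "blk \<epsilon> y p q \<equiv> mat n n (\<lambda>(i, j). incr \<epsilon> y (p i) (q j))"

lemma jac_increment_mat:
  assumes y: "y \<in> fiber n x" and \<epsilon>: "godd \<epsilon>" and pq: "p = Inl \<or> p = Inr" "q = Inl \<or> q = Inr"
  shows "jac n p q F (y(Inr 0 := y (Inr 0) + \<epsilon>)) =
    jac n p q F y + jac n p Inl F y * blk \<epsilon> y Inl q + jac n p Inr F y * blk \<epsilon> y Inr q"
proof (rule eq_matI, goal_cases)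
  case (1 i j)
  then have ij: "i < n" "j < n" by (auto simp: jac_def)
  then have "p i \<in> sidx n" "q j \<in> sidx n" using pq by auto
  then show ?case
    using ij jac_increment[OF y _ _ \<epsilon>, of "p i" "q j"]
    by (simp add: jac_def scalar_prod_def sum_sidx atLeast0LessThan add.assoc)
qed (simp_all add: jac_def)

lemma jac_slice:
  assumes n: "n = Suc k" and y: "y \<in> fiber n x" "on_slice y" and pq: "p = Inl \<or> p = Inr" "q
      = Inl \<or> q = Inr"
  shows "jac n p q F y = bdiag (dF (p 0) (q 0) y) (mat k k (\<lambda>(i, j). dF (p (Suc i)) (q (Suc j)) y))"
proof (rule eq_matI, goal_cases)
  case (1 i j)
  then have ij: "i < Suc k" "j < Suc k" by (auto simp: bdiag_def)
  show ?case
    unfolding bdiag_index[OF mat_carrier ij]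
    using ij pq dF_normal[OF y] dF_tangent[OF y] n
    by (auto simp: jac_def tangent_def split: nat.splits)
qed (simp_all add: jac_def bdiag_def n)

abbreviation sub :: "nat \<Rightarrow> 'l spoint \<Rightarrow> (nat \<Rightarrow> sindex) \<Rightarrow> (nat \<Rightarrow> sindex) \<Rightarrow> 'l grassmann mat" where
  "sub k y p q \<equiv> mat k k (\<lambda>(i, j). dF (p (Suc i)) (q (Suc j)) y)"

lemma sub_parity:
  assumes "n = Suc k" "y \<in> fiber n x"
  shows "even_mat k (sub k y Inl Inl)" "even_mat k (sub k y Inr Inr)"
    "odd_mat k (sub k y Inl Inr)" "odd_mat k (sub k y Inr Inl)"
  using fiber_map_pd_invol[OF F assms(2)] assms(1)
  by (auto simp: even_mat_def odd_mat_def geven_iff godd_iff)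

lemma sub_body_det:
  assumes n: "n = Suc k" and y: "y \<in> fiber n x" "on_slice y" and p: "p = Inl \<or> p = Inr"
  shows "det (map_mat gbody (sub k y p p)) \<noteq> 0"
  using body_inverse[OF y(1) p] jac_slice[OF n y p p]
  by (simp add: map_mat_gbody_bdiag[of _ k] det_bdiag[of _ k])

lemma normal_even:
  assumes "y \<in> fiber n x"
  shows "geven (dF (Inl 0) (Inl 0) y)" "geven (dF (Inr 0) (Inr 0) y)"
  using fiber_map_pd_invol[OF F assms] n_pos by (simp_all add: geven_iff)

lemma normal_inverse':
  assumes "y \<in> fiber n x" "on_slice y"
  shows "dF (Inr 0) (Inr 0) y * dF (Inl 0) (Inl 0) y = 1"
  using dF_normal_inverse[OF assms] geven_commute[OF normal_even(1)[OF assms(1)]] by metis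

text \<open>
  By duality the increment of the Jacobian matrix consists of second derivatives of \<open>x\<^sup>0\<close> as a
  function of the new coordinates; its supertrace is twice \<open>\<Sum>\<^sub>\<mu> \<partial>\<^sup>2x\<^sup>0/\<partial>x'\<^sup>\<mu>\<partial>\<theta>'\<^sub>\<mu>\<close>.
\<close>

lemma Ber_theta0:
  assumes y: "y \<in> fiber n x" "on_slice y" and \<epsilon>: "godd \<epsilon>"
  shows "Ber n F (y(Inr 0 := y (Inr 0) + \<epsilon>)) = Ber n F y"
proof -
  let ?y = "y(Inr 0 := y (Inr 0) + \<epsilon>)"
  obtain k where n: "n = Suc k" using n_pos by (cases n) auto
  have s: "F y \<in> fiber n x'" "on_slice (F y)"
    using y slice fiber_mapD(1)[OF F] by auto
  let ?A = "jac n Inl Inl F y" and ?B = "jac n Inl Inr F y" and ?C = "jac n Inr Inl F y" and ?D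
      = "jac n Inr Inr F y"
  let ?m = "blk \<epsilon> y Inl Inl" and ?u = "blk \<epsilon> y Inl Inr" and ?v = "blk \<epsilon> y Inr Inl" and ?q
      = "blk \<epsilon> y Inr Inr"
  obtain E where E: "E \<in> carrier_mat k k" "sub k y Inr Inr * E = 1\<^sub>m k" "E * sub k y Inr Inr = 1\<^sub>m k"
    using mat_inverse_of_body[of "sub k y Inr Inr" k] sub_body_det[OF n y, of Inr] by auto
  let ?a = "dF (Inl 0) (Inl 0) y" and ?d = "dF (Inr 0) (Inr 0) y"
  let ?E = "bdiag ?a E"
  have D: "?D = bdiag ?d (sub k y Inr Inr)" and C: "?C = bdiag 0 (sub k y Inr Inl)"
    using jac_slice[OF n y, of Inr Inr] jac_slice[OF n y, of Inr Inl] dF_normal_rl[OF y] by auto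
  have Ec: "?E \<in> carrier_mat n n" unfolding n by (rule bdiag_carrier[OF E(1)])
  have DE: "?D * ?E = 1\<^sub>m n" "?E * ?D = 1\<^sub>m n"
    unfolding D using E normal_inverse'[OF y] dF_normal_inverse[OF y]
    by (simp_all add: bdiag_mult[of _ k] bdiag_one n)
  have EC: "?E * ?C = bdiag 0 (E * sub k y Inr Inl)"
    unfolding C using E(1) by (simp add: bdiag_mult[of _ k])
  have EC0: "(?E * ?C) $$ (l, i) = 0" if "l = 0 \<or> i = 0" "l < n" "i < n" for l i
  proof -
    have "E * sub k y Inr Inl \<in> carrier_mat k k" using E(1) by (rule square_mat_closed) simp
    then show ?thesis unfolding EC using that n by (subst bdiag_index[of _ k]) (auto split: nat.split)
  qed
  have ECc: "?E * ?C \<in> carrier_mat n n" using Ec by (auto simp: jac_def)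
  have eps: "eps_mat \<epsilon> n (blk \<epsilon> y p q)" for p q
  proof -
    have "\<exists>x. incr \<epsilon> y C B = \<epsilon> * x" for C B
      by (rule exI[of _ "psign C *\<^sub>R pd C (dG (flip B) (Inl 0)) (F y)"]) (simp add: incr_def)
    then show ?thesis by (auto simp: eps_mat_def)
  qed
  have par: "even_mat n ?m" "even_mat n ?q" "odd_mat n ?u"
    using incr_invol[OF y(1) _ _ \<epsilon>] by (auto simp: even_mat_def odd_mat_def geven_iff godd_iff)
  have diag: "incr \<epsilon> y (Inl i) (Inl i) = 0" "incr \<epsilon> y (Inr i) (Inr i) = 0" if "i < n" for i
    using that G0_second_normal[OF s] G0_second_tangent[OF s]
    by (cases "i = 0"; simp add: incr_def tangent_def)+
  have u0: "incr \<epsilon> y (Inl i) (Inr j) = 0" if "0 < i" "0 < j" "i < n" "j < n" for i j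
    using that G0_second_tangent[OF s] by (simp add: incr_def tangent_def)
  define X where "X = ?E * ?C"
  have X: "X \<in> carrier_mat n n" "dim_row X = n" "dim_col X = n"
    using ECc carrier_matD[OF ECc] unfolding X_def by (simp_all only:)
  have X0: "X $$ (l, i) = 0" if "l = 0 \<or> i = 0" "l < n" "i < n" for l i
    unfolding X_def using that by (rule EC0)
  \<comment> \<open>Every product \<open>?u $$ (i, l) * X $$ (l, i)\<close> vanishes: row and column
    0 of \<open>X\<close> are zero, and \<open>?u\<close> is zero where both indices are positive.
    The same holds in the opposite order.\<close>
  have d1: "(?m - ?u * (?E * ?C)) $$ (i, i) = 0" if i: "i < n" for i
  proof -
    have "?u $$ (i, l) * X $$ (l, i) = 0" if l: "l < n" for l
      using X0[of l i] u0[of i l] l i by (cases "l = 0 \<or> i = 0") auto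
    then have "(?u * X) $$ (i, i) = 0"
      using i X(1) by (subst mat_mult_index[of _ n n]) auto
    then show ?thesis
      unfolding X_def[symmetric] using i diag X by (simp del: index_mult_mat(1))
  qed
  have d2: "(?q + ?E * ?C * ?u) $$ (i, i) = 0" if i: "i < n" for i
  proof -
    have "X $$ (i, l) * ?u $$ (l, i) = 0" if l: "l < n" for l
      using X0[of i l] u0[of l i] l i by (cases "l = 0 \<or> i = 0") auto
    then have "(X * ?u) $$ (i, i) = 0"
      using i X(1) by (subst mat_mult_index[of _ n n]) auto
    then show ?thesis
      unfolding X_def[symmetric] using i diag X by (simp del: index_mult_mat(1))
  qed
  note pj = jac_parity[OF y(1)]
  have inc: "jac n Inl Inl F ?y = ?A + ?A * ?m + ?B * ?v" "jac n Inr Inl F ?y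
      = ?C + ?C * ?m + ?D * ?v"
    by (rule jac_increment_mat[OF y(1) \<epsilon>]; simp)+
  have swap: "jac n p Inr F ?y = jac n p Inl F y * ?u + jac n p Inr F y + jac n p Inr F y * ?q"
    if "p = Inl \<or> p = Inr" for p
  proof -
    have J: "jac n p r F y \<in> carrier_mat n n" for r by (simp add: jac_def)
    have "jac n p Inr F y + jac n p Inl F y * ?u = jac n p Inl F y * ?u + jac n p Inr F y"
      by (rule comm_add_mat[OF J square_mat_closed(3)[OF J]]) simp
    then show ?thesis using jac_increment_mat[OF y(1) \<epsilon> that, of Inr] by simp
  qed
  have inc': "jac n Inl Inr F ?y = ?A * ?u + ?B + ?B * ?q" "jac n Inr Inr F ?y
      = ?C * ?u + ?D + ?D * ?q"
    by (rule swap; simp)+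
  show ?thesis
    unfolding Ber_eq_Ber_mat inc inc'
    by (rule Ber_mat_perturb[OF \<epsilon> pj(1,3,4,2) Ec DE eps par(1) eps par(2) eps par(3) eps d1 d2])
qed

text \<open>Besides the Berezinian, the root depends on the sign of the body of a determinant, and
  this body is not affected by an odd increment.\<close>

lemma sqrt_Ber_theta0:
  assumes y: "y \<in> fiber n x" "on_slice y" and \<epsilon>: "godd \<epsilon>"
  shows "sqrt_Ber n F (y(Inr 0 := y (Inr 0) + \<epsilon>)) = sqrt_Ber n F y"
proof -
  let ?y = "y(Inr 0 := y (Inr 0) + \<epsilon>)"
  have y': "?y \<in> fiber n x" using y(1) n_pos \<epsilon> by (intro fiber_update) (auto simp: godd_square)
  have "gbody (dF A B ?y) = gbody (dF A B y)" if "A \<in> sidx n" "B \<in> sidx n" for A B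
    using jac_increment[OF y(1) that \<epsilon>] gbody_godd[OF \<epsilon>] by (simp add: gbody_sum incr_def)
  then have "map_mat gbody (jac n Inl Inl F ?y) = map_mat gbody (jac n Inl Inl F y)"
    by (intro eq_matI) (auto simp: jac_def)
  then have "rbody (even_det (jac n Inl Inl F ?y)) = rbody (even_det (jac n Inl Inl F y))"
    using rbody_even_det[OF jac_parity(1)[OF y']] rbody_even_det[OF jac_parity(1)[OF y(1)]] by simp
  then show ?thesis unfolding sqrt_Ber_eq_sqrt_of Ber_theta0[OF assms] by simp
qed

text \<open>\<open>FM\<close> stands for the transition of the induced charts, which is built from
  an inverse on \<open>M\<close>. It is known to be the restriction of \<open>F\<close> only over
  the given body, which is all that derivatives there see.\<close>

lemma jac_induced:
  assumes n: "n = Suc k" and y: "y \<in> fiber n x" "on_slice y"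
    and FM: "\<And>p A. p \<in> fiber k (\<lambda>i. x (Suc i)) \<Longrightarrow> A \<in> sidx k \<Longrightarrow> FM p A = drop0 (F (insert0 p)) A"
    and pq: "p = Inl \<or> p = Inr" "q = Inl \<or> q = Inr"
  shows "jac k p q FM (drop0 y) = sub k y p q"
proof -
  have "pd A (\<lambda>p. FM p B) (drop0 y) = dF (sucidx A) (sucidx B) y" if AB: "A \<in> sidx k" "B \<in> sidx k"
      for A B
  proof -
    have f: "drop0 y \<in> fiber k (\<lambda>i. x (Suc i))" using fiber_drop0 y(1) n by blast
    have "pd A (\<lambda>p. FM p B) (drop0 y) = pd A (\<lambda>p. F (insert0 p) (sucidx B)) (drop0 y)"
      using FM AB(2) by (intro pd_cong[OF f AB(1)]) (simp add: drop0_sucidx)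
    also have "\<dots> = dF (sucidx A) (sucidx B) y"
    proof (rule pd_eqI)
      have hp: "has_pd (\<lambda>y. F y (sucidx B)) y (sucidx A) (dF (sucidx A) (sucidx B) y)"
        using AB n by (intro fiber_mapD(3)[OF F y(1)]) auto
      show "has_pd (\<lambda>p. F (insert0 p) (sucidx B)) (drop0 y) A (dF (sucidx A) (sucidx B) y)"
        unfolding has_pd_def insert0_update insert0_drop0[OF y(2)] drop0_sucidx
        using hp by (cases A) (simp_all add: has_pd_def)
    qed
    finally show ?thesis .
  qed
  then show ?thesis using pq by (intro eq_matI) (auto simp: jac_def)
qed

text \<open>The determinant fixing the branch acquires the same normal factor \<open>a\<close> whose
  square enters the Berezinian, so \<open>sqrt_of_scale\<close> extracts \<open>a\<close> with its
  sign.\<close>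

lemma sqrt_Ber_slice:
  assumes n: "n = Suc k" and y: "y \<in> fiber n x" "on_slice y"
    and FM: "\<And>p A. p \<in> fiber k (\<lambda>i. x (Suc i)) \<Longrightarrow> A \<in> sidx k \<Longrightarrow> FM p A = drop0 (F (insert0 p)) A"
  shows "sqrt_Ber n F y = dF (Inl 0) (Inl 0) y * sqrt_Ber k FM (drop0 y)"
proof -
  let ?a = "dF (Inl 0) (Inl 0) y" and ?d = "dF (Inr 0) (Inr 0) y"
  note J = jac_induced[OF n y FM]
  have a: "of_geven (to_geven ?a) = ?a" using normal_even(1)[OF y(1)] by (rule to_geven_simps(1))
  obtain E where E: "E \<in> carrier_mat k k" "sub k y Inr Inr * E = 1\<^sub>m k" "E * sub k y Inr Inr = 1\<^sub>m k"
    using mat_inverse_of_body[of "sub k y Inr Inr" k] sub_body_det[OF n y, of Inr] by auto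
  have q: "Ber k FM (drop0 y) = Ber_mat k (sub k y Inl Inl) (sub k y Inl Inr) (sub k y Inr Inl)
      (sub k y Inr Inr)"
    unfolding Ber_eq_Ber_mat using J by simp
  have qn: "Ber n F y = to_geven ?a * to_geven ?a * Ber k FM (drop0 y)"
    unfolding q
    unfolding Ber_eq_Ber_mat[of n] jac_slice[OF n y, of Inl Inl, simplified] jac_slice[OF n y, of
        Inl Inr, simplified]
      jac_slice[OF n y, of Inr Inl, simplified] jac_slice[OF n y, of Inr Inr, simplified]
          dF_normal_rl[OF y]
    unfolding n
    by (rule Ber_mat_bdiag[OF _ _ _ sub_parity(2)[OF n y(1)] E normal_even[OF y(1)]
        dF_normal_inverse[OF y]]) simp_all
  have ra: "rbody (to_geven ?a) \<noteq> 0"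
    using arg_cong[OF dF_normal_inverse[OF y], of gbody] by (auto simp: rbody_def a)
  have rq: "rbody (Ber k FM (drop0 y)) \<noteq> 0"
    unfolding q by (rule rbody_Ber_mat[OF sub_parity(1,3,4,2)[OF n y(1)] E sub_body_det[OF n y]]) simp
  let ?\<sigma> = "sgn (rbody (even_det (jac k Inl Inl FM (drop0 y))))"
  have \<sigma>: "?\<sigma> = 1 \<or> ?\<sigma> = -1"
    using sub_body_det[OF n y, of Inl] rbody_even_det[OF sub_parity(1)[OF n y(1)]] J[of Inl Inl]
    by (auto simp: sgn_if)
  have "even_det (jac n Inl Inl F y) = to_geven ?a * even_det (jac k Inl Inl FM (drop0 y))"
    using jac_slice[OF n y, of Inl Inl] J[of Inl Inl] even_det_bdiag[of "sub k y Inl Inl" k ?a]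
        by simp
  then have "sgn (rbody (even_det (jac n Inl Inl F y))) = sgn (rbody (to_geven ?a)) * ?\<sigma>"
    by (simp add: sgn_mult)
  then have "sqrt_Ber n F y = of_geven (to_geven ?a * (THE r. sqrt_of (Ber k FM (drop0 y)) ?\<sigma> r))"
    unfolding sqrt_Ber_eq_sqrt_of qn using sqrt_of_scale[OF ra rq \<sigma>] by simp
  then show ?thesis by (simp add: sqrt_Ber_eq_sqrt_of times_geven_ring.rep_eq a)
qed

end

section \<open>Restriction of superfunctions to the surface\<close>

definition ins0 :: "(nat \<Rightarrow> real) \<Rightarrow> nat \<Rightarrow> real" where
  "ins0 x = (\<lambda>i. case i of 0 \<Rightarrow> 0 | Suc j \<Rightarrow> x j)"

lemma ins0_simps [simp]: "ins0 x 0 = 0" "ins0 x (Suc i) = x i"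
  by (simp_all add: ins0_def)

lemma ins0_update: "ins0 (x(i := t)) = (ins0 x)(Suc i := t)"
  by (auto simp: ins0_def fun_eq_iff split: nat.split)

lemma ins0_rspace: "x \<in> rspace k \<Longrightarrow> ins0 x \<in> rspace (Suc k)"
  by (auto simp: rspace_def ins0_def split: nat.split)

lemma continuous_ins0: "continuous_on S ins0"
proof (rule continuous_on_coordinatewise_then_product)
  show "continuous_on S (\<lambda>x. ins0 x i)" for i
    by (cases i) (auto intro: continuous_on_subset[OF continuous_on_product_coordinates])
qed

lemma pbody_insert0: "pbody (insert0 y) = ins0 (pbody y)"
  by (auto simp: pbody_def insert0_def ins0_def fun_eq_iff split: nat.split)

lemma foldr_rpartial_ins0:
  "foldr rpartial js (\<lambda>x. g (ins0 x)) = (\<lambda>x. foldr rpartial (map Suc js) g (ins0 x))"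
proof (induction js)
  case (Cons j js)
  have "foldr rpartial (j # js) (\<lambda>x. g (ins0 x))
      = rpartial j (\<lambda>x. foldr rpartial (map Suc js) g (ins0 x))"
    by (simp add: Cons.IH)
  also have "\<dots> = (\<lambda>x. foldr rpartial (map Suc (j # js)) g (ins0 x))"
    by (simp add: rpartial_def ins0_update fun_eq_iff)
  finally show ?case .
qed simp

lemma smooth_ins0:
  assumes g: "smooth (Suc k) V g" and W: "\<And>x. x \<in> W \<Longrightarrow> ins0 x \<in> V"
  shows "smooth k W (\<lambda>x. g (ins0 x))"
  unfolding smooth_def
proof (intro allI impI conjI ballI)
  fix js assume "set js \<subseteq> {..<k}"
  then have js: "set (map Suc js) \<subseteq> {..<Suc k}" by auto
  have "continuous_on V (foldr rpartial (map Suc js) g)" using g js unfolding smooth_def by blast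
  then show "continuous_on W (foldr rpartial js (\<lambda>x. g (ins0 x)))"
    unfolding foldr_rpartial_ins0 using W by (intro continuous_on_compose2[OF _ continuous_ins0]) auto
  fix i x assume i: "i < k" and x: "x \<in> W"
  have "(\<lambda>t. foldr rpartial (map Suc js) g ((ins0 x)(Suc i := t))) differentiable at (ins0 x (Suc i))"
    using g js i W[OF x] unfolding smooth_def by (metis Suc_less_eq)
  then show "(\<lambda>t. foldr rpartial js (\<lambda>x. g (ins0 x)) (x(i := t))) differentiable at (x i)"
    unfolding foldr_rpartial_ins0 by (simp add: ins0_update)
qed

lemma open_dom_ins0:
  assumes "open_dom (Suc k) V"
  shows "open_dom k {x \<in> rspace k. ins0 x \<in> V}"
proof -
  obtain T where T: "open T" "V = rspace (Suc k) \<inter> T"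
    using assms unfolding open_dom_def openin_open by blast
  have "open (ins0 -` T)" using continuous_ins0 T(1) by (rule open_vimage[rotated])
  moreover have "{x \<in> rspace k. ins0 x \<in> V} = rspace k \<inter> ins0 -` T"
    using ins0_rspace T(2) by auto
  ultimately show ?thesis unfolding open_dom_def openin_open by blast
qed

lemma gsmooth_ins0:
  assumes c: "gsmooth (Suc k) V c" and W: "\<And>x. x \<in> W \<Longrightarrow> ins0 x \<in> V" "W \<subseteq> rspace k"
  shows "gsmooth k W (\<lambda>x. c (ins0 x))"
  unfolding gsmooth_def
proof (intro conjI allI ballI)
  show "smooth k W (\<lambda>x. gcoeff (c (ins0 x)) S)" for S
    using c by (intro smooth_ins0[OF _ W(1)]) (auto simp: gsmooth_def)
  fix x assume x: "x \<in> W"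
  then obtain V0 N where V0: "open_dom (Suc k) V0" "ins0 x \<in> V0" "finite N"
    "\<forall>y\<in>V0 \<inter> V. \<forall>S. gcoeff (c y) S \<noteq> 0 \<longrightarrow> S \<subseteq> N"
    using c W(1) unfolding gsmooth_def by meson
  have "\<forall>y\<in>{x \<in> rspace k. ins0 x \<in> V0} \<inter> W. \<forall>S. gcoeff (c (ins0 y)) S \<noteq> 0 \<longrightarrow> S \<subseteq> N"
    using V0(4) W(1) by blast
  then show "\<exists>V N. open_dom k V \<and> x \<in> V \<and> finite N \<and>
      (\<forall>y\<in>V \<inter> W. \<forall>S. gcoeff (c (ins0 y)) S \<noteq> 0 \<longrightarrow> S \<subseteq> N)"
    using open_dom_ins0[OF V0(1)] V0(2,3) x W(2)
    by (intro exI[of _ "{x \<in> rspace k. ins0 x \<in> V0}"] exI[of _ N] conjI) auto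
qed

lemma gpartials_ins0: "gpartials js (\<lambda>x. c (ins0 x)) x = gpartials (map Suc js) c (ins0 x)"
  unfolding gpartials_def foldr_rpartial_ins0[of js "\<lambda>y. gcoeff (c y) _"] ..

lemma gsoul_zero [simp]: "gsoul 0 = 0"
  by (simp add: gsoul_def)

text \<open>On the slice the soul of \<open>x^0\<close> is zero, so sequences containing the index 0
  drop out; the others are the shifted sequences of the smaller space.\<close>

lemma taylor_insert0: "taylor (Suc k) c (insert0 y) = taylor k (\<lambda>x. c (ins0 x)) y"
proof -
  have m: "soul_monomial (insert0 y) (map Suc js) = soul_monomial y js" for js
    by (simp add: soul_monomial_def comp_def)
  have z: "soul_monomial (insert0 y) is = 0" if "0 \<in> set is" for "is"
    using that by (induction "is") (auto simp: soul_monomial_def)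
  let ?S = "{js. set js \<subseteq> {..<k} \<and> soul_monomial y js \<noteq> 0}"
  have S: "{is. set is \<subseteq> {..<Suc k} \<and> soul_monomial (insert0 y) is \<noteq> 0} = map Suc ` ?S" (is "?L = _")
  proof (intro equalityI subsetI)
    fix "is" assume i: "is \<in> ?L"
    then have "0 \<notin> set is" using z by auto
    then have e: "is = map Suc (map (\<lambda>i. i - 1) is)"
      by (auto simp: comp_def intro!: map_idI[symmetric]) (metis Suc_pred neq0_conv)
    moreover have "map (\<lambda>i. i - 1) is \<in> ?S"
    proof -
      have "soul_monomial y (map (\<lambda>i. i - 1) is) \<noteq> 0" using i m e
          by (metis (mono_tags, lifting) mem_Collect_eq)
      moreover have "i - 1 < k" if "i \<in> set is" for i
        using that i \<open>0 \<notin> set is\<close> by (cases i) auto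
      ultimately show ?thesis by auto
    qed
    ultimately show "is \<in> map Suc ` ?S" by blast
  qed (auto simp: m)
  show ?thesis
    unfolding taylor_def S
    by (subst sum.reindex) (auto simp: inj_on_def inj_map_eq_map m gpartials_ins0 pbody_insert0)
qed

lemma sorted_list_of_Suc_image:
  assumes "finite I"
  shows "sorted_list_of_set (Suc ` I) = map Suc (sorted_list_of_set I)"
    and "sorted_list_of_set (insert 0 (Suc ` I)) = 0 # map Suc (sorted_list_of_set I)"
proof -
  show *: "sorted_list_of_set (Suc ` I) = map Suc (sorted_list_of_set I)"
    using assms by (intro sorted_distinct_set_unique) (auto simp: sorted_map distinct_map)
  have "sorted_list_of_set (insert 0 (Suc ` I)) = insort 0 (sorted_list_of_set (Suc ` I))"
    using assms by (subst sorted_list_of_set_insert) auto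
  then show "sorted_list_of_set (insert 0 (Suc ` I)) = 0 # map Suc (sorted_list_of_set I)"
    unfolding * by (cases "sorted_list_of_set I") auto
qed

text \<open>Being the smallest index, 0 puts \<theta>_0 in front of the monomial, so it splits off
  without a sign.\<close>

lemma odd_monomial_theta0:
  assumes "finite I"
  shows "odd_monomial ((insert0 y)(Inr 0 := h)) (Suc ` I) = odd_monomial y I"
    "odd_monomial ((insert0 y)(Inr 0 := h)) (insert 0 (Suc ` I)) = h * odd_monomial y I"
  unfolding odd_monomial_def sorted_list_of_Suc_image[OF assms] by (simp_all add: comp_def)

lemma sum_Pow_Suc:
  "(\<Sum>I\<in>Pow {..<Suc k}. f I) = (\<Sum>I\<in>Pow {..<k}. f (Suc ` I)) + (\<Sum>I\<in>Pow {..<k}. f (insert 0 (Suc ` I)))"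
proof -
  have L: "{..<Suc k} = insert 0 (Suc ` {..<k})" by (rule lessThan_Suc_eq_insert_0)
  have P: "Pow {..<Suc k} = (`) Suc ` Pow {..<k} \<union> insert 0 ` (`) Suc ` Pow {..<k}"
    unfolding L Pow_insert by (simp add: image_Pow_surj)
  have i1: "inj_on ((`) Suc) (Pow {..<k})" by (auto simp: inj_on_def inj_image_eq_iff)
  have i2: "inj_on (insert 0) ((`) Suc ` Pow {..<k})" by (auto simp: inj_on_def)
  have "(\<Sum>I\<in>Pow {..<Suc k}. f I) = sum f ((`) Suc ` Pow {..<k}) + sum f (insert 0 ` (`) Suc ` Pow
      {..<k})"
    unfolding P by (rule sum.union_disjoint) auto
  then show ?thesis
    by (simp add: sum.reindex[OF i1] sum.reindex[OF i2])
qed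

lemma superfunction_theta0_restrict:
  fixes f :: "'l::{linorder, infinite} spoint \<Rightarrow> 'l grassmann"
  assumes f: "superfunction (Suc k) V f" and W: "\<And>x. x \<in> W \<Longrightarrow> ins0 x \<in> V" "W \<subseteq> rspace k"
  shows "superfunction k W (\<lambda>y. pd (Inr 0) f (insert0 y))"
proof -
  obtain c where c: "\<And>I. I \<subseteq> {..<Suc k} \<Longrightarrow> gsmooth (Suc k) V (c I)"
    "\<And>z. z \<in> superdomain (Suc k) V \<Longrightarrow> f z = (\<Sum>I\<in>Pow {..<Suc k}. odd_monomial z I * taylor (Suc k)
        (c I) z)"
    using f unfolding superfunction_def by blast
  define c' where "c' I = (\<lambda>x. c (insert 0 (Suc ` I)) (ins0 x))" for I
  have "gsmooth k W (c' I)" if "I \<in> Pow {..<k}" for I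
    unfolding c'_def using that by (intro gsmooth_ins0[OF c(1) W]) auto
  moreover have "pd (Inr 0) f (insert0 y) = (\<Sum>I\<in>Pow {..<k}. odd_monomial y I * taylor k (c' I) y)"
    (is "_ = ?g") if y: "y \<in> superdomain k W" for y
  proof (rule pd_eqI)
    have yf: "insert0 y \<in> fiber (Suc k) (ins0 (pbody y))"
      using y insert0_svec by (auto simp: fiber_def superdomain_def pbody_insert0)
    have V: "ins0 (pbody y) \<in> V" using y W(1) by (simp add: superdomain_def)
    have val: "f ((insert0 y)(Inr 0 := h)) =
        (\<Sum>I\<in>Pow {..<k}. odd_monomial y I * taylor (Suc k) (c (Suc ` I)) (insert0 y)) + h * ?g"
      if h: "godd h" for h :: "'l grassmann"
    proof -
      have "(insert0 y)(Inr 0 := insert0 y (Inr 0) + h) \<in> fiber (Suc k) (ins0 (pbody y))"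
        using h by (intro fiber_update[OF yf]) (auto simp: godd_square)
      then have "(insert0 y)(Inr 0 := h) \<in> superdomain (Suc k) V"
        using fiber_superdomain V by auto
      then have "f ((insert0 y)(Inr 0 := h)) = (\<Sum>I\<in>Pow {..<Suc k}.
          odd_monomial ((insert0 y)(Inr 0 := h)) I * taylor (Suc k) (c I) ((insert0 y)(Inr 0 := h)))"
        by (rule c(2))
      \<comment> \<open>The Taylor factors see only even coordinates and do not notice the change of
        \<theta>_0.\<close>
      also have "\<dots> = (\<Sum>I\<in>Pow {..<Suc k}.
          odd_monomial ((insert0 y)(Inr 0 := h)) I * taylor (Suc k) (c I) (insert0 y))"
        by (simp add: taylor_def soul_monomial_def pbody_def)
      also have "\<dots> = (\<Sum>I\<in>Pow {..<k}. odd_monomial y I * taylor (Suc k) (c (Suc ` I)) (insert0 y))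
          + (\<Sum>I\<in>Pow {..<k}. h * (odd_monomial y I * taylor k (c' I) y))"
        unfolding sum_Pow_Suc
        by (intro arg_cong2[where f = "(+)"] sum.cong refl)
          (auto simp: odd_monomial_theta0 finite_subset[OF _ finite_lessThan] c'_def
              taylor_insert0 mult.assoc)
      finally show ?thesis by (simp add: sum_distrib_left)
    qed
    have "(insert0 y)(Inr 0 := 0) = insert0 y" by (auto simp: fun_eq_iff)
    then show "has_pd f (insert0 y) (Inr 0) ?g"
      using val val[of 0] by (simp add: has_pd_def godd_iff)
  qed
  ultimately show ?thesis unfolding superfunction_def by blast
qed

section \<open>The induced semidensity\<close>

lemma slice_system_iff:
  "(D, w) \<in> slice_systems n U M \<Longrightarrow> p \<in> D \<Longrightarrow> on_slice (w p) \<longleftrightarrow> p \<in> M"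
  by (auto simp: slice_systems_def on_slice_def)

text \<open>A common point of both domains brings its whole fiber with it, so the two transitions
  are mutually inverse over its body. Both charts cut out the same \<open>M\<close>, which gives the
  slice condition.\<close>

lemma transition_adapted_pair:
  fixes \<Omega> :: "'l::{linorder, infinite} two_form"
  assumes n: "0 < n" and \<Omega>: "odd_symplectic n U \<Omega>"
    and c: "(D, w) \<in> adjusted_systems n U \<Omega> M" and c': "(D', w') \<in> adjusted_systems n U \<Omega> M"
    and z: "z \<in> D" "z \<in> D'"
  shows "adapted_pair n (pbody (w z)) (pbody (w' z)) (w' \<circ> inv_into D w) (w \<circ> inv_into D' w')"
proof -
  have d: "(D, w) \<in> darboux_systems n U \<Omega>" "(D', w') \<in> darboux_systems n U \<Omega>"
    and sl: "(D, w) \<in> slice_systems n U M" "(D', w') \<in> slice_systems n U M"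
    using c c' by (auto simp: adjusted_systems_def)
  then have cs: "(D, w) \<in> coord_systems n U" "(D', w') \<in> coord_systems n U"
    by (auto simp: darboux_systems_def)
  note m = coord_system_fiber_maps[OF cs(1) z(1)] and m' = coord_system_fiber_maps[OF cs(2) z(2)]
  have p: "inv_into D w y \<in> D \<and> inv_into D w y \<in> D'" if "y \<in> fiber n (pbody (w z))" for y
    using fiber_mapD(1)[OF m(4) that] m(1) m'(1) by auto
  have p': "inv_into D' w' y \<in> D \<and> inv_into D' w' y \<in> D'" if "y \<in> fiber n (pbody (w' z))" for y
    using fiber_mapD(1)[OF m'(4) that] m(1) m'(1) by auto
  show ?thesis
  proof
    show "fiber_map n (pbody (w z)) (pbody (w' z)) (w' \<circ> inv_into D w)"
      by (rule fiber_map_compose[OF m(4) m'(3)])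
    show "fiber_map n (pbody (w' z)) (pbody (w z)) (w \<circ> inv_into D' w')"
      by (rule fiber_map_compose[OF m'(4) m(3)])
    show "(w \<circ> inv_into D' w') ((w' \<circ> inv_into D w) y) = y" if "y \<in> fiber n (pbody (w z))" for y
      using p[OF that] m(6)[OF that] m'(5) by simp
    show "(w' \<circ> inv_into D w) ((w \<circ> inv_into D' w') y) = y" if "y \<in> fiber n (pbody (w' z))" for y
      using p'[OF that] m'(6)[OF that] m(5) by simp
    show "on_slice ((w' \<circ> inv_into D w) y) \<longleftrightarrow> on_slice y" if "y \<in> fiber n (pbody (w z))" for y
      using p[OF that] m(6)[OF that] slice_system_iff[OF sl(1)] slice_system_iff[OF sl(2)]
          by (metis comp_apply)
    show "canonical_bracket n (\<lambda>y. (w' \<circ> inv_into D w) y C) (\<lambda>y. (w' \<circ> inv_into D w) y E) y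
        = kron C E"
      if "y \<in> fiber n (pbody (w z))" "C \<in> sidx n" "E \<in> sidx n" for y C E
      by (rule transition_canonical[OF \<Omega> d z that])
    show "canonical_bracket n (\<lambda>y. (w \<circ> inv_into D' w') y C) (\<lambda>y. (w \<circ> inv_into D' w') y E) y
        = kron C E"
      if "y \<in> fiber n (pbody (w' z))" "C \<in> sidx n" "E \<in> sidx n" for y C E
      by (rule transition_canonical[OF \<Omega> d(2,1) z(2,1) that])
  qed (rule n)
qed

lemma theta0_derivative_transform:
  fixes \<Omega> :: "'l::{linorder, infinite} two_form"
  assumes n: "n = Suc k" and \<Omega>: "odd_symplectic n U \<Omega>" and s: "semidensity n (coord_systems n U) s"
    and c: "(D, w) \<in> adjusted_systems n U \<Omega> M" and c': "(D', w') \<in> adjusted_systems n U \<Omega> M"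
    and z: "z \<in> M" "z \<in> D" "z \<in> D'"
  shows "pd (Inr 0) (s (D, w)) (w z) = pd (Inr 0) (s (D', w')) (w' z) *
    sqrt_Ber k (transition (induced_chart M (D, w)) (induced_chart M (D', w'))) (drop0 (w z))"
proof -
  define F where "F = w' \<circ> inv_into D w"
  interpret adapted_pair n "pbody (w z)" "pbody (w' z)" F "w \<circ> inv_into D' w'"
    unfolding F_def using n by (intro transition_adapted_pair[OF _ \<Omega> c c' z(2,3)]) simp
  have sl: "(D, w) \<in> slice_systems n U M" "(D', w') \<in> slice_systems n U M"
    using c c' by (auto simp: adjusted_systems_def)
  then have cs: "(D, w) \<in> coord_systems n U" "(D', w') \<in> coord_systems n U"
    by (auto simp: slice_systems_def)
  note m = coord_system_fiber_maps[OF cs(1) z(2)] and m' = coord_system_fiber_maps[OF cs(2) z(3)]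
  let ?y = "w z" and ?J = "sqrt_Ber n F (w z)"
  have y: "?y \<in> fiber n (pbody (w z))" "on_slice ?y"
    using m(7) slice_system_iff[OF sl(1) z(2)] z(1) by auto
  have Fy: "F ?y = w' z" using m(5)[OF z(2)] by (simp add: F_def)
  have transform: "s (D, w) p = s (D', w') (F p) * sqrt_Ber n F p"
      if p: "p \<in> fiber n (pbody (w z))" for p
  proof -
    have "inv_into D w p \<in> D \<inter> D'" using fiber_mapD(1)[OF m(4) p] m(1) m'(1) by auto
    then have "s (D, w) (w (inv_into D w p)) = s (D', w') (w' (inv_into D w p)) *
        sqrt_Ber n (transition (D, w) (D', w')) (w (inv_into D w p))"
      using s cs unfolding semidensity_def by blast
    moreover have "transition (D, w) (D', w') = F" by (simp add: transition_def F_def)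
    ultimately show ?thesis using m(6)[OF p] by (simp add: F_def)
  qed
  have idx: "Inr 0 \<in> sidx n" using n by simp
  let ?d = "dF (Inr 0) (Inr 0) ?y" and ?g = "pd (Inr 0) (s (D', w')) (w' z)"
  have g: "has_pd (s (D', w')) (w' z) (Inr 0) ?g"
  proof -
    have "superfunction n (pbody ` w' ` D') (s (D', w'))"
      using s cs(2) unfolding semidensity_def by blast
    then have "sdiff n (pbody (w' z)) 1 (s (D', w'))"
      using z(3) by (intro superfunction_sdiff) auto
    then show ?thesis using m'(7) idx by (intro sdiff_has_pd[of n _ 1]) auto
  qed
  have "has_pd (s (D, w)) ?y (Inr 0) (?d * ?g * ?J)"
    unfolding has_pd_def
  proof (intro allI impI)
    fix h :: "'l grassmann" assume h: "has_parity (Inr 0) h \<and> h * h = 0"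
    let ?y1 = "?y(Inr 0 := ?y (Inr 0) + h)"
    have y1: "?y1 \<in> fiber n (pbody (w z))" using fiber_update[OF y(1) idx] h by blast
    have z0: "dF (Inr 0) B ?y = 0" if "B \<in> sidx n" "B \<noteq> Inr 0" for B
    proof (cases B)
      case (Inl i)
      then show ?thesis using dF_normal(1)[OF y, of i] dF_normal_rl[OF y] that by (cases "i = 0") auto
    next
      case (Inr i)
      then show ?thesis using dF_normal(2)[OF y, of i] that by (cases "i = 0") auto
    qed
    \<comment> \<open>Among the derivatives along \<theta>_0 only that of the new \<theta>_0
      survives. The image point moves by the odd increment \<open>h * ?d\<close> in this coordinate
      alone, so \<open>?g\<close> applies.\<close>
    have "F ?y1 = shift (F ?y) h (\<lambda>B. dF (Inr 0) B ?y) (sidx n)"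
      using h by (intro fiber_map_update(1)[OF F y(1) idx]) auto
    also have "\<dots> = (w' z)(Inr 0 := w' z (Inr 0) + h * ?d)"
      using z0 idx by (auto simp: shift_def Fy fun_eq_iff)
    finally have Fy1: "F ?y1 = (w' z)(Inr 0 := w' z (Inr 0) + h * ?d)" .
    have hd: "has_parity (Inr 0) (h * ?d)" "h * ?d * (h * ?d) = 0"
      using h normal_even(2)[OF y(1)] eps_null[of h] by (auto simp: godd_iff geven_iff)
    have "s (D, w) ?y1 = s (D', w') (F ?y1) * sqrt_Ber n F ?y1" by (rule transform[OF y1])
    also have "sqrt_Ber n F ?y1 = ?J" using h by (intro sqrt_Ber_theta0[OF y]) auto
    also have "s (D', w') (F ?y1) = s (D', w') (w' z) + h * ?d * ?g"
      unfolding Fy1 by (rule has_pdD[OF g hd])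
    finally have s1: "s (D, w) ?y1 = (s (D', w') (w' z) + h * ?d * ?g) * ?J" .
    show "s (D, w) ?y1 = s (D, w) ?y + h * (?d * ?g * ?J)"
      unfolding s1 transform[OF y(1)] Fy by (simp add: algebra_simps)
  qed
  then have pd: "pd (Inr 0) (s (D, w)) ?y = ?d * ?g * ?J" by (rule pd_eqI)
  let ?FM = "transition (induced_chart M (D, w)) (induced_chart M (D', w'))"
  have x0: "pbody (w z) 0 = 0" using y(2) by (simp add: pbody_def on_slice_def)
  have FM: "?FM p A = drop0 (F (insert0 p)) A" if p: "p \<in> fiber k (\<lambda>i. pbody (w z) (Suc i))" for p A
  proof -
    have ip: "insert0 p \<in> fiber n (pbody (w z))" using fiber_insert0[OF p] x0 n by simp
    define q where "q = inv_into D w (insert0 p)"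
    have wq: "w q = insert0 p" unfolding q_def by (rule m(6)[OF ip])
    have qD: "q \<in> D" using fiber_mapD(1)[OF m(4) ip] m(1) by (auto simp: q_def)
    then have qM: "q \<in> M \<inter> D" using slice_system_iff[OF sl(1) qD] on_slice_insert0[of p] wq by simp
    \<comment> \<open>On \<open>M\<close> the forgotten coordinates are zero and can be restored by
      \<open>insert0\<close>; hence the inverse of the induced chart picks the point given by the
      inverse of \<open>w\<close>.\<close>
    have "inj_on (drop0 \<circ> w) (M \<inter> D)"
    proof (rule inj_onI)
      fix a b assume ab: "a \<in> M \<inter> D" "b \<in> M \<inter> D" "(drop0 \<circ> w) a = (drop0 \<circ> w) b"
      have slice_ab: "on_slice (w a)" "on_slice (w b)"
        using ab(1,2) slice_system_iff[OF sl(1), of a] slice_system_iff[OF sl(1), of b] by auto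
      have "w a = insert0 (drop0 (w a))" by (rule insert0_drop0[OF slice_ab(1), symmetric])
      also have "\<dots> = insert0 (drop0 (w b))" using ab(3) by (simp only: comp_apply)
      also have "\<dots> = w b" by (rule insert0_drop0[OF slice_ab(2)])
      finally have "inv_into D w (w a) = inv_into D w (w b)" by (rule arg_cong)
      then show "a = b" using m(5)[of a] m(5)[of b] ab(1,2) by (simp only: Int_iff)
    qed
    then have "inv_into (M \<inter> D) (drop0 \<circ> w) ((drop0 \<circ> w) q) = q" using qM by (rule inv_into_f_f)
    then have "inv_into (M \<inter> D) (drop0 \<circ> w) p = q" by (simp add: wq)
    then show ?thesis by (simp add: transition_def induced_chart_def F_def q_def)
  qed
  have J: "?J = dF (Inl 0) (Inl 0) ?y * sqrt_Ber k ?FM (drop0 ?y)"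
    by (rule sqrt_Ber_slice[OF n y FM])
  have "?d * ?g * ?J = ?g * ((?d * dF (Inl 0) (Inl 0) ?y) * sqrt_Ber k ?FM (drop0 ?y))"
    unfolding J geven_commute[OF normal_even(2)[OF y(1)], of ?g] by (simp only: mult.assoc)
  then show ?thesis using pd normal_inverse'[OF y] by simp
qed

theorem mainTheorem2:
  fixes n :: nat
    and U :: "(nat \<Rightarrow> real) set"
    and \<Omega> :: "'l::{linorder, infinite} two_form"
    and s :: "'l chart \<Rightarrow> 'l spoint \<Rightarrow> 'l grassmann"
  assumes "1 \<le> n"
    and "open_dom n U"
    and "odd_symplectic n U \<Omega>"
    and "semidensity n (coord_systems n U) s"
  shows "\<exists>\<A> :: 'l spoint set \<Rightarrow> 'l chart \<Rightarrow> 'l spoint \<Rightarrow> 'l grassmann.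
    \<forall>M. nondegenerate_surface n U \<Omega> M \<longrightarrow>
      semidensity (n - 1) (induced_chart M ` adjusted_systems n U \<Omega> M) (\<A> M) \<and>
      (\<forall>c\<in>adjusted_systems n U \<Omega> M. \<forall>z\<in>M \<inter> fst c.
         \<A> M (induced_chart M c) (drop0 (snd c z)) = pd (Inr 0) (s c) (snd c z))"
proof -
  obtain k where n: "n = Suc k" using assms(1) by (cases n) auto
  \<comment> \<open>Any ambient chart inducing \<open>ch\<close> will do; \<open>chart_value\<close>
    shows that the choice is immaterial.\<close>
  define pick where "pick M ch = (SOME c. c \<in> adjusted_systems n U \<Omega> M \<and> induced_chart M c = ch)"
      for M and ch :: "'l chart"
  define \<A> where "\<A> M ch = (\<lambda>y. pd (Inr 0) (s (pick M ch)) (insert0 y))" for M ch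
  have pick: "pick M (induced_chart M c) \<in> adjusted_systems n U \<Omega> M \<and> induced_chart M (pick M
      (induced_chart M c)) = induced_chart M c"
    if "c \<in> adjusted_systems n U \<Omega> M" for M c
    unfolding pick_def by (rule someI[of _ c]) (use that in simp)
  note transform = theta0_derivative_transform[OF n assms(3,4)]
  have slice0: "insert0 (drop0 (w z)) = w z" if "(D, w) \<in> adjusted_systems n U \<Omega> M" "z \<in> M" "z \<in>
      D" for D w M z
    using that slice_system_iff[of D w n U M z] by
        (intro insert0_drop0) (auto simp: adjusted_systems_def)
  have chart_value: "\<A> M (induced_chart M (D, w)) (drop0 (w z)) = pd (Inr 0) (s (D, w)) (w z)"
    if c: "(D, w) \<in> adjusted_systems n U \<Omega> M" and z: "z \<in> M" "z \<in> D" for M D w z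
  proof -
    obtain D0 w0 where c0: "pick M (induced_chart M (D, w)) = (D0, w0)" by (meson surj_pair)
    then have adj: "(D0, w0) \<in> adjusted_systems n U \<Omega> M"
      and ind: "induced_chart M (D0, w0) = induced_chart M (D, w)" using pick[OF c] by auto
    from ind have z0: "z \<in> D0" "drop0 (w0 z) = drop0 (w z)"
      using z by (auto simp: induced_chart_def fun_eq_iff)
    have "\<A> M (induced_chart M (D, w)) (drop0 (w z)) = pd (Inr 0) (s (D0, w0)) (w0 z)"
      unfolding \<A>_def c0 z0(2)[symmetric] slice0[OF adj z(1) z0(1)] ..
    \<comment> \<open>The chosen chart and the given one induce the same chart, so passing from
      either of them to the given one involves the same root factor. Comparing the two
      transformation laws avoids evaluating the root for the identity.\<close>
    also have "\<dots> = pd (Inr 0) (s (D, w)) (w z)"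
      using transform[OF adj c z(1) z0(1) z(2)] transform[OF c c z z(2)] by (simp add: ind z0(2))
    finally show ?thesis .
  qed
  have super: "superfunction k (pbody ` (drop0 \<circ> w) ` (M \<inter> D)) (\<A> M (induced_chart M (D, w)))"
    if c: "(D, w) \<in> adjusted_systems n U \<Omega> M" for M D w
  proof -
    obtain D0 w0 where c0: "pick M (induced_chart M (D, w)) = (D0, w0)" by (meson surj_pair)
    then have adj: "(D0, w0) \<in> adjusted_systems n U \<Omega> M"
      and ind: "induced_chart M (D0, w0) = induced_chart M (D, w)" using pick[OF c] by auto
    have cs: "(D0, w0) \<in> coord_systems n U" using adj
        by (auto simp: adjusted_systems_def slice_systems_def)
    \<comment> \<open>The coefficient is computed in the chosen ambient chart, while its domain
      refers to the given one; the domain depends only on the induced chart.\<close>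
    have W: "pbody ` (drop0 \<circ> w) ` (M \<inter> D) = pbody ` (drop0 \<circ> w0) ` (M \<inter> D0)"
      using ind by (simp add: induced_chart_def)
    have "superfunction n (pbody ` w0 ` D0) (s (D0, w0))"
      using assms(4) cs unfolding semidensity_def by blast
    moreover have "ins0 x \<in> pbody ` w0 ` D0" if x: "x \<in> pbody ` (drop0 \<circ> w0) ` (M \<inter> D0)" for x
    proof -
      obtain q where q: "q \<in> M" "q \<in> D0" "x = pbody (drop0 (w0 q))" using x by auto
      have "ins0 x = pbody (w0 q)"
        unfolding q(3) pbody_insert0[symmetric] slice0[OF adj q(1,2)] ..
      then show ?thesis using q(2) by blast
    qed
    moreover have "pbody ` (drop0 \<circ> w0) ` (M \<inter> D0) \<subseteq> rspace k"
    proof (clarsimp)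
      fix q assume "q \<in> D0"
      then have "w0 q \<in> svec (Suc k)" using coord_system_fiber_maps(7)[OF cs] n fiber_svec by blast
      then have "drop0 (w0 q) \<in> svec k" by (rule drop0_svec)
      then show "pbody (drop0 (w0 q)) \<in> rspace k"
        using svec_zero[of "drop0 (w0 q)" k "Inl _"] by (auto simp: rspace_def pbody_def)
    qed
    ultimately show ?thesis
      unfolding W \<A>_def c0 n by (rule superfunction_theta0_restrict)
  qed
  show ?thesis
  proof (intro exI[of _ \<A>] allI impI conjI)
    fix M
    show "semidensity (n - 1) (induced_chart M ` adjusted_systems n U \<Omega> M) (\<A> M)"
      unfolding semidensity_def
    proof (intro conjI ballI, goal_cases)
      case (1 ch)
      then obtain D w where c: "(D, w) \<in> adjusted_systems n U \<Omega> M" "ch = induced_chart M (D, w)"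
          by auto
      then show ?case using super[OF c(1)] n by (simp add: induced_chart_def image_comp)
    next
      case (2 ch)
      then obtain D w where c: "(D, w) \<in> adjusted_systems n U \<Omega> M" "ch = induced_chart M (D, w)"
          by auto
      have "case ch' of (E, v) \<Rightarrow> \<forall>z\<in>(M \<inter> D) \<inter> E. \<A> M ch (drop0 (w z)) =
          \<A> M ch' (v z) * sqrt_Ber k (transition ch ch') (drop0 (w z))"
        if "ch' \<in> induced_chart M ` adjusted_systems n U \<Omega> M" for ch'
      proof -
        obtain D' w' where c': "(D', w') \<in> adjusted_systems n U \<Omega> M" "ch' = induced_chart M (D', w')"
          using \<open>ch' \<in> _\<close> by auto
        have "\<A> M ch (drop0 (w z)) = \<A> M ch' (drop0 (w' z)) * sqrt_Ber k (transition ch ch')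
            (drop0 (w z))"
          if z: "z \<in> M" "z \<in> D" "z \<in> D'" for z
          unfolding c(2) c'(2) chart_value[OF c(1) z(1,2)] chart_value[OF c'(1) z(1,3)]
          by (rule transform[OF c(1) c'(1) z])
        then show ?thesis by (simp add: c'(2) induced_chart_def)
      qed
      then have "\<forall>ch'\<in>induced_chart M ` adjusted_systems n U \<Omega> M. case ch' of (E, v) \<Rightarrow>
          \<forall>z\<in>(M \<inter> D) \<inter> E. \<A> M ch (drop0 (w z)) =
          \<A> M ch' (v z) * sqrt_Ber k (transition ch ch') (drop0 (w z))" by blast
      then show ?case
        using n by (simp add: c(2) induced_chart_def case_prod_beta)
    qed
    show "\<forall>c\<in>adjusted_systems n U \<Omega> M. \<forall>z\<in>M \<inter> fst c.
        \<A> M (induced_chart M c) (drop0 (snd c z)) = pd (Inr 0) (s c) (snd c z)"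
      using chart_value by auto
  qed
qed

end
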